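(* Let $w$ be an even finite signed Borel measure on $\mathbb R^d$, let $f\in L^2(\mathbb R^d)$ be nonnegative, and set $$\theta(\xi)=|\xi|^2+\int_{\mathbb R^d}w\,dx\int_{\mathbb R^d}f^2\,d\xi-(2\pi)^{d/2}(\hat w*f^2)(\xi),\qquad Y_f(t,x)=\int_{\mathbb R^d}f(\xi)e^{i(\xi x-\theta(\xi)t)}\,dW(\xi).$$ Then $Y_f$ is a solution of $$i\partial_tX=-\Delta X+(w*\mathbb E[|X|^2])X-\int_{\mathbb R^d}w(x-y)\,\mathbb E[\overline{X(y)}X(x)]\,X(y)\,dy ,$$ and $Y_f$ is a Gaussian field whose probability law is invariant under time translations and under space translations (so that it is an equilibrium of the equation).
   Context: $(\Omega,\mathcal A,\mathbb P)$ is a probability space with expectation $\mathbb E$, and unknowns $X:\mathbb R\times\mathbb R^d\times\Omega\to\mathbb C$ are random fields. $dW$ is the complex (circularly symmetric) Wiener integral: $dW(\xi)$ are infinitesimal centred complex Gaussian variables with $\mathbb E[\overline{dW(\xi)}dW(\xi')]=\delta(\xi-\xi')d\xi d\xi'$. The Fourier transform is $\hat h(\xi)=(2\pi)^{-d/2}\int e^{-ix\xi}h(x)dx$, also for measures; $\int w(x-y)h(y)\,dy$ denotes convolution with the measure $w$. The equation is understood in the sense of distributions in $(t,x)$ with values in $L^2(\Omega)$. *)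

theory Defs
  imports "HOL-Probability.Probability"
begin

section \<open>Square-integrable functions and random variables\<close>

definition square_integrable :: "'a measure \<Rightarrow> ('a \<Rightarrow> complex) \<Rightarrow> bool" where
  "square_integrable N g \<longleftrightarrow>
     g \<in> borel_measurable N \<and> integrable N (\<lambda>x. (cmod (g x))\<^sup>2)"

definition L2_norm :: "'a measure \<Rightarrow> ('a \<Rightarrow> complex) \<Rightarrow> real" where
  "L2_norm N g = sqrt (\<integral>x. (cmod (g x))\<^sup>2 \<partial>N)"

text \<open>
  Bochner integral of a map \<open>U\<close> with values in \<open>L\<^sup>2(M)\<close>. As \<open>L\<^sup>2(M)\<close> depends on the measure
  \<open>M\<close> it is not a type, and the integral is a relation: \<open>V\<close> is a representative of the
  integral of \<open>U\<close>. The approximating simple functions are finite sums of indicators of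
  finite-measure sets times elements of \<open>L\<^sup>2(M)\<close>. The measurability clause is needed
  because \<open>nn_integral\<close> of a non-measurable function is only a lower integral.
\<close>

definition has_L2_integral ::
  "'z measure \<Rightarrow> 'w measure \<Rightarrow> ('z \<Rightarrow> 'w \<Rightarrow> complex) \<Rightarrow> ('w \<Rightarrow> complex) \<Rightarrow> bool" where
  "has_L2_integral N M U V \<longleftrightarrow>
     (\<forall>z\<in>space N. square_integrable M (U z)) \<and> square_integrable M V \<and>
     (\<exists>(n :: nat \<Rightarrow> nat) (A :: nat \<Rightarrow> nat \<Rightarrow> 'z set) (Z :: nat \<Rightarrow> nat \<Rightarrow> 'w \<Rightarrow> complex).
        (\<forall>j k. A j k \<in> sets N \<and> emeasure N (A j k) < \<infinity> \<and> square_integrable M (Z j k)) \<and>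
        (\<forall>j. (\<lambda>z. L2_norm M (\<lambda>\<omega>. U z \<omega> - (\<Sum>k<n j. of_real (indicator (A j k) z) * Z j k \<omega>)))
               \<in> borel_measurable N) \<and>
        (\<lambda>j. \<integral>\<^sup>+ z. ennreal (L2_norm M
               (\<lambda>\<omega>. U z \<omega> - (\<Sum>k<n j. of_real (indicator (A j k) z) * Z j k \<omega>))) \<partial>N)
          \<longlonglongrightarrow> 0 \<and>
        (\<lambda>j. L2_norm M
               (\<lambda>\<omega>. V \<omega> - (\<Sum>k<n j. of_real (measure N (A j k)) * Z j k \<omega>)))
          \<longlonglongrightarrow> 0)"


section \<open>Finite signed Borel measures\<close>

definition finite_signed_measure :: "('a::topological_space set \<Rightarrow> real) \<Rightarrow> bool" where
  "finite_signed_measure w \<longleftrightarrow> w {} = 0 \<and>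
     (\<forall>A :: nat \<Rightarrow> 'a set. range A \<subseteq> sets borel \<and> disjoint_family A \<longrightarrow>
        (\<lambda>n. w (A n)) sums w (\<Union>n. A n))"

definition even_signed_measure :: "('a::{topological_space,uminus} set \<Rightarrow> real) \<Rightarrow> bool" where
  "even_signed_measure w \<longleftrightarrow> (\<forall>A\<in>sets borel. w (uminus ` A) = w A)"

text \<open>
  Jordan decomposition: the positive variation is \<open>A \<mapsto> sup {w B | B \<subseteq> A Borel}\<close>. The
  truncation of negative values by \<open>ennreal\<close> is harmless, since \<open>B = {}\<close> is admissible.
\<close>

definition pos_variation :: "('a::topological_space set \<Rightarrow> real) \<Rightarrow> 'a measure" where
  "pos_variation w =
     measure_of UNIV (sets borel) (\<lambda>A. SUP B\<in>{B \<in> sets borel. B \<subseteq> A}. ennreal (w B))"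

definition neg_variation :: "('a::topological_space set \<Rightarrow> real) \<Rightarrow> 'a measure" where
  "neg_variation w = pos_variation (\<lambda>A. - w A)"

definition signed_integrable ::
  "('a::topological_space set \<Rightarrow> real) \<Rightarrow> ('a \<Rightarrow> 'b::{banach,second_countable_topology}) \<Rightarrow> bool" where
  "signed_integrable w g \<longleftrightarrow> integrable (pos_variation w) g \<and> integrable (neg_variation w) g"

definition signed_integral ::
  "('a::topological_space set \<Rightarrow> real) \<Rightarrow> ('a \<Rightarrow> 'b::{banach,second_countable_topology}) \<Rightarrow> 'b" where
  "signed_integral w g = integral\<^sup>L (pos_variation w) g - integral\<^sup>L (neg_variation w) g"

definition has_signed_L2_integral ::
  "('a::topological_space set \<Rightarrow> real) \<Rightarrow> 'w measure \<Rightarrow> ('a \<Rightarrow> 'w \<Rightarrow> complex)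
     \<Rightarrow> ('w \<Rightarrow> complex) \<Rightarrow> bool" where
  "has_signed_L2_integral w M U V \<longleftrightarrow>
     (\<exists>V1 V2. has_L2_integral (pos_variation w) M U V1 \<and>
              has_L2_integral (neg_variation w) M U V2 \<and>
              square_integrable M V \<and> (AE \<omega> in M. V \<omega> = V1 \<omega> - V2 \<omega>))"

definition fourier_measure :: "((real ^ 'd) set \<Rightarrow> real) \<Rightarrow> real ^ 'd \<Rightarrow> complex" where
  "fourier_measure w \<xi> = of_real ((2 * pi) powr (- (real CARD('d) / 2))) *
     signed_integral w (\<lambda>x. exp (- \<i> * of_real (x \<bullet> \<xi>)))"


section \<open>Gaussian families, complex white noise and the Wiener integral\<close>

definition real_gaussian :: "'w measure \<Rightarrow> ('w \<Rightarrow> real) \<Rightarrow> bool" where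
  "real_gaussian M R \<longleftrightarrow> R \<in> borel_measurable M \<and>
     (\<exists>\<mu> \<sigma>. (\<sigma> = 0 \<and> (AE \<omega> in M. R \<omega> = \<mu>)) \<or>
            (\<sigma> > 0 \<and> distributed M lborel R (\<lambda>x. ennreal (normal_density \<mu> \<sigma> x))))"

text \<open>
  With complex coefficients \<open>c\<close>, the real parts below are exactly the real linear combinations
  of the real and imaginary parts of the members of the family.
\<close>

definition gaussian_family :: "'w measure \<Rightarrow> 'i set \<Rightarrow> ('i \<Rightarrow> 'w \<Rightarrow> complex) \<Rightarrow> bool" where
  "gaussian_family M I X \<longleftrightarrow>
     (\<forall>i\<in>I. X i \<in> borel_measurable M) \<and>
     (\<forall>J c. finite J \<and> J \<subseteq> I \<longrightarrow> real_gaussian M (\<lambda>\<omega>. Re (\<Sum>j\<in>J. c j * X j \<omega>)))"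

definition finite_borel_sets :: "'a::euclidean_space set set" where
  "finite_borel_sets = {A \<in> sets borel. emeasure lborel A < \<infinity>}"

text \<open>
  \<open>W A\<close> is the integral of \<open>dW\<close> over \<open>A\<close>; the vanishing of \<open>E[W A W B]\<close> is circular symmetry.
\<close>

definition complex_white_noise ::
  "'w measure \<Rightarrow> ('a::euclidean_space set \<Rightarrow> 'w \<Rightarrow> complex) \<Rightarrow> bool" where
  "complex_white_noise M W \<longleftrightarrow>
     gaussian_family M finite_borel_sets W \<and>
     (\<forall>A\<in>finite_borel_sets. (\<integral>\<omega>. W A \<omega> \<partial>M) = 0) \<and>
     (\<forall>A\<in>finite_borel_sets. \<forall>B\<in>finite_borel_sets.
        (\<integral>\<omega>. cnj (W A \<omega>) * W B \<omega> \<partial>M) = of_real (measure lborel (A \<inter> B)) \<and>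
        (\<integral>\<omega>. W A \<omega> * W B \<omega> \<partial>M) = 0)"

definition has_wiener_integral ::
  "'w measure \<Rightarrow> ('a::euclidean_space set \<Rightarrow> 'w \<Rightarrow> complex) \<Rightarrow> ('a \<Rightarrow> complex)
     \<Rightarrow> ('w \<Rightarrow> complex) \<Rightarrow> bool" where
  "has_wiener_integral M W h Z \<longleftrightarrow>
     square_integrable lborel h \<and> square_integrable M Z \<and>
     (\<exists>(n :: nat \<Rightarrow> nat) (A :: nat \<Rightarrow> nat \<Rightarrow> 'a set) (c :: nat \<Rightarrow> nat \<Rightarrow> complex).
        (\<forall>j k. A j k \<in> finite_borel_sets) \<and>
        (\<lambda>j. L2_norm lborel (\<lambda>\<xi>. h \<xi> - (\<Sum>k<n j. c j k * of_real (indicator (A j k) \<xi>))))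
          \<longlonglongrightarrow> 0 \<and>
        (\<lambda>j. L2_norm M (\<lambda>\<omega>. Z \<omega> - (\<Sum>k<n j. c j k * W (A j k) \<omega>))) \<longlonglongrightarrow> 0)"

text \<open>The integral is only determined almost surely; an arbitrary version is chosen.\<close>

definition wiener_integral ::
  "'w measure \<Rightarrow> ('a::euclidean_space set \<Rightarrow> 'w \<Rightarrow> complex) \<Rightarrow> ('a \<Rightarrow> complex) \<Rightarrow> 'w \<Rightarrow> complex" where
  "wiener_integral M W h = (SOME Z. has_wiener_integral M W h Z)"


section \<open>Test functions\<close>

definition dir_deriv ::
  "'a::real_normed_vector \<Rightarrow> ('a \<Rightarrow> complex) \<Rightarrow> 'a \<Rightarrow> complex" where
  "dir_deriv v \<phi> = (\<lambda>z. frechet_derivative \<phi> (at z) v)"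

primrec times_differentiable :: "nat \<Rightarrow> ('a::real_normed_vector \<Rightarrow> complex) \<Rightarrow> bool" where
  "times_differentiable 0 \<phi> \<longleftrightarrow> continuous_on UNIV \<phi>"
| "times_differentiable (Suc k) \<phi> \<longleftrightarrow>
     (\<forall>z. \<phi> differentiable (at z)) \<and> (\<forall>v. times_differentiable k (dir_deriv v \<phi>))"

definition test_function :: "('a::real_normed_vector \<Rightarrow> complex) \<Rightarrow> bool" where
  "test_function \<phi> \<longleftrightarrow>
     (\<forall>k. times_differentiable k \<phi>) \<and> compact (closure {z. \<phi> z \<noteq> 0})"

definition time_deriv :: "(real \<times> (real ^ 'd) \<Rightarrow> complex) \<Rightarrow> real \<times> (real ^ 'd) \<Rightarrow> complex" where
  "time_deriv \<phi> = dir_deriv (1, 0) \<phi>"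

definition space_laplacian :: "(real \<times> (real ^ 'd) \<Rightarrow> complex) \<Rightarrow> real \<times> (real ^ 'd) \<Rightarrow> complex" where
  "space_laplacian \<phi> = (\<lambda>z. \<Sum>b\<in>Basis. dir_deriv (0, b) (dir_deriv (0, b) \<phi>) z)"


section \<open>The equation\<close>

text \<open>
  The value, in \<open>L\<^sup>2(M)\<close>, of the distribution defined by the field \<open>X\<close> at the function \<open>\<phi>\<close>.
\<close>

definition has_pairing ::
  "'w measure \<Rightarrow> (real \<Rightarrow> real ^ 'd \<Rightarrow> 'w \<Rightarrow> complex) \<Rightarrow> (real \<times> (real ^ 'd) \<Rightarrow> complex)
     \<Rightarrow> ('w \<Rightarrow> complex) \<Rightarrow> bool" where
  "has_pairing M X \<phi> V \<longleftrightarrow> has_L2_integral lborel M (\<lambda>(t, x) \<omega>. \<phi> (t, x) * X t x \<omega>) V"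

definition correlation ::
  "'w measure \<Rightarrow> (real \<Rightarrow> real ^ 'd \<Rightarrow> 'w \<Rightarrow> complex) \<Rightarrow> real \<Rightarrow> real ^ 'd \<Rightarrow> real ^ 'd \<Rightarrow> complex" where
  "correlation M X t y x = (\<integral>\<omega>. cnj (X t y \<omega>) * X t x \<omega> \<partial>M)"

text \<open>
  Convolution with the measure \<open>w\<close>: \<open>\<integral> w(x - y) h(y) dy\<close> means \<open>\<integral> h(x - z) dw(z)\<close>.
\<close>

definition direct_potential ::
  "'w measure \<Rightarrow> ((real ^ 'd) set \<Rightarrow> real) \<Rightarrow> (real \<Rightarrow> real ^ 'd \<Rightarrow> 'w \<Rightarrow> complex)
     \<Rightarrow> real \<Rightarrow> real ^ 'd \<Rightarrow> real" where
  "direct_potential M w X t x =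
     signed_integral w (\<lambda>z. \<integral>\<omega>. (cmod (X t (x - z) \<omega>))\<^sup>2 \<partial>M)"

definition is_exchange_term ::
  "'w measure \<Rightarrow> ((real ^ 'd) set \<Rightarrow> real) \<Rightarrow> (real \<Rightarrow> real ^ 'd \<Rightarrow> 'w \<Rightarrow> complex)
     \<Rightarrow> (real \<Rightarrow> real ^ 'd \<Rightarrow> 'w \<Rightarrow> complex) \<Rightarrow> bool" where
  "is_exchange_term M w X E \<longleftrightarrow>
     (\<forall>t x. has_signed_L2_integral w M
        (\<lambda>z \<omega>. correlation M X t (x - z) x * X t (x - z) \<omega>) (E t x))"

text \<open>
  Derivatives are moved to the test function, so \<open>\<i> \<partial>\<^sub>t X\<close> takes the value \<open>- \<i> A\<close> and \<open>- \<Delta> X\<close>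
  the value \<open>- B\<close>.
\<close>

definition is_solution ::
  "'w measure \<Rightarrow> ((real ^ 'd) set \<Rightarrow> real) \<Rightarrow> (real \<Rightarrow> real ^ 'd \<Rightarrow> 'w \<Rightarrow> complex) \<Rightarrow> bool" where
  "is_solution M w X \<longleftrightarrow>
     (\<forall>t x. square_integrable M (X t x)) \<and>
     (\<forall>t x. signed_integrable w (\<lambda>z. \<integral>\<omega>. (cmod (X t (x - z) \<omega>))\<^sup>2 \<partial>M)) \<and>
     (\<exists>E. is_exchange_term M w X E \<and>
        (\<forall>\<phi>. test_function \<phi> \<longrightarrow>
           (\<exists>A B C D.
              has_pairing M X (time_deriv \<phi>) A \<and>
              has_pairing M X (space_laplacian \<phi>) B \<and>
              has_pairing M (\<lambda>t x \<omega>. of_real (direct_potential M w X t x) * X t x \<omega>) \<phi> C \<and>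
              has_pairing M E \<phi> D \<and>
              (AE \<omega> in M. - \<i> * A \<omega> = - B \<omega> + C \<omega> - D \<omega>))))"


section \<open>Law of a random field\<close>

definition gaussian_field ::
  "'w measure \<Rightarrow> (real \<Rightarrow> real ^ 'd \<Rightarrow> 'w \<Rightarrow> complex) \<Rightarrow> bool" where
  "gaussian_field M X \<longleftrightarrow> gaussian_family M UNIV (\<lambda>(t, x). X t x)"

definition field_law ::
  "'w measure \<Rightarrow> (real \<Rightarrow> real ^ 'd \<Rightarrow> 'w \<Rightarrow> complex) \<Rightarrow> (real \<times> (real ^ 'd) \<Rightarrow> complex) measure" where
  "field_law M X = distr M (\<Pi>\<^sub>M p\<in>UNIV. borel) (\<lambda>\<omega> (t, x). X t x \<omega>)"

definition time_translation_invariant ::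
  "'w measure \<Rightarrow> (real \<Rightarrow> real ^ 'd \<Rightarrow> 'w \<Rightarrow> complex) \<Rightarrow> bool" where
  "time_translation_invariant M X \<longleftrightarrow> (\<forall>s. field_law M (\<lambda>t x. X (t + s) x) = field_law M X)"

definition space_translation_invariant ::
  "'w measure \<Rightarrow> (real \<Rightarrow> real ^ 'd \<Rightarrow> 'w \<Rightarrow> complex) \<Rightarrow> bool" where
  "space_translation_invariant M X \<longleftrightarrow> (\<forall>a. field_law M (\<lambda>t x. X t (x + a)) = field_law M X)"


section \<open>The dispersion relation and the field \<open>Y\<^sub>f\<close>\<close>

text \<open>
  \<open>theta\<close> is complex-valued because \<open>fourier_measure w\<close> is; its values are real when \<open>w\<close> is even.
\<close>

definition theta :: "((real ^ 'd) set \<Rightarrow> real) \<Rightarrow> (real ^ 'd \<Rightarrow> real) \<Rightarrow> real ^ 'd \<Rightarrow> complex" where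
  "theta w f \<xi> =
     of_real ((norm \<xi>)\<^sup>2)
     + of_real (signed_integral w (\<lambda>_. 1) * (\<integral>\<eta>. (f \<eta>)\<^sup>2 \<partial>lborel))
     - of_real ((2 * pi) powr (real CARD('d) / 2)) *
         (\<integral>\<eta>. fourier_measure w (\<xi> - \<eta>) * of_real ((f \<eta>)\<^sup>2) \<partial>lborel)"

definition Y_field ::
  "'w measure \<Rightarrow> ((real ^ 'd) set \<Rightarrow> 'w \<Rightarrow> complex) \<Rightarrow> ((real ^ 'd) set \<Rightarrow> real)
     \<Rightarrow> (real ^ 'd \<Rightarrow> real) \<Rightarrow> real \<Rightarrow> real ^ 'd \<Rightarrow> 'w \<Rightarrow> complex" where
  "Y_field M W w f t x = wiener_integral M W
     (\<lambda>\<xi>. of_real (f \<xi>) * exp (\<i> * (of_real (\<xi> \<bullet> x) - theta w f \<xi> * of_real t)))"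

end

theory Submission
  imports Defs
begin

text \<open>
  The field \<open>Y\<close> superposes the plane waves \<open>e\<^sub>\<xi> (t, x) = exp (\<i> (\<xi> \<bullet> x - \<theta> \<xi> t))\<close> with independent
  complex Gaussian amplitudes of variance \<open>(f \<xi>)\<^sup>2 d\<xi>\<close>. Everything rests on the Wiener integral being
  a linear isometry from \<open>L\<^sup>2(d\<xi>)\<close> to \<open>L\<^sup>2(M)\<close> (\<open>has_wiener_integral_linear\<close>,
  \<open>has_wiener_integral_isometry\<close>), which turns each operation on \<open>Y\<close> into multiplication of \<open>f\<close> by
  a function of \<open>\<xi>\<close>.

  \<^item> The correlation of \<open>Y\<close> at \<open>y\<close> and \<open>x\<close> is \<open>\<integral> exp (\<i> \<xi> \<bullet> (x - y)) (f \<xi>)\<^sup>2 d\<xi>\<close>, a function of \<open>x - y\<close>.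
    Hence the direct potential is the constant \<open>w(\<real>\<^sup>d) \<integral> f\<^sup>2\<close>, and the exchange term multiplies \<open>f\<close>
    by \<open>K = (2\<pi>)\<^bsup>d/2\<^esup> w^ * f\<^sup>2\<close>, by Fubini's theorem (\<open>exchange_multiplier_eq\<close>, \<open>exchange_integral\<close>).

  \<^item> The pairing of \<open>Y\<close> with a test function \<open>\<phi>\<close> is the Wiener integral of \<open>f \<integral> \<phi> e\<^sub>\<xi>\<close>
    (\<open>has_pairing_wiener\<close>). Integration by parts replaces \<open>\<partial>\<^sub>t\<close> and \<open>\<Delta>\<close> on \<open>\<phi>\<close> by \<open>\<i> \<theta>\<close> and
    \<open>- \<bar>\<xi>\<bar>\<^sup>2\<close> (\<open>integral_dir_deriv_plane_wave\<close>), so the equation becomes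
    \<open>\<theta> = \<bar>\<xi>\<bar>\<^sup>2 + w(\<real>\<^sup>d) \<integral> f\<^sup>2 - K\<close>, which holds by definition of \<open>\<theta>\<close> (\<open>is_solution_Y\<close>).

  \<^item> Since the noise is circularly symmetric, \<open>E[exp (\<i> Re Z)] = exp (- \<parallel>h\<parallel>\<^sup>2 / 4)\<close> for the Wiener
    integral \<open>Z\<close> of \<open>h\<close> (\<open>has_wiener_integral_char\<close>). So \<open>Y\<close> is Gaussian and its law depends only on
    the norms of linear combinations of the integrands (\<open>wiener_law_eq\<close>). A translation in \<open>t\<close> or
    \<open>x\<close> multiplies all integrands by one and the same function, of modulus one because \<open>\<theta>\<close> is real
    for even \<open>w\<close>, and so it preserves these norms and the law (\<open>field_law_translate\<close>).

  The analytic input is the Bochner integral of \<open>z \<mapsto> g z * f\<close> in \<open>L\<^sup>2(d\<xi>)\<close> for bounded \<open>g\<close>, continuous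
  in \<open>z\<close> (\<open>has_L2_integral_lborel\<close>). The isometry carries it to \<open>L\<^sup>2(M)\<close>
  (\<open>has_L2_integral_wiener\<close>), which serves both the pairings, integrals over space-time, and the
  exchange term, an integral against the variations of \<open>w\<close>.
\<close>

section \<open>Square-integrable functions\<close>

lemma square_integrableD:
  assumes "square_integrable N g"
  shows "g \<in> borel_measurable N" "integrable N (\<lambda>x. (cmod (g x))\<^sup>2)"
  using assms by (auto simp: square_integrable_def)

lemma square_integrable_dominated:
  assumes "square_integrable N g" and [measurable]: "h \<in> borel_measurable N"
    and "\<And>x. x \<in> space N \<Longrightarrow> cmod (h x) \<le> B * cmod (g x)"
  shows "square_integrable N h"
  unfolding square_integrable_def
proof (intro conjI)
  show "integrable N (\<lambda>x. (cmod (h x))\<^sup>2)"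
  proof (rule Bochner_Integration.integrable_bound)
    show "integrable N (\<lambda>x. B\<^sup>2 * (cmod (g x))\<^sup>2)"
      using square_integrableD(2)[OF assms(1)] by simp
    show "AE x in N. norm ((cmod (h x))\<^sup>2) \<le> norm (B\<^sup>2 * (cmod (g x))\<^sup>2)"
      using assms(3) by (auto intro!: AE_I2 power_mono simp: power_mult_distrib[symmetric])
  qed measurable
qed fact

lemma square_integrable_zero [simp]: "square_integrable N (\<lambda>x. 0)"
  by (simp add: square_integrable_def)

lemma square_integrable_cmult:
  assumes "square_integrable N g"
  shows "square_integrable N (\<lambda>x. c * g x)"
  using square_integrableD[OF assms]
  by (auto simp: square_integrable_def norm_mult power_mult_distrib)

lemma square_integrable_add:
  assumes g: "square_integrable N g" and h: "square_integrable N h"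
  shows "square_integrable N (\<lambda>x. g x + h x)"
  unfolding square_integrable_def
proof (intro conjI)
  note [measurable] = square_integrableD(1)[OF g] square_integrableD(1)[OF h]
  show "(\<lambda>x. g x + h x) \<in> borel_measurable N" by measurable
  show "integrable N (\<lambda>x. (cmod (g x + h x))\<^sup>2)"
  proof (rule Bochner_Integration.integrable_bound)
    show "integrable N (\<lambda>x. 2 * (cmod (g x))\<^sup>2 + 2 * (cmod (h x))\<^sup>2)"
      using square_integrableD(2)[OF g] square_integrableD(2)[OF h] by simp
    have "(cmod (g x + h x))\<^sup>2 \<le> 2 * (cmod (g x))\<^sup>2 + 2 * (cmod (h x))\<^sup>2" for x
    proof -
      have "(cmod (g x + h x))\<^sup>2 \<le> (cmod (g x) + cmod (h x))\<^sup>2"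
        by (intro power_mono norm_triangle_ineq) auto
      then show ?thesis using sum_squares_bound[of "cmod (g x)" "cmod (h x)"]
        by (simp add: power2_sum)
    qed
    then show "AE x in N. norm ((cmod (g x + h x))\<^sup>2) \<le> norm (2 * (cmod (g x))\<^sup>2 + 2 * (cmod (h x))\<^sup>2)"
      by (intro AE_I2) simp
  qed measurable
qed

lemma square_integrable_diff:
  assumes "square_integrable N g" "square_integrable N h"
  shows "square_integrable N (\<lambda>x. g x - h x)"
  using square_integrable_add[OF assms(1) square_integrable_cmult[OF assms(2), of "-1"]] by simp

lemma square_integrable_sum:
  assumes "\<And>k. k \<in> J \<Longrightarrow> square_integrable N (g k)"
  shows "square_integrable N (\<lambda>x. \<Sum>k\<in>J. g k x)"
  using assms by (induction J rule: infinite_finite_induct) (auto intro!: square_integrable_add)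

lemma integrable_square_integrable_mult:
  assumes g: "square_integrable N g" and h: "square_integrable N h"
  shows "integrable N (\<lambda>x. g x * h x)"
proof (rule Bochner_Integration.integrable_bound)
  note [measurable] = square_integrableD(1)[OF g] square_integrableD(1)[OF h]
  show "integrable N (\<lambda>x. (cmod (g x))\<^sup>2 + (cmod (h x))\<^sup>2)"
    using square_integrableD(2)[OF g] square_integrableD(2)[OF h] by simp
  show "(\<lambda>x. g x * h x) \<in> borel_measurable N" by measurable
  have "cmod (g x) * cmod (h x) \<le> (cmod (g x))\<^sup>2 + (cmod (h x))\<^sup>2" for x
    using sum_squares_bound[of "cmod (g x)" "cmod (h x)"]
      mult_nonneg_nonneg[OF norm_ge_zero[of "g x"] norm_ge_zero[of "h x"]] by linarith
  then show "AE x in N. norm (g x * h x) \<le> norm ((cmod (g x))\<^sup>2 + (cmod (h x))\<^sup>2)"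
    by (intro AE_I2) (simp add: norm_mult)
qed

lemma square_integrable_cnj:
  assumes "square_integrable N g" shows "square_integrable N (\<lambda>x. cnj (g x))"
proof (rule square_integrable_dominated[OF assms, where B = 1])
  have "(\<lambda>x. cnj (g x)) = cnj \<circ> g" by auto
  moreover have "cnj \<in> borel_measurable borel"
    by (intro borel_measurable_continuous_onI continuous_intros)
  ultimately show "(\<lambda>x. cnj (g x)) \<in> borel_measurable N"
    using square_integrableD(1)[OF assms] by (metis measurable_comp)
qed simp

lemma (in prob_space) integrable_square_integrable:
  assumes "square_integrable M g" shows "integrable M g"
  using integrable_square_integrable_mult[OF assms, of "\<lambda>_. 1"]
  by (simp add: square_integrable_def)

lemma L2_norm_nonneg [simp]: "0 \<le> L2_norm N g"
  by (simp add: L2_norm_def)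

lemma L2_norm_power2: "(L2_norm N g)\<^sup>2 = (\<integral>x. (cmod (g x))\<^sup>2 \<partial>N)"
  by (simp add: L2_norm_def)

lemma L2_norm_cmult: "L2_norm N (\<lambda>x. c * g x) = cmod c * L2_norm N g"
  by (simp add: L2_norm_def norm_mult power_mult_distrib real_sqrt_mult)

lemma L2_norm_minus_commute: "L2_norm N (\<lambda>x. g x - h x) = L2_norm N (\<lambda>x. h x - g x)"
  by (simp add: L2_norm_def norm_minus_commute)

lemma L2_norm_cnj_diff: "L2_norm N (\<lambda>x. cnj (g x) - cnj (h x)) = L2_norm N (\<lambda>x. g x - h x)"
  by (simp add: L2_norm_def flip: complex_cnj_diff)

lemma L2_norm_eq_if_inner_eq:
  assumes "(\<integral>x. cnj (g x) * g x \<partial>N) = (\<integral>x. cnj (h x) * h x \<partial>N')"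
  shows "L2_norm N g = L2_norm N' h"
proof -
  have "cnj z * z = of_real ((cmod z)\<^sup>2)" for z
    by (metis complex_norm_square mult.commute of_real_power)
  then have "complex_of_real (\<integral>x. (cmod (g x))\<^sup>2 \<partial>N) = of_real (\<integral>x. (cmod (h x))\<^sup>2 \<partial>N')"
    using assms by (simp del: of_real_power)
  then show ?thesis by (simp add: L2_norm_def)
qed

lemma AE_eq_0_if_L2_norm_eq_0:
  assumes "square_integrable N g" and "L2_norm N g = 0"
  shows "AE x in N. g x = 0"
proof -
  have "(\<integral>x. (cmod (g x))\<^sup>2 \<partial>N) = 0"
    using assms(2) L2_norm_power2[of N g] by simp
  then have "AE x in N. (cmod (g x))\<^sup>2 = 0"
    using integral_nonneg_eq_0_iff_AE[OF square_integrableD(2)[OF assms(1)]] by simp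
  then show ?thesis by simp
qed

text \<open>
  The Cauchy-Schwarz inequality: for positive norms \<open>a\<close> and \<open>b\<close>, integrate the pointwise bound of
  \<open>\<bar>g h\<bar>\<close> by \<open>b / (2 a) \<bar>g\<bar>\<^sup>2 + a / (2 b) \<bar>h\<bar>\<^sup>2\<close>.
\<close>

lemma integral_norm_mult_le_L2_norm:
  assumes g: "square_integrable N g" and h: "square_integrable N h"
  shows "(\<integral>x. cmod (g x) * cmod (h x) \<partial>N) \<le> L2_norm N g * L2_norm N h"
proof -
  define a b where "a = L2_norm N g" and "b = L2_norm N h"
  note [measurable] = square_integrableD(1)[OF g] square_integrableD(1)[OF h]
  have ab: "0 \<le> a" "0 \<le> b" by (auto simp: a_def b_def)
  consider "a = 0" | "b = 0" | "0 < a" "0 < b" using ab by linarith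
  then show ?thesis
  proof cases
    case 1
    then have "AE x in N. g x = 0" using AE_eq_0_if_L2_norm_eq_0[OF g] by (simp add: a_def)
    then have "(\<integral>x. cmod (g x) * cmod (h x) \<partial>N) = 0"
      by (intro integral_eq_zero_AE) auto
    then show ?thesis by simp
  next
    case 2
    then have "AE x in N. h x = 0" using AE_eq_0_if_L2_norm_eq_0[OF h] by (simp add: b_def)
    then have "(\<integral>x. cmod (g x) * cmod (h x) \<partial>N) = 0"
      by (intro integral_eq_zero_AE) auto
    then show ?thesis by simp
  next
    case 3
    have int: "integrable N (\<lambda>x. cmod (g x) * cmod (h x))"
      using integrable_square_integrable_mult[OF g h, THEN integrable_norm] by (simp add: norm_mult)
    have "cmod (g x) * cmod (h x) \<le> b / (2 * a) * (cmod (g x))\<^sup>2 + a / (2 * b) * (cmod (h x))\<^sup>2" for x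
    proof -
      have "0 \<le> (b * cmod (g x) - a * cmod (h x))\<^sup>2" by simp
      then have "2 * a * b * (cmod (g x) * cmod (h x)) \<le> b\<^sup>2 * (cmod (g x))\<^sup>2 + a\<^sup>2 * (cmod (h x))\<^sup>2"
        by (simp add: power2_diff power_mult_distrib algebra_simps)
      then show ?thesis using 3
        by (simp add: field_simps power2_eq_square)
    qed
    then have "(\<integral>x. cmod (g x) * cmod (h x) \<partial>N)
        \<le> (\<integral>x. b / (2 * a) * (cmod (g x))\<^sup>2 + a / (2 * b) * (cmod (h x))\<^sup>2 \<partial>N)"
      using square_integrableD(2)[OF g] square_integrableD(2)[OF h] int by (intro integral_mono) auto
    also have "\<dots> = b / (2 * a) * a\<^sup>2 + a / (2 * b) * b\<^sup>2"
      using square_integrableD(2)[OF g] square_integrableD(2)[OF h]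
      by (simp add: a_def b_def L2_norm_power2)
    also have "\<dots> = a * b" using 3 by (simp add: field_simps power2_eq_square)
    finally show ?thesis by (simp add: a_def b_def)
  qed
qed

lemma norm_integral_mult_le_L2_norm:
  assumes g: "square_integrable N g" and h: "square_integrable N h"
  shows "cmod (\<integral>x. g x * h x \<partial>N) \<le> L2_norm N g * L2_norm N h"
  using order_trans[OF integral_norm_bound integral_norm_mult_le_L2_norm[OF g h, folded norm_mult]] .

lemma L2_norm_triangle:
  assumes g: "square_integrable N g" and h: "square_integrable N h"
  shows "L2_norm N (\<lambda>x. g x + h x) \<le> L2_norm N g + L2_norm N h"
proof (rule power2_le_imp_le)
  have int: "integrable N (\<lambda>x. cmod (g x) * cmod (h x))"
    using integrable_square_integrable_mult[OF g h, THEN integrable_norm] by (simp add: norm_mult)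
  have "(L2_norm N (\<lambda>x. g x + h x))\<^sup>2 = (\<integral>x. (cmod (g x + h x))\<^sup>2 \<partial>N)"
    by (rule L2_norm_power2)
  also have "\<dots> \<le> (\<integral>x. (cmod (g x))\<^sup>2 + (cmod (h x))\<^sup>2 + 2 * (cmod (g x) * cmod (h x)) \<partial>N)"
  proof (rule integral_mono)
    show "(cmod (g x + h x))\<^sup>2 \<le> (cmod (g x))\<^sup>2 + (cmod (h x))\<^sup>2 + 2 * (cmod (g x) * cmod (h x))" for x
      using power_mono[OF norm_triangle_ineq[of "g x" "h x"], of 2] by (simp add: power2_sum)
  qed (use g h int square_integrable_add[OF g h] in \<open>auto simp: square_integrable_def\<close>)
  also have "\<dots> = (L2_norm N g)\<^sup>2 + (L2_norm N h)\<^sup>2 + 2 * (\<integral>x. cmod (g x) * cmod (h x) \<partial>N)"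
    using g h int by (simp add: L2_norm_power2 square_integrable_def)
  also have "\<dots> \<le> (L2_norm N g)\<^sup>2 + (L2_norm N h)\<^sup>2 + 2 * (L2_norm N g * L2_norm N h)"
    using integral_norm_mult_le_L2_norm[OF g h] by simp
  also have "\<dots> = (L2_norm N g + L2_norm N h)\<^sup>2" by (simp add: power2_sum)
  finally show "(L2_norm N (\<lambda>x. g x + h x))\<^sup>2 \<le> (L2_norm N g + L2_norm N h)\<^sup>2" .
qed simp

lemma L2_norm_triangle_diff:
  assumes "square_integrable N g" "square_integrable N h" "square_integrable N u"
  shows "L2_norm N (\<lambda>x. g x - h x) \<le> L2_norm N (\<lambda>x. g x - u x) + L2_norm N (\<lambda>x. u x - h x)"
  using L2_norm_triangle[OF square_integrable_diff[OF assms(1,3)] square_integrable_diff[OF assms(3,2)]]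
  by simp

lemma L2_norm_linear_comb_le:
  assumes "square_integrable N g" "square_integrable N h"
  shows "L2_norm N (\<lambda>x. a * g x + b * h x) \<le> cmod a * L2_norm N g + cmod b * L2_norm N h"
  using L2_norm_triangle[OF square_integrable_cmult[OF assms(1), of a] square_integrable_cmult[OF assms(2), of b]]
  by (simp add: L2_norm_cmult)

lemma tendsto_0_if_le:
  fixes a b :: "nat \<Rightarrow> real"
  assumes "b \<longlonglongrightarrow> 0" "\<And>j. 0 \<le> a j" "\<And>j. a j \<le> b j" shows "a \<longlonglongrightarrow> 0"
  by (rule tendsto_sandwich[OF _ _ tendsto_const assms(1)]) (use assms in auto)

lemma L2_norm_tendsto:
  assumes g: "square_integrable N g" and gj: "\<And>j. square_integrable N (gj j)"
    and lim: "(\<lambda>j. L2_norm N (\<lambda>x. g x - gj j x)) \<longlonglongrightarrow> 0"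
  shows "(\<lambda>j. L2_norm N (gj j)) \<longlonglongrightarrow> L2_norm N g"
proof -
  have "\<bar>L2_norm N (gj j) - L2_norm N g\<bar> \<le> L2_norm N (\<lambda>x. g x - gj j x)" for j
    using L2_norm_triangle[OF square_integrable_diff[OF g gj[of j]] gj[of j]]
      L2_norm_triangle[OF square_integrable_diff[OF gj[of j] g] g]
    unfolding L2_norm_minus_commute[of N "gj j" g] by simp
  then have "(\<lambda>j. L2_norm N (gj j) - L2_norm N g) \<longlonglongrightarrow> 0"
    by (intro tendsto_rabs_zero_cancel[OF tendsto_0_if_le[OF lim]]) auto
  then show ?thesis by (simp add: LIM_zero_iff)
qed

lemma integral_mult_tendsto:
  assumes g: "square_integrable N g" and gj: "\<And>j. square_integrable N (gj j)"
    and h: "square_integrable N h" and hj: "\<And>j. square_integrable N (hj j)"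
    and limg: "(\<lambda>j. L2_norm N (\<lambda>x. g x - gj j x)) \<longlonglongrightarrow> 0"
    and limh: "(\<lambda>j. L2_norm N (\<lambda>x. h x - hj j x)) \<longlonglongrightarrow> 0"
  shows "(\<lambda>j. \<integral>x. gj j x * hj j x \<partial>N) \<longlonglongrightarrow> (\<integral>x. g x * h x \<partial>N)"
proof -
  define e where "e = (\<lambda>j. L2_norm N (\<lambda>x. g x - gj j x) * L2_norm N (hj j)
      + L2_norm N g * L2_norm N (\<lambda>x. h x - hj j x))"
  have "e \<longlonglongrightarrow> 0 * L2_norm N h + L2_norm N g * 0"
    unfolding e_def by (intro tendsto_intros limg limh L2_norm_tendsto h hj)
  then have e: "e \<longlonglongrightarrow> 0" by simp
  have "cmod ((\<integral>x. gj j x * hj j x \<partial>N) - (\<integral>x. g x * h x \<partial>N)) \<le> e j" for j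
  proof -
    note [simp] = integrable_square_integrable_mult[OF gj hj] integrable_square_integrable_mult[OF g h]
      integrable_square_integrable_mult[OF g hj]
      integrable_square_integrable_mult[OF square_integrable_diff[OF g gj] hj]
      integrable_square_integrable_mult[OF g square_integrable_diff[OF h hj]]
    have "(\<integral>x. g x * h x \<partial>N) - (\<integral>x. gj j x * hj j x \<partial>N)
        = (\<integral>x. g x * h x - gj j x * hj j x \<partial>N)"
      by (rule Bochner_Integration.integral_diff[symmetric]) simp_all
    also have "\<dots> = (\<integral>x. (g x - gj j x) * hj j x + g x * (h x - hj j x) \<partial>N)"
      by (intro Bochner_Integration.integral_cong refl) (simp add: algebra_simps)
    also have "\<dots> = (\<integral>x. (g x - gj j x) * hj j x \<partial>N) + (\<integral>x. g x * (h x - hj j x) \<partial>N)"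
      by (rule Bochner_Integration.integral_add) simp_all
    also have "cmod \<dots> \<le> e j" unfolding e_def
      by (intro order_trans[OF norm_triangle_ineq] add_mono norm_integral_mult_le_L2_norm
          square_integrable_diff g gj h hj)
    finally show ?thesis by (simp add: norm_minus_commute)
  qed
  then have "(\<lambda>j. (\<integral>x. gj j x * hj j x \<partial>N) - (\<integral>x. g x * h x \<partial>N)) \<longlonglongrightarrow> 0"
    by (intro tendsto_norm_zero_cancel[OF tendsto_0_if_le[OF e]]) auto
  then show ?thesis by (simp add: LIM_zero_iff)
qed

lemma (in prob_space) integral_norm_le_L2_norm:
  assumes "square_integrable M g" shows "(\<integral>x. cmod (g x) \<partial>M) \<le> L2_norm M g"
  using integral_norm_mult_le_L2_norm[OF assms, of "\<lambda>_. 1"]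
  by (simp add: square_integrable_def L2_norm_def prob_space)

text \<open>
  Over a probability space an \<open>L\<^sup>2\<close>-Cauchy sequence is \<open>L\<^sup>1\<close>-Cauchy, so a subsequence converges
  almost everywhere, and Fatou's lemma bounds the \<open>L\<^sup>2\<close>-distance to the limit.
\<close>

lemma (in prob_space) L2_complete:
  assumes S: "\<And>j. square_integrable M (S j)"
    and cauchy: "\<And>e. e > 0 \<Longrightarrow> \<exists>N. \<forall>i\<ge>N. \<forall>j\<ge>N. L2_norm M (\<lambda>x. S i x - S j x) < e"
  obtains Z where "square_integrable M Z" "(\<lambda>j. L2_norm M (\<lambda>x. Z x - S j x)) \<longlonglongrightarrow> 0"
proof -
  note [measurable] = square_integrableD(1)[OF S]
  obtain r where r: "strict_mono r" "AE x in M. Cauchy (\<lambda>i. S (r i) x)"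
  proof (rule cauchy_L1_AE_cauchy_subseq[of M S])
    show "integrable M (S n)" for n by (rule integrable_square_integrable[OF S])
    show "\<exists>N. \<forall>i\<ge>N. \<forall>j\<ge>N. LINT x|M. cmod (S i x - S j x) < e" if "e > 0" for e
      using cauchy[OF that] integral_norm_le_L2_norm[OF square_integrable_diff[OF S S]]
      by (meson le_less_trans)
  qed blast
  define Z where "Z x = lim (\<lambda>i. S (r i) x)" for x
  have Z_meas [measurable]: "Z \<in> borel_measurable M"
    unfolding Z_def by measurable
  have lim: "AE x in M. (\<lambda>i. S (r i) x) \<longlonglongrightarrow> Z x"
    using r(2) by eventually_elim (simp add: Z_def Cauchy_convergent_iff convergent_LIMSEQ_iff)
  have fatou: "(\<integral>\<^sup>+x. ennreal ((cmod (Z x - S j x))\<^sup>2) \<partial>M) \<le> ennreal (e\<^sup>2)"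
    if j: "\<And>i. i \<ge> N \<Longrightarrow> L2_norm M (\<lambda>x. S i x - S j x) < e" and "e > 0" for e j N
  proof -
    have "(\<integral>\<^sup>+x. ennreal ((cmod (Z x - S j x))\<^sup>2) \<partial>M)
        = (\<integral>\<^sup>+x. liminf (\<lambda>i. ennreal ((cmod (S (r i) x - S j x))\<^sup>2)) \<partial>M)"
    proof (rule nn_integral_cong_AE, use lim in eventually_elim)
      case (elim x)
      have "(\<lambda>i. ennreal ((cmod (S (r i) x - S j x))\<^sup>2)) \<longlonglongrightarrow> ennreal ((cmod (Z x - S j x))\<^sup>2)"
        by (intro tendsto_intros elim)
      then show ?case by (metis lim_imp_Liminf trivial_limit_sequentially)
    qed
    also have "\<dots> \<le> liminf (\<lambda>i. \<integral>\<^sup>+x. ennreal ((cmod (S (r i) x - S j x))\<^sup>2) \<partial>M)"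
      by (intro nn_integral_liminf) measurable
    also have "\<dots> \<le> ennreal (e\<^sup>2)"
    proof (rule order_trans[OF Liminf_le_Limsup Limsup_bounded], simp, rule eventually_sequentiallyI[of N])
      fix i assume "i \<ge> N"
      then have "r i \<ge> N" using seq_suble[OF r(1), of i] by linarith
      have "(\<integral>\<^sup>+x. ennreal ((cmod (S (r i) x - S j x))\<^sup>2) \<partial>M)
          = ennreal ((L2_norm M (\<lambda>x. S (r i) x - S j x))\<^sup>2)"
        using square_integrable_diff[OF S S]
        by (subst nn_integral_eq_integral) (auto simp: square_integrable_def L2_norm_power2)
      also have "\<dots> \<le> ennreal (e\<^sup>2)"
        using j[OF \<open>r i \<ge> N\<close>] by (intro ennreal_leI power_mono) auto
      finally show "(\<integral>\<^sup>+x. ennreal ((cmod (S (r i) x - S j x))\<^sup>2) \<partial>M) \<le> ennreal (e\<^sup>2)" .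
    qed
    finally show ?thesis .
  qed
  have diff: "square_integrable M (\<lambda>x. Z x - S j x) \<and> L2_norm M (\<lambda>x. Z x - S j x) \<le> e"
    if "\<And>i. i \<ge> N \<Longrightarrow> L2_norm M (\<lambda>x. S i x - S j x) < e" and "e > 0" for e j N
  proof
    have *: "(\<integral>\<^sup>+x. ennreal ((cmod (Z x - S j x))\<^sup>2) \<partial>M) \<le> ennreal (e\<^sup>2)"
      using fatou[OF that] .
    then have int: "integrable M (\<lambda>x. (cmod (Z x - S j x))\<^sup>2)"
      by (intro integrableI_bounded) (auto simp: less_top[symmetric] top_unique)
    then show "square_integrable M (\<lambda>x. Z x - S j x)"
      by (auto simp: square_integrable_def)
    show "L2_norm M (\<lambda>x. Z x - S j x) \<le> e"
      using * int \<open>e > 0\<close> by (simp add: L2_norm_def nn_integral_eq_integral real_le_lsqrt)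
  qed
  obtain N1 where "\<And>i. i \<ge> N1 \<Longrightarrow> L2_norm M (\<lambda>x. S i x - S N1 x) < 1"
    using cauchy[of 1] by auto
  then have "square_integrable M (\<lambda>x. (Z x - S N1 x) + S N1 x)"
    by (intro square_integrable_add S) (use diff[of N1 N1 1] in auto)
  then have Z: "square_integrable M Z" by simp
  moreover have "(\<lambda>j. L2_norm M (\<lambda>x. Z x - S j x)) \<longlonglongrightarrow> 0"
  proof (rule LIMSEQ_I)
    fix e :: real assume "e > 0"
    then obtain N where "\<And>i j. i \<ge> N \<Longrightarrow> j \<ge> N \<Longrightarrow> L2_norm M (\<lambda>x. S i x - S j x) < e/2"
      using cauchy[of "e/2"] by auto
    then have "L2_norm M (\<lambda>x. Z x - S j x) \<le> e/2" if "j \<ge> N" for j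
      using diff[of N j "e/2"] \<open>e > 0\<close> that by auto
    then show "\<exists>N. \<forall>j\<ge>N. norm (L2_norm M (\<lambda>x. Z x - S j x) - 0) < e"
      using \<open>e > 0\<close> by (intro exI[of _ N]) fastforce
  qed
  ultimately show ?thesis using that by blast
qed


section \<open>Real Gaussian variables\<close>

lemma (in prob_space) real_gaussian_square_integrable:
  assumes "real_gaussian M R" shows "integrable M (\<lambda>\<omega>. (R \<omega>)\<^sup>2)"
proof -
  have [measurable]: "R \<in> borel_measurable M" using assms by (simp add: real_gaussian_def)
  obtain \<mu> \<sigma> where "(\<sigma> = 0 \<and> (AE \<omega> in M. R \<omega> = \<mu>)) \<or>
      (\<sigma> > 0 \<and> distributed M lborel R (\<lambda>x. ennreal (normal_density \<mu> \<sigma> x)))"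
    using assms by (auto simp: real_gaussian_def)
  then show ?thesis
  proof (elim disjE conjE)
    assume "AE \<omega> in M. R \<omega> = \<mu>"
    then show ?thesis by (subst integrable_cong_AE[where g = "\<lambda>_. \<mu>\<^sup>2"]) auto
  next
    assume \<sigma>: "0 < \<sigma>" and D: "distributed M lborel R (\<lambda>x. ennreal (normal_density \<mu> \<sigma> x))"
    have "integrable lborel (\<lambda>x. normal_density \<mu> \<sigma> x * (x - \<mu>)^2
        + 2 * \<mu> * (normal_density \<mu> \<sigma> x * (x - \<mu>)^1) + \<mu>\<^sup>2 * (normal_density \<mu> \<sigma> x * (x - \<mu>)^0))"
      by (intro Bochner_Integration.integrable_add integrable_mult_right integrable_normal_moment \<sigma>)
    moreover have "normal_density \<mu> \<sigma> x * (x - \<mu>)^2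
        + 2 * \<mu> * (normal_density \<mu> \<sigma> x * (x - \<mu>)^1) + \<mu>\<^sup>2 * (normal_density \<mu> \<sigma> x * (x - \<mu>)^0)
        = normal_density \<mu> \<sigma> x * x\<^sup>2" for x by (simp add: power2_eq_square algebra_simps)
    ultimately show ?thesis
      using distributed_integrable[OF D, of "\<lambda>x. x\<^sup>2"] by (simp add: normal_density_nonneg)
  qed
qed

text \<open>The characteristic function at \<open>1\<close>; other arguments are reached by scaling \<open>R\<close>.\<close>

lemma (in prob_space) real_gaussian_char:
  assumes R: "real_gaussian M R" and mean: "expectation R = 0"
  shows "(\<integral>\<omega>. iexp (R \<omega>) \<partial>M) = of_real (exp (- expectation (\<lambda>\<omega>. (R \<omega>)\<^sup>2) / 2))"
proof -
  have [measurable]: "R \<in> borel_measurable M" using R by (simp add: real_gaussian_def)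
  obtain \<mu> \<sigma> where "(\<sigma> = 0 \<and> (AE \<omega> in M. R \<omega> = \<mu>)) \<or>
      (\<sigma> > 0 \<and> distributed M lborel R (\<lambda>x. ennreal (normal_density \<mu> \<sigma> x)))"
    using R by (auto simp: real_gaussian_def)
  then show ?thesis
  proof (elim disjE conjE)
    assume ae: "AE \<omega> in M. R \<omega> = \<mu>"
    have "expectation R = (\<integral>\<omega>. \<mu> \<partial>M)" by (rule integral_cong_AE) (use ae in auto)
    then have [simp]: "\<mu> = 0" using mean by (simp add: prob_space)
    have "expectation (\<lambda>\<omega>. (R \<omega>)\<^sup>2) = (\<integral>\<omega>. 0 \<partial>M)" by (rule integral_cong_AE) (use ae in auto)
    moreover have "(\<integral>\<omega>. iexp (R \<omega>) \<partial>M) = (\<integral>\<omega>. 1 \<partial>M)" by (rule integral_cong_AE) (use ae in auto)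
    ultimately show ?thesis by (simp add: prob_space)
  next
    assume \<sigma>: "0 < \<sigma>" and D: "distributed M lborel R (\<lambda>x. ennreal (normal_density \<mu> \<sigma> x))"
    have [simp]: "\<mu> = 0" using normal_distributed_expectation[OF \<sigma> D] mean by simp
    have var: "expectation (\<lambda>\<omega>. (R \<omega>)\<^sup>2) = \<sigma>\<^sup>2"
      using normal_distributed_variance[OF \<sigma> D] mean by simp
    have "distributed M lborel (\<lambda>x. R x / \<sigma>) (\<lambda>x. ennreal (std_normal_density x))"
      using normal_standard_normal_convert[OF \<sigma>, of R \<mu>] D by simp
    then have "distr M borel (\<lambda>x. R x / \<sigma>) = std_normal_distribution"
      using distributed_distr_eq_density by (metis distr_cong sets_lborel)
    then have "exp (- \<sigma>\<^sup>2 / 2) = char (distr M borel (\<lambda>x. R x / \<sigma>)) \<sigma>"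
      by (simp add: char_std_normal_distribution exp_of_real)
    also have "\<dots> = (\<integral>\<omega>. iexp (R \<omega>) \<partial>M)"
      unfolding char_def using \<sigma> by (subst integral_distr) auto
    finally show ?thesis by (simp add: var exp_of_real)
  qed
qed


section \<open>The Wiener integral\<close>

text \<open>
  A simple function is paired with its Wiener integral through a common representation, so that
  independence of the representation never has to be shown; it follows from the isometry.
\<close>

definition elementary_pair ::
  "('a::euclidean_space set \<Rightarrow> 'w \<Rightarrow> complex) \<Rightarrow> ('a \<Rightarrow> complex) \<Rightarrow> ('w \<Rightarrow> complex) \<Rightarrow> bool" where
  "elementary_pair W s S \<longleftrightarrow>
     (\<exists>(n :: nat) (A :: nat \<Rightarrow> 'a set) c. (\<forall>k. A k \<in> finite_borel_sets) \<and>
        s = (\<lambda>\<xi>. \<Sum>k<n. c k * of_real (indicator (A k) \<xi>)) \<and> S = (\<lambda>\<omega>. \<Sum>k<n. c k * W (A k) \<omega>))"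

lemma has_wiener_integral_iff_elementary:
  "has_wiener_integral M W h Z \<longleftrightarrow> square_integrable lborel h \<and> square_integrable M Z \<and>
     (\<exists>s S. (\<forall>j::nat. elementary_pair W (s j) (S j)) \<and>
        (\<lambda>j. L2_norm lborel (\<lambda>\<xi>. h \<xi> - s j \<xi>)) \<longlonglongrightarrow> 0 \<and>
        (\<lambda>j. L2_norm M (\<lambda>\<omega>. Z \<omega> - S j \<omega>)) \<longlonglongrightarrow> 0)"
  (is "?L \<longleftrightarrow> _ \<and> _ \<and> ?R")
proof
  assume ?L
  then obtain n A c where *: "square_integrable lborel h" "square_integrable M Z"
      "\<forall>(j::nat) (k::nat). A j k \<in> finite_borel_sets"
      "(\<lambda>j. L2_norm lborel (\<lambda>\<xi>. h \<xi> - (\<Sum>k<n j. c j k * of_real (indicator (A j k) \<xi>)))) \<longlonglongrightarrow> 0"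
      "(\<lambda>j. L2_norm M (\<lambda>\<omega>. Z \<omega> - (\<Sum>k<n j. c j k * W (A j k) \<omega>))) \<longlonglongrightarrow> 0"
    unfolding has_wiener_integral_def by blast
  have "?R"
    by (rule exI[of _ "\<lambda>j \<xi>. \<Sum>k<n j. c j k * of_real (indicator (A j k) \<xi>)"],
        rule exI[of _ "\<lambda>j \<omega>. \<Sum>k<n j. c j k * W (A j k) \<omega>"])
       (use *(3-5) in \<open>auto simp: elementary_pair_def\<close>)
  with * show "square_integrable lborel h \<and> square_integrable M Z \<and> ?R" by blast
next
  assume *: "square_integrable lborel h \<and> square_integrable M Z \<and> ?R"
  then obtain s S where sS: "\<forall>j::nat. elementary_pair W (s j) (S j)"
      "(\<lambda>j. L2_norm lborel (\<lambda>\<xi>. h \<xi> - s j \<xi>)) \<longlonglongrightarrow> 0"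
      "(\<lambda>j. L2_norm M (\<lambda>\<omega>. Z \<omega> - S j \<omega>)) \<longlonglongrightarrow> 0"
    by blast
  have "\<forall>j. \<exists>n A c. (\<forall>k::nat. A k \<in> finite_borel_sets) \<and>
      s j = (\<lambda>\<xi>. \<Sum>k<n. c k * of_real (indicator (A k) \<xi>)) \<and> S j = (\<lambda>\<omega>. \<Sum>k<n. c k * W (A k) \<omega>)"
    using sS(1) unfolding elementary_pair_def .
  from choice[OF this] obtain n where "\<forall>j. \<exists>A c. (\<forall>k::nat. A k \<in> finite_borel_sets) \<and>
      s j = (\<lambda>\<xi>. \<Sum>k<n j. c k * of_real (indicator (A k) \<xi>)) \<and> S j = (\<lambda>\<omega>. \<Sum>k<n j. c k * W (A k) \<omega>)" ..
  from choice[OF this] obtain A where "\<forall>j. \<exists>c. (\<forall>k::nat. A j k \<in> finite_borel_sets) \<and>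
      s j = (\<lambda>\<xi>. \<Sum>k<n j. c k * of_real (indicator (A j k) \<xi>)) \<and> S j = (\<lambda>\<omega>. \<Sum>k<n j. c k * W (A j k) \<omega>)" ..
  from choice[OF this] obtain c where c: "\<forall>j. (\<forall>k::nat. A j k \<in> finite_borel_sets) \<and>
      s j = (\<lambda>\<xi>. \<Sum>k<n j. c j k * of_real (indicator (A j k) \<xi>)) \<and> S j = (\<lambda>\<omega>. \<Sum>k<n j. c j k * W (A j k) \<omega>)" ..
  then have nAc: "\<forall>j (k::nat). A j k \<in> finite_borel_sets"
      "\<And>j. s j = (\<lambda>\<xi>. \<Sum>k<n j. c j k * of_real (indicator (A j k) \<xi>))"
      "\<And>j. S j = (\<lambda>\<omega>. \<Sum>k<n j. c j k * W (A j k) \<omega>)"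
    by blast+
  have "(\<forall>j k. A j k \<in> finite_borel_sets) \<and>
      (\<lambda>j. L2_norm lborel (\<lambda>\<xi>. h \<xi> - (\<Sum>k<n j. c j k * of_real (indicator (A j k) \<xi>)))) \<longlonglongrightarrow> 0 \<and>
      (\<lambda>j. L2_norm M (\<lambda>\<omega>. Z \<omega> - (\<Sum>k<n j. c j k * W (A j k) \<omega>))) \<longlonglongrightarrow> 0"
    using nAc(1) sS(2,3) unfolding nAc(2,3) by blast
  then show ?L
    unfolding has_wiener_integral_def using * by blast
qed

lemma elementary_pair_single:
  "A \<in> finite_borel_sets \<Longrightarrow> elementary_pair W (\<lambda>\<xi>. c * of_real (indicator A \<xi>)) (\<lambda>\<omega>. c * W A \<omega>)"
  unfolding elementary_pair_def
  by (intro exI[of _ 1] exI[of _ "\<lambda>_. A"] exI[of _ "\<lambda>_. c"]) auto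

lemma elementary_pair_zero: "elementary_pair W (\<lambda>\<xi>. 0) (\<lambda>\<omega>. 0)"
  unfolding elementary_pair_def
  by (intro exI[of _ 0] exI[of _ "\<lambda>_. {}"] exI[of _ "\<lambda>_. 0"]) (auto simp: finite_borel_sets_def)

lemma elementary_pair_cmult:
  assumes "elementary_pair W s S" shows "elementary_pair W (\<lambda>\<xi>. a * s \<xi>) (\<lambda>\<omega>. a * S \<omega>)"
proof -
  obtain n A c where *: "\<forall>k::nat. A k \<in> finite_borel_sets"
      "s = (\<lambda>\<xi>. \<Sum>k<n. c k * of_real (indicator (A k) \<xi>))" "S = (\<lambda>\<omega>. \<Sum>k<n. c k * W (A k) \<omega>)"
    using assms unfolding elementary_pair_def by blast
  show ?thesis unfolding elementary_pair_def
    by (intro exI[of _ n] exI[of _ A] exI[of _ "\<lambda>k. a * c k"])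
       (use *(1) in \<open>auto simp: *(2,3) sum_distrib_left mult.assoc\<close>)
qed

lemma elementary_pair_add:
  assumes "elementary_pair W s S" "elementary_pair W s' S'"
  shows "elementary_pair W (\<lambda>\<xi>. s \<xi> + s' \<xi>) (\<lambda>\<omega>. S \<omega> + S' \<omega>)"
proof -
  obtain n A c where *: "\<forall>k::nat. A k \<in> finite_borel_sets"
      "s = (\<lambda>\<xi>. \<Sum>k<n. c k * of_real (indicator (A k) \<xi>))" "S = (\<lambda>\<omega>. \<Sum>k<n. c k * W (A k) \<omega>)"
    using assms(1) unfolding elementary_pair_def by blast
  obtain n' A' c' where **: "\<forall>k::nat. A' k \<in> finite_borel_sets"
      "s' = (\<lambda>\<xi>. \<Sum>k<n'. c' k * of_real (indicator (A' k) \<xi>))" "S' = (\<lambda>\<omega>. \<Sum>k<n'. c' k * W (A' k) \<omega>)"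
    using assms(2) unfolding elementary_pair_def by blast
  have split: "(\<Sum>k<n + n'. (if k < n then F k else G (k - n))) = (\<Sum>k<n. F k) + (\<Sum>k<n'. G k)"
    for F G :: "nat \<Rightarrow> complex"
  proof -
    have "(\<Sum>k<n + n'. (if k < n then F k else G (k - n)))
        = (\<Sum>k<n. (if k < n then F k else G (k - n))) + (\<Sum>k=n..<n+n'. (if k < n then F k else G (k - n)))"
      using sum.atLeastLessThan_concat[of 0 n "n+n'" "\<lambda>k. if k < n then F k else G (k - n)"]
      by (simp add: atLeast0LessThan)
    also have "(\<Sum>k=n..<n+n'. (if k < n then F k else G (k - n))) = (\<Sum>k<n'. G k)"
      using sum.shift_bounds_nat_ivl[of "\<lambda>k. if k < n then F k else G (k - n)" 0 n n']
      by (simp add: atLeast0LessThan add.commute)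
    finally show ?thesis by simp
  qed
  show ?thesis unfolding elementary_pair_def
  proof (intro exI conjI)
    show "\<forall>k. (if k < n then A k else A' (k - n)) \<in> finite_borel_sets" using *(1) **(1) by auto
    show "(\<lambda>\<xi>. s \<xi> + s' \<xi>) = (\<lambda>\<xi>. \<Sum>k<n + n'. (if k < n then c k else c' (k - n)) *
            of_real (indicator (if k < n then A k else A' (k - n)) \<xi>))"
      unfolding *(2) **(2) split[symmetric] by (intro ext sum.cong) auto
    show "(\<lambda>\<omega>. S \<omega> + S' \<omega>) = (\<lambda>\<omega>. \<Sum>k<n + n'. (if k < n then c k else c' (k - n)) *
            W (if k < n then A k else A' (k - n)) \<omega>)"
      unfolding *(3) **(3) split[symmetric] by (intro ext sum.cong) auto
  qed
qed

lemma elementary_pair_sum: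
  assumes "\<And>k. k \<in> J \<Longrightarrow> elementary_pair W (s k) (S k)"
  shows "elementary_pair W (\<lambda>\<xi>. \<Sum>k\<in>J. s k \<xi>) (\<lambda>\<omega>. \<Sum>k\<in>J. S k \<omega>)"
  using assms
  by (induction J rule: infinite_finite_induct) (auto intro!: elementary_pair_zero elementary_pair_add)

text \<open>
  The pointwise simple approximations \<open>F j\<close> of \<open>h\<close> can be chosen with \<open>\<bar>F j\<bar> \<le> 2 \<bar>h\<bar>\<close>, so dominated
  convergence applies, and the level sets of nonzero values have finite measure.
\<close>

lemma elementary_functions_dense:
  fixes W :: "'a::euclidean_space set \<Rightarrow> 'w \<Rightarrow> complex"
  assumes h: "square_integrable lborel h"
  obtains s S where "\<And>j::nat. elementary_pair W (s j) (S j)"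
    "(\<lambda>j. L2_norm lborel (\<lambda>\<xi>. h \<xi> - s j \<xi>)) \<longlonglongrightarrow> 0"
proof -
  note [measurable] = square_integrableD(1)[OF h]
  obtain F where F: "\<And>j. simple_function lborel (F j)" "\<And>x. (\<lambda>j::nat. F j x) \<longlonglongrightarrow> h x"
      "\<And>j x. cmod (F j x) \<le> 2 * cmod (h x)"
    using borel_measurable_implies_sequence_metric[of h lborel 0] by auto
  have Fm [measurable]: "F j \<in> borel_measurable lborel" for j
    by (rule borel_measurable_simple_function[OF F(1)])
  define S where "S j \<omega> = (\<Sum>c\<in>range (F j) - {0}. c * W (F j -` {c}) \<omega>)" for j \<omega>
  have fin: "finite (range (F j))" for j using F(1)[of j] by (simp add: simple_function_def)
  have ep: "elementary_pair W (F j) (S j)" for j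
  proof -
    have fb: "F j -` {c} \<in> finite_borel_sets" if "c \<noteq> 0" for c
    proof -
      have m: "F j -` {c} \<in> sets lborel"
        using simple_functionD(2)[OF F(1), of j "{c}"] by simp
      have "emeasure lborel (F j -` {c}) = (\<integral>\<^sup>+x. indicator (F j -` {c}) x \<partial>lborel)"
        using m by simp
      also have "\<dots> \<le> (\<integral>\<^sup>+x. ennreal (4 / (cmod c)\<^sup>2 * (cmod (h x))\<^sup>2) \<partial>lborel)"
      proof (rule nn_integral_mono)
        fix x
        have "1 \<le> 4 / (cmod c)\<^sup>2 * (cmod (h x))\<^sup>2" if "F j x = c"
          using power_mono[OF F(3)[of j x], of 2] that \<open>c \<noteq> 0\<close>
          by (simp add: power_mult_distrib field_simps)
        then show "indicator (F j -` {c}) x \<le> ennreal (4 / (cmod c)\<^sup>2 * (cmod (h x))\<^sup>2)"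
          by (auto simp: indicator_def simp del: ennreal_1 simp add: ennreal_1[symmetric] intro!: ennreal_leI)
      qed
      also have "\<dots> < \<infinity>"
        using square_integrableD(2)[OF h]
        by (subst nn_integral_eq_integral) auto
      finally show ?thesis using m by (auto simp: finite_borel_sets_def)
    qed
    have "F j = (\<lambda>\<xi>. \<Sum>c\<in>range (F j) - {0}. c * of_real (indicator (F j -` {c}) \<xi>))"
    proof
      fix \<xi>
      have "(\<Sum>c\<in>range (F j) - {0}. c * of_real (indicator (F j -` {c}) \<xi>))
          = (\<Sum>c\<in>range (F j) - {0}. if F j \<xi> = c then c else 0)"
        by (intro sum.cong) (auto simp: indicator_def)
      also have "\<dots> = F j \<xi>" using fin by (subst sum.delta') auto
      finally show "F j \<xi> = (\<Sum>c\<in>range (F j) - {0}. c * of_real (indicator (F j -` {c}) \<xi>))" by simp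
    qed
    moreover have "elementary_pair W (\<lambda>\<xi>. \<Sum>c\<in>range (F j) - {0}. c * of_real (indicator (F j -` {c}) \<xi>)) (S j)"
      unfolding S_def by (intro elementary_pair_sum elementary_pair_single fb) auto
    ultimately show ?thesis by simp
  qed
  have "(\<lambda>j. \<integral>x. (cmod (h x - F j x))\<^sup>2 \<partial>lborel) \<longlonglongrightarrow> (\<integral>x. 0 \<partial>(lborel :: 'a measure))"
  proof (rule integral_dominated_convergence)
    show "integrable lborel (\<lambda>x. 9 * (cmod (h x))\<^sup>2)" using square_integrableD(2)[OF h] by simp
    show "AE x in lborel. (\<lambda>j. (cmod (h x - F j x))\<^sup>2) \<longlonglongrightarrow> 0"
    proof (rule AE_I2)
      fix x
      have "(\<lambda>j. (cmod (h x - F j x))\<^sup>2) \<longlonglongrightarrow> (cmod (h x - h x))\<^sup>2" by (intro tendsto_intros F)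
      then show "(\<lambda>j. (cmod (h x - F j x))\<^sup>2) \<longlonglongrightarrow> 0" by simp
    qed
    show "AE x in lborel. norm ((cmod (h x - F j x))\<^sup>2) \<le> 9 * (cmod (h x))\<^sup>2" for j
    proof (rule AE_I2)
      fix x
      have "cmod (h x - F j x) \<le> 3 * cmod (h x)"
        using norm_triangle_ineq4[of "h x" "F j x"] F(3)[of j x] by linarith
      then show "norm ((cmod (h x - F j x))\<^sup>2) \<le> 9 * (cmod (h x))\<^sup>2"
        using power_mono[of "cmod (h x - F j x)" "3 * cmod (h x)" 2] by (simp add: power_mult_distrib)
    qed
  qed measurable
  then have "(\<lambda>j. L2_norm lborel (\<lambda>\<xi>. h \<xi> - F j \<xi>)) \<longlonglongrightarrow> sqrt 0"
    unfolding L2_norm_def by (intro tendsto_real_sqrt) simp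
  then show ?thesis by (intro that[OF ep]) simp
qed

locale white_noise = prob_space M
  for M :: "'w measure" +
  fixes W :: "'a::euclidean_space set \<Rightarrow> 'w \<Rightarrow> complex"
  assumes white_noise: "complex_white_noise M W"
begin

lemma W_square_integrable:
  assumes A: "A \<in> finite_borel_sets" shows "square_integrable M (W A)"
proof -
  have W [measurable]: "W A \<in> borel_measurable M"
    using white_noise A by (auto simp: complex_white_noise_def gaussian_family_def)
  have g: "real_gaussian M (\<lambda>\<omega>. Re (\<Sum>j\<in>{A}. c * W j \<omega>))" for c
    using white_noise A unfolding complex_white_noise_def gaussian_family_def
    by (elim conjE allE[of _ "{A}"] allE[of _ "\<lambda>_. c"]) auto
  have "integrable M (\<lambda>\<omega>. (Re (W A \<omega>))\<^sup>2)" "integrable M (\<lambda>\<omega>. (Im (W A \<omega>))\<^sup>2)"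
    using real_gaussian_square_integrable[OF g[of 1]] real_gaussian_square_integrable[OF g[of "-\<i>"]]
    by auto
  then show ?thesis by (auto simp: square_integrable_def cmod_power2)
qed

lemma elementary_pair_square_integrable:
  assumes "elementary_pair W s S" shows "square_integrable lborel s" "square_integrable M S"
proof -
  obtain n A c where *: "\<forall>k::nat. A k \<in> finite_borel_sets"
      "s = (\<lambda>\<xi>. \<Sum>k<n. c k * of_real (indicator (A k) \<xi>))" "S = (\<lambda>\<omega>. \<Sum>k<n. c k * W (A k) \<omega>)"
    using assms unfolding elementary_pair_def by blast
  have "square_integrable lborel (\<lambda>\<xi>. of_real (indicator (A k) \<xi>))" for k
  proof -
    have "(cmod (of_real (indicator (A k) \<xi>)))\<^sup>2 = indicator (A k) \<xi>" for \<xi>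
      by (simp split: split_indicator)
    then show ?thesis using *(1)[rule_format, of k]
      by (auto simp: square_integrable_def finite_borel_sets_def)
  qed
  then show "square_integrable lborel s" unfolding *(2)
    by (intro square_integrable_sum square_integrable_cmult)
  show "square_integrable M S" unfolding *(3)
    using *(1) by (intro square_integrable_sum square_integrable_cmult W_square_integrable) auto
qed

text \<open>
  The moments are sesquilinear, respectively bilinear, so those of \<open>W\<close> on sets determine them.
\<close>

lemma elementary_pair_covariance:
  assumes "elementary_pair W s S" "elementary_pair W s' S'"
  shows "(\<integral>\<omega>. cnj (S \<omega>) * S' \<omega> \<partial>M) = (\<integral>\<xi>. cnj (s \<xi>) * s' \<xi> \<partial>lborel)"
    and "(\<integral>\<omega>. S \<omega> * S' \<omega> \<partial>M) = 0"
proof -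
  obtain n A c where *: "\<And>k::nat. A k \<in> finite_borel_sets"
      "s = (\<lambda>\<xi>. \<Sum>k<n. c k * of_real (indicator (A k) \<xi>))" "S = (\<lambda>\<omega>. \<Sum>k<n. c k * W (A k) \<omega>)"
    using assms(1) unfolding elementary_pair_def by blast
  obtain n' A' c' where **: "\<And>k::nat. A' k \<in> finite_borel_sets"
      "s' = (\<lambda>\<xi>. \<Sum>k<n'. c' k * of_real (indicator (A' k) \<xi>))" "S' = (\<lambda>\<omega>. \<Sum>k<n'. c' k * W (A' k) \<omega>)"
    using assms(2) unfolding elementary_pair_def by blast
  note sq = W_square_integrable[OF *(1)] W_square_integrable[OF **(1)]
  note int = integrable_square_integrable_mult[OF square_integrable_cnj[OF sq(1)] sq(2)]
    integrable_square_integrable_mult[OF sq]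
  have cov: "(\<integral>\<omega>. cnj (W (A k) \<omega>) * W (A' k') \<omega> \<partial>M) = of_real (measure lborel (A k \<inter> A' k'))"
    "(\<integral>\<omega>. W (A k) \<omega> * W (A' k') \<omega> \<partial>M) = 0" for k k'
    using white_noise *(1) **(1) by (auto simp: complex_white_noise_def)
  have mA: "A k \<inter> A' k' \<in> sets lborel" "emeasure lborel (A k \<inter> A' k') < \<infinity>" for k k'
    using *(1)[of k] **(1)[of k'] emeasure_mono[of "A k \<inter> A' k'" "A k" lborel]
    by (auto simp: finite_borel_sets_def intro: le_less_trans)
  have "(\<integral>\<omega>. cnj (S \<omega>) * S' \<omega> \<partial>M)
      = (\<integral>\<omega>. (\<Sum>k<n. \<Sum>k'<n'. cnj (c k) * c' k' * (cnj (W (A k) \<omega>) * W (A' k') \<omega>)) \<partial>M)"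
    unfolding *(3) **(3) cnj_sum sum_product
    by (intro Bochner_Integration.integral_cong refl sum.cong) (simp add: mult_ac)
  also have "\<dots> = (\<Sum>k<n. \<Sum>k'<n'. cnj (c k) * c' k' * of_real (measure lborel (A k \<inter> A' k')))"
    using int by (simp add: Bochner_Integration.integral_sum cov)
  also have "\<dots> = (\<integral>\<xi>. (\<Sum>k<n. \<Sum>k'<n'. cnj (c k) * c' k' * of_real (indicator (A k \<inter> A' k') \<xi>)) \<partial>lborel)"
  proof -
    have "integrable lborel (\<lambda>\<xi>. complex_of_real (indicator (A k \<inter> A' k') \<xi>))" for k k'
      using mA by (intro integrable_of_real) auto
    moreover have "(\<integral>\<xi>. complex_of_real (indicator (A k \<inter> A' k') \<xi>) \<partial>lborel)
        = of_real (measure lborel (A k \<inter> A' k'))" for k k'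
      using mA by (subst integral_complex_of_real) auto
    ultimately show ?thesis by (simp add: Bochner_Integration.integral_sum)
  qed
  also have "\<dots> = (\<integral>\<xi>. cnj (s \<xi>) * s' \<xi> \<partial>lborel)"
    unfolding *(2) **(2) cnj_sum sum_product
    by (intro Bochner_Integration.integral_cong refl sum.cong) (simp add: mult_ac indicator_inter_arith)
  finally show "(\<integral>\<omega>. cnj (S \<omega>) * S' \<omega> \<partial>M) = (\<integral>\<xi>. cnj (s \<xi>) * s' \<xi> \<partial>lborel)" .
  have "(\<integral>\<omega>. S \<omega> * S' \<omega> \<partial>M)
      = (\<integral>\<omega>. (\<Sum>k<n. \<Sum>k'<n'. c k * c' k' * (W (A k) \<omega> * W (A' k') \<omega>)) \<partial>M)"
    unfolding *(3) **(3) cnj_sum sum_product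
    by (intro Bochner_Integration.integral_cong refl sum.cong) (simp add: mult_ac)
  also have "\<dots> = 0"
    using int by (simp add: Bochner_Integration.integral_sum cov)
  finally show "(\<integral>\<omega>. S \<omega> * S' \<omega> \<partial>M) = 0" .
qed

lemma elementary_pair_isometry:
  "elementary_pair W s S \<Longrightarrow> L2_norm M S = L2_norm lborel s"
  by (intro L2_norm_eq_if_inner_eq elementary_pair_covariance)

text \<open>
  The integrals of approximating simple functions form a Cauchy sequence, by the isometry on
  simple functions, and \<open>L\<^sup>2(M)\<close> is complete.
\<close>

lemma has_wiener_integral_exists:
  assumes h: "square_integrable lborel h"
  shows "\<exists>Z. has_wiener_integral M W h Z"
proof -
  obtain s S where sS: "\<And>j::nat. elementary_pair W (s j) (S j)"
      and lim: "(\<lambda>j. L2_norm lborel (\<lambda>\<xi>. h \<xi> - s j \<xi>)) \<longlonglongrightarrow> 0"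
    by (rule elementary_functions_dense[where W = W, OF h]) (rule that)
  note sq = elementary_pair_square_integrable[OF sS]
  obtain Z where "square_integrable M Z" "(\<lambda>j. L2_norm M (\<lambda>x. Z x - S j x)) \<longlonglongrightarrow> 0"
  proof (rule L2_complete)
    show "square_integrable M (S j)" for j by (rule sq)
    fix e :: real assume "e > 0"
    then obtain N where N: "\<And>j. j \<ge> N \<Longrightarrow> L2_norm lborel (\<lambda>\<xi>. h \<xi> - s j \<xi>) < e/2"
      using LIMSEQ_D[OF lim, of "e/2"] by auto
    have "L2_norm M (\<lambda>x. S i x - S j x) < e" if "i \<ge> N" "j \<ge> N" for i j
    proof -
      have "elementary_pair W (\<lambda>\<xi>. s i \<xi> + (-1) * s j \<xi>) (\<lambda>\<omega>. S i \<omega> + (-1) * S j \<omega>)"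
        by (intro elementary_pair_add elementary_pair_cmult sS)
      from elementary_pair_isometry[OF this]
      have "L2_norm M (\<lambda>x. S i x - S j x) = L2_norm lborel (\<lambda>x. s i x - s j x)" by simp
      also have "\<dots> \<le> L2_norm lborel (\<lambda>x. s i x - h x) + L2_norm lborel (\<lambda>x. h x - s j x)"
        by (intro L2_norm_triangle_diff sq h)
      also have "\<dots> < e"
        using N[OF that(1)] N[OF that(2)] unfolding L2_norm_minus_commute[of lborel "s i" h] by linarith
      finally show ?thesis .
    qed
    then show "\<exists>N. \<forall>i\<ge>N. \<forall>j\<ge>N. L2_norm M (\<lambda>x. S i x - S j x) < e" by blast
  qed blast
  with sS lim h show ?thesis by (auto simp: has_wiener_integral_iff_elementary)
qed

lemma has_wiener_integral_wiener_integral: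
  "square_integrable lborel h \<Longrightarrow> has_wiener_integral M W h (wiener_integral M W h)"
  unfolding wiener_integral_def by (rule someI_ex[OF has_wiener_integral_exists])

lemma has_wiener_integral_square_integrable:
  assumes "has_wiener_integral M W h Z"
  shows "square_integrable lborel h" "square_integrable M Z"
  using assms by (auto simp: has_wiener_integral_def)

lemma has_wiener_integral_linear:
  assumes "has_wiener_integral M W h Z" "has_wiener_integral M W h' Z'"
  shows "has_wiener_integral M W (\<lambda>\<xi>. a * h \<xi> + b * h' \<xi>) (\<lambda>\<omega>. a * Z \<omega> + b * Z' \<omega>)"
proof -
  note sq = has_wiener_integral_square_integrable[OF assms(1)] has_wiener_integral_square_integrable[OF assms(2)]
  obtain s S where sS: "\<And>j::nat. elementary_pair W (s j) (S j)"
      "(\<lambda>j. L2_norm lborel (\<lambda>\<xi>. h \<xi> - s j \<xi>)) \<longlonglongrightarrow> 0" "(\<lambda>j. L2_norm M (\<lambda>\<omega>. Z \<omega> - S j \<omega>)) \<longlonglongrightarrow> 0"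
    using assms(1) unfolding has_wiener_integral_iff_elementary by blast
  obtain s' S' where sS': "\<And>j::nat. elementary_pair W (s' j) (S' j)"
      "(\<lambda>j. L2_norm lborel (\<lambda>\<xi>. h' \<xi> - s' j \<xi>)) \<longlonglongrightarrow> 0" "(\<lambda>j. L2_norm M (\<lambda>\<omega>. Z' \<omega> - S' j \<omega>)) \<longlonglongrightarrow> 0"
    using assms(2) unfolding has_wiener_integral_iff_elementary by blast
  note sqs = elementary_pair_square_integrable[OF sS(1)] elementary_pair_square_integrable[OF sS'(1)]
  have lim0: "(\<lambda>j. cmod a * u j + cmod b * v j) \<longlonglongrightarrow> 0" if "u \<longlonglongrightarrow> 0" "v \<longlonglongrightarrow> 0" for u v :: "nat \<Rightarrow> real"
    using tendsto_add[OF tendsto_mult_left[OF that(1), of "cmod a"] tendsto_mult_left[OF that(2), of "cmod b"]]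
    by simp
  show ?thesis unfolding has_wiener_integral_iff_elementary
  proof (intro conjI exI allI)
    show "elementary_pair W (\<lambda>\<xi>. a * s j \<xi> + b * s' j \<xi>) (\<lambda>\<omega>. a * S j \<omega> + b * S' j \<omega>)" for j
      by (intro elementary_pair_add elementary_pair_cmult sS sS')
    show "(\<lambda>j. L2_norm lborel (\<lambda>\<xi>. (a * h \<xi> + b * h' \<xi>) - (a * s j \<xi> + b * s' j \<xi>))) \<longlonglongrightarrow> 0"
    proof (rule tendsto_0_if_le[OF lim0[OF sS(2) sS'(2)]])
      fix j
      have "(\<lambda>\<xi>. (a * h \<xi> + b * h' \<xi>) - (a * s j \<xi> + b * s' j \<xi>)) = (\<lambda>\<xi>. a * (h \<xi> - s j \<xi>) + b * (h' \<xi> - s' j \<xi>))"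
        by (simp add: algebra_simps)
      then show "L2_norm lborel (\<lambda>\<xi>. (a * h \<xi> + b * h' \<xi>) - (a * s j \<xi> + b * s' j \<xi>))
          \<le> cmod a * L2_norm lborel (\<lambda>\<xi>. h \<xi> - s j \<xi>) + cmod b * L2_norm lborel (\<lambda>\<xi>. h' \<xi> - s' j \<xi>)"
        using L2_norm_linear_comb_le[OF square_integrable_diff[OF sq(1) sqs(1)] square_integrable_diff[OF sq(3) sqs(3)]]
        by simp
    qed simp
    show "(\<lambda>j. L2_norm M (\<lambda>\<omega>. (a * Z \<omega> + b * Z' \<omega>) - (a * S j \<omega> + b * S' j \<omega>))) \<longlonglongrightarrow> 0"
    proof (rule tendsto_0_if_le[OF lim0[OF sS(3) sS'(3)]])
      fix j
      have "(\<lambda>\<omega>. (a * Z \<omega> + b * Z' \<omega>) - (a * S j \<omega> + b * S' j \<omega>)) = (\<lambda>\<omega>. a * (Z \<omega> - S j \<omega>) + b * (Z' \<omega> - S' j \<omega>))"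
        by (simp add: algebra_simps)
      then show "L2_norm M (\<lambda>\<omega>. (a * Z \<omega> + b * Z' \<omega>) - (a * S j \<omega> + b * S' j \<omega>))
          \<le> cmod a * L2_norm M (\<lambda>\<omega>. Z \<omega> - S j \<omega>) + cmod b * L2_norm M (\<lambda>\<omega>. Z' \<omega> - S' j \<omega>)"
        using L2_norm_linear_comb_le[OF square_integrable_diff[OF sq(2) sqs(2)] square_integrable_diff[OF sq(4) sqs(4)]]
        by simp
    qed simp
  qed (use sq in \<open>auto intro!: square_integrable_add square_integrable_cmult\<close>)
qed

lemma has_wiener_integral_zero: "has_wiener_integral M W (\<lambda>\<xi>. 0) (\<lambda>\<omega>. 0)"
  unfolding has_wiener_integral_iff_elementary
  by (auto intro!: exI[of _ "\<lambda>_ _. 0"] elementary_pair_zero simp: L2_norm_def)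

lemma has_wiener_integral_cmult:
  "has_wiener_integral M W h Z \<Longrightarrow> has_wiener_integral M W (\<lambda>\<xi>. a * h \<xi>) (\<lambda>\<omega>. a * Z \<omega>)"
  using has_wiener_integral_linear[OF _ has_wiener_integral_zero, of h Z a 0] by simp

lemma has_wiener_integral_diff:
  "has_wiener_integral M W h Z \<Longrightarrow> has_wiener_integral M W h' Z' \<Longrightarrow>
   has_wiener_integral M W (\<lambda>\<xi>. h \<xi> - h' \<xi>) (\<lambda>\<omega>. Z \<omega> - Z' \<omega>)"
  using has_wiener_integral_linear[of h Z h' Z' 1 "-1"] by simp

lemma has_wiener_integral_sum:
  assumes "\<And>k. k \<in> J \<Longrightarrow> has_wiener_integral M W (h k) (Z k)"
  shows "has_wiener_integral M W (\<lambda>\<xi>. \<Sum>k\<in>J. h k \<xi>) (\<lambda>\<omega>. \<Sum>k\<in>J. Z k \<omega>)"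
  using assms
proof (induction J rule: infinite_finite_induct)
  case (insert k J)
  then show ?case using has_wiener_integral_linear[of "h k" "Z k" "\<lambda>\<xi>. \<Sum>k\<in>J. h k \<xi>" "\<lambda>\<omega>. \<Sum>k\<in>J. Z k \<omega>" 1 1]
    by simp
qed (auto intro: has_wiener_integral_zero)

lemma has_wiener_integral_covariance:
  assumes "has_wiener_integral M W h Z" "has_wiener_integral M W h' Z'"
  shows "(\<integral>\<omega>. cnj (Z \<omega>) * Z' \<omega> \<partial>M) = (\<integral>\<xi>. cnj (h \<xi>) * h' \<xi> \<partial>lborel)"
proof -
  note sq = has_wiener_integral_square_integrable[OF assms(1)] has_wiener_integral_square_integrable[OF assms(2)]
  obtain s S where sS: "\<And>j::nat. elementary_pair W (s j) (S j)"
      "(\<lambda>j. L2_norm lborel (\<lambda>\<xi>. h \<xi> - s j \<xi>)) \<longlonglongrightarrow> 0" "(\<lambda>j. L2_norm M (\<lambda>\<omega>. Z \<omega> - S j \<omega>)) \<longlonglongrightarrow> 0"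
    using assms(1) unfolding has_wiener_integral_iff_elementary by blast
  obtain s' S' where sS': "\<And>j::nat. elementary_pair W (s' j) (S' j)"
      "(\<lambda>j. L2_norm lborel (\<lambda>\<xi>. h' \<xi> - s' j \<xi>)) \<longlonglongrightarrow> 0" "(\<lambda>j. L2_norm M (\<lambda>\<omega>. Z' \<omega> - S' j \<omega>)) \<longlonglongrightarrow> 0"
    using assms(2) unfolding has_wiener_integral_iff_elementary by blast
  note sqs = elementary_pair_square_integrable[OF sS(1)] elementary_pair_square_integrable[OF sS'(1)]
  have "(\<lambda>j. \<integral>\<omega>. cnj (S j \<omega>) * S' j \<omega> \<partial>M) \<longlonglongrightarrow> (\<integral>\<omega>. cnj (Z \<omega>) * Z' \<omega> \<partial>M)"
    by (intro integral_mult_tendsto square_integrable_cnj sq sqs) (auto simp: L2_norm_cnj_diff sS sS')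
  moreover have "(\<lambda>j. \<integral>\<xi>. cnj (s j \<xi>) * s' j \<xi> \<partial>lborel) \<longlonglongrightarrow> (\<integral>\<xi>. cnj (h \<xi>) * h' \<xi> \<partial>lborel)"
    by (intro integral_mult_tendsto square_integrable_cnj sq sqs) (auto simp: L2_norm_cnj_diff sS sS')
  ultimately show ?thesis
    unfolding elementary_pair_covariance(1)[OF sS(1) sS'(1)] by (rule LIMSEQ_unique)
qed

lemma has_wiener_integral_isometry:
  "has_wiener_integral M W h Z \<Longrightarrow> L2_norm M Z = L2_norm lborel h"
  by (intro L2_norm_eq_if_inner_eq has_wiener_integral_covariance)

lemma has_wiener_integral_unique:
  assumes "has_wiener_integral M W h Z" "has_wiener_integral M W h Z'"
  shows "AE \<omega> in M. Z \<omega> = Z' \<omega>"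
proof -
  have *: "has_wiener_integral M W (\<lambda>\<xi>. h \<xi> - h \<xi>) (\<lambda>\<omega>. Z \<omega> - Z' \<omega>)"
    by (rule has_wiener_integral_diff[OF assms])
  then have "AE \<omega> in M. Z \<omega> - Z' \<omega> = 0"
    by (intro AE_eq_0_if_L2_norm_eq_0 has_wiener_integral_square_integrable(2)[OF *])
       (subst has_wiener_integral_isometry[OF *], simp add: L2_norm_def)
  then show ?thesis by simp
qed

end


section \<open>Wiener integrals are jointly Gaussian\<close>

lemma norm_iexp_diff_le: "cmod (iexp a - iexp b) \<le> \<bar>a - b\<bar>"
proof -
  have "iexp a - iexp b = iexp b * (iexp (a - b) - 1)"
    by (simp add: right_diff_distrib exp_add[symmetric] algebra_simps of_real_diff)
  then have "cmod (iexp a - iexp b) = cmod (iexp (a - b) - 1)" by (simp add: norm_mult)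
  also have "\<dots> \<le> \<bar>a - b\<bar>" using iexp_approx1[of "a - b" 0] by simp
  finally show ?thesis .
qed

lemma (in prob_space) integrable_iexp:
  assumes [measurable]: "R \<in> borel_measurable M"
  shows "integrable M (\<lambda>\<omega>. iexp (R \<omega>))"
  by (rule integrable_const_bound[where B = 1]) auto

context white_noise
begin

text \<open>
  The family \<open>W\<close> is Gaussian for sums over sets of indices; equal sets in the list \<open>A\<close> are
  therefore collected first.
\<close>

lemma elementary_pair_real_gaussian:
  assumes "elementary_pair W s S" shows "real_gaussian M (\<lambda>\<omega>. Re (S \<omega>))"
proof -
  obtain n A c where *: "\<And>k::nat. A k \<in> finite_borel_sets" "S = (\<lambda>\<omega>. \<Sum>k<n. c k * W (A k) \<omega>)"
    using assms unfolding elementary_pair_def by blast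
  define C where "C B = (\<Sum>k\<in>{k. k \<in> {..<n} \<and> A k = B}. c k)" for B
  have "S = (\<lambda>\<omega>. \<Sum>B\<in>A ` {..<n}. C B * W B \<omega>)"
  proof
    fix \<omega>
    have "S \<omega> = (\<Sum>B\<in>A ` {..<n}. \<Sum>k\<in>{k. k \<in> {..<n} \<and> A k = B}. c k * W (A k) \<omega>)"
      unfolding *(2) by (rule sum.image_gen) simp
    also have "\<dots> = (\<Sum>B\<in>A ` {..<n}. C B * W B \<omega>)"
      unfolding C_def sum_distrib_right by (intro sum.cong refl) auto
    finally show "S \<omega> = (\<Sum>B\<in>A ` {..<n}. C B * W B \<omega>)" .
  qed
  moreover have "finite (A ` {..<n})" "A ` {..<n} \<subseteq> finite_borel_sets" using *(1) by auto
  ultimately show ?thesis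
    using white_noise by (auto simp: complex_white_noise_def gaussian_family_def)
qed

text \<open>
  As \<open>E[S\<^sup>2] = 0\<close>, the variance of \<open>Re S\<close> is half of \<open>E[\<bar>S\<bar>\<^sup>2]\<close>; this is where circular symmetry
  of the noise enters.
\<close>

lemma elementary_pair_char:
  assumes ep: "elementary_pair W s S"
  shows "(\<integral>\<omega>. iexp (Re (S \<omega>)) \<partial>M) = of_real (exp (- (L2_norm lborel s)\<^sup>2 / 4))"
proof -
  obtain n A c where *: "\<And>k::nat. A k \<in> finite_borel_sets" "S = (\<lambda>\<omega>. \<Sum>k<n. c k * W (A k) \<omega>)"
    using ep unfolding elementary_pair_def by blast
  note sq = elementary_pair_square_integrable[OF ep]
  have W0: "integrable M (W (A k))" "expectation (W (A k)) = 0" for k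
    using W_square_integrable[OF *(1)] white_noise *(1)
    by (auto simp: integrable_square_integrable complex_white_noise_def)
  have "(\<integral>\<omega>. S \<omega> \<partial>M) = 0"
    unfolding *(2) using W0 by (simp add: Bochner_Integration.integral_sum)
  then have mean: "expectation (\<lambda>\<omega>. Re (S \<omega>)) = 0"
    using integral_Re[OF integrable_square_integrable[OF sq(2)]] by simp
  have int: "integrable M (\<lambda>\<omega>. S \<omega> * S \<omega>)" by (rule integrable_square_integrable_mult[OF sq(2) sq(2)])
  have "(Re z)\<^sup>2 = ((cmod z)\<^sup>2 + Re (z * z)) / 2" for z
    unfolding cmod_power2 by (simp add: power2_eq_square)
  then have "expectation (\<lambda>\<omega>. (Re (S \<omega>))\<^sup>2) = expectation (\<lambda>\<omega>. ((cmod (S \<omega>))\<^sup>2 + Re (S \<omega> * S \<omega>)) / 2)"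
    by (simp only:)
  also have "\<dots> = ((L2_norm M S)\<^sup>2 + Re (\<integral>\<omega>. S \<omega> * S \<omega> \<partial>M)) / 2"
    using square_integrableD(2)[OF sq(2)] int integral_Re[OF int] integrable_Re[OF int]
    by (simp add: L2_norm_power2)
  also have "\<dots> = (L2_norm lborel s)\<^sup>2 / 2"
    by (simp add: elementary_pair_covariance(2)[OF ep ep] elementary_pair_isometry[OF ep])
  finally show ?thesis
    using real_gaussian_char[OF elementary_pair_real_gaussian[OF ep] mean] by simp
qed

lemma has_wiener_integral_char:
  assumes "has_wiener_integral M W h Z"
  shows "(\<integral>\<omega>. iexp (Re (Z \<omega>)) \<partial>M) = of_real (exp (- (L2_norm lborel h)\<^sup>2 / 4))"
proof -
  note sq = has_wiener_integral_square_integrable[OF assms]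
  obtain s S where sS: "\<And>j::nat. elementary_pair W (s j) (S j)"
      "(\<lambda>j. L2_norm lborel (\<lambda>\<xi>. h \<xi> - s j \<xi>)) \<longlonglongrightarrow> 0" "(\<lambda>j. L2_norm M (\<lambda>\<omega>. Z \<omega> - S j \<omega>)) \<longlonglongrightarrow> 0"
    using assms unfolding has_wiener_integral_iff_elementary by blast
  note sqs = elementary_pair_square_integrable[OF sS(1)]
  note [measurable] = square_integrableD(1)[OF sq(2)] square_integrableD(1)[OF sqs(2)]
  have le: "cmod ((\<integral>\<omega>. iexp (Re (S j \<omega>)) \<partial>M) - (\<integral>\<omega>. iexp (Re (Z \<omega>)) \<partial>M)) \<le> L2_norm M (\<lambda>\<omega>. Z \<omega> - S j \<omega>)" for j
  proof -
    have "(\<integral>\<omega>. iexp (Re (S j \<omega>)) \<partial>M) - (\<integral>\<omega>. iexp (Re (Z \<omega>)) \<partial>M)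
        = (\<integral>\<omega>. iexp (Re (S j \<omega>)) - iexp (Re (Z \<omega>)) \<partial>M)"
      by (intro Bochner_Integration.integral_diff[symmetric] integrable_iexp) measurable
    also have "cmod \<dots> \<le> (\<integral>\<omega>. cmod (iexp (Re (S j \<omega>)) - iexp (Re (Z \<omega>))) \<partial>M)"
      by (rule integral_norm_bound)
    also have "\<dots> \<le> (\<integral>\<omega>. cmod (Z \<omega> - S j \<omega>) \<partial>M)"
    proof (rule integral_mono)
      show "integrable M (\<lambda>\<omega>. cmod (iexp (Re (S j \<omega>)) - iexp (Re (Z \<omega>))))"
        by (intro integrable_norm Bochner_Integration.integrable_diff integrable_iexp) measurable
      show "integrable M (\<lambda>\<omega>. cmod (Z \<omega> - S j \<omega>))"
        by (intro integrable_norm integrable_square_integrable square_integrable_diff sq sqs)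
      show "cmod (iexp (Re (S j \<omega>)) - iexp (Re (Z \<omega>))) \<le> cmod (Z \<omega> - S j \<omega>)" for \<omega>
        using order_trans[OF norm_iexp_diff_le[of "Re (S j \<omega>)" "Re (Z \<omega>)"]] abs_Re_le_cmod[of "Z \<omega> - S j \<omega>"]
        by (simp add: abs_minus_commute)
    qed
    also have "\<dots> \<le> L2_norm M (\<lambda>\<omega>. Z \<omega> - S j \<omega>)"
      by (intro integral_norm_le_L2_norm square_integrable_diff sq sqs)
    finally show ?thesis .
  qed
  have "(\<lambda>j. (\<integral>\<omega>. iexp (Re (S j \<omega>)) \<partial>M) - (\<integral>\<omega>. iexp (Re (Z \<omega>)) \<partial>M)) \<longlonglongrightarrow> 0"
    by (intro tendsto_norm_zero_cancel[OF tendsto_0_if_le[OF sS(3)]] le) auto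
  then have "(\<lambda>j. \<integral>\<omega>. iexp (Re (S j \<omega>)) \<partial>M) \<longlonglongrightarrow> (\<integral>\<omega>. iexp (Re (Z \<omega>)) \<partial>M)"
    by (simp add: LIM_zero_iff)
  moreover have "(\<lambda>j. \<integral>\<omega>. iexp (Re (S j \<omega>)) \<partial>M) \<longlonglongrightarrow> of_real (exp (- (L2_norm lborel h)\<^sup>2 / 4))"
    unfolding elementary_pair_char[OF sS(1)]
    by (intro tendsto_intros L2_norm_tendsto[OF sq(1) sqs(1) sS(2)]) simp
  ultimately show ?thesis by (rule LIMSEQ_unique)
qed

text \<open>
  The characteristic function of \<open>Re Z\<close>, rescaled to variance \<open>1\<close>, is the standard normal one; the
  variance \<open>\<parallel>h\<parallel>\<^sup>2 / 2\<close> is read off from \<open>has_wiener_integral_char\<close>.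
\<close>

lemma has_wiener_integral_real_gaussian:
  assumes hZ: "has_wiener_integral M W h Z"
  shows "real_gaussian M (\<lambda>\<omega>. Re (Z \<omega>))"
proof -
  note sq = has_wiener_integral_square_integrable[OF hZ]
  note [measurable] = square_integrableD(1)[OF sq(2)]
  define v where "v = L2_norm lborel h"
  show ?thesis
  proof (cases "v = 0")
    case True
    then have "AE \<omega> in M. Z \<omega> = 0"
      using AE_eq_0_if_L2_norm_eq_0[OF sq(2)] has_wiener_integral_isometry[OF hZ] by (simp add: v_def)
    then have "AE \<omega> in M. Re (Z \<omega>) = 0" by auto
    then show ?thesis unfolding real_gaussian_def
      by (intro conjI exI[of _ 0]) auto
  next
    case False
    then have "v > 0" using L2_norm_nonneg[of lborel h] unfolding v_def by linarith
    define \<sigma> where "\<sigma> = v / sqrt 2"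
    have \<sigma>: "\<sigma> > 0" using \<open>v > 0\<close> by (simp add: \<sigma>_def)
    let ?D = "distr M borel (\<lambda>\<omega>. Re (Z \<omega>) / \<sigma>)"
    have rd: "real_distribution ?D" by (rule real_distribution_distr) measurable
    have "?D = std_normal_distribution"
    proof (rule Levy_uniqueness[OF rd])
      show "real_distribution std_normal_distribution"
        using real_dist_normal_dist by simp
      show "char ?D = char std_normal_distribution"
      proof
        fix u
        have "char ?D u = (\<integral>\<omega>. iexp (Re (of_real (u / \<sigma>) * Z \<omega>)) \<partial>M)"
          unfolding char_def by (subst integral_distr) auto
        also have "\<dots> = of_real (exp (- (cmod (of_real (u / \<sigma>)) * v)\<^sup>2 / 4))"
          using has_wiener_integral_char[OF has_wiener_integral_cmult[OF hZ, of "of_real (u / \<sigma>)"]]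
          by (simp only: L2_norm_cmult v_def)
        also have "(cmod (of_real (u / \<sigma>)) * v)\<^sup>2 = 2 * u\<^sup>2"
          using \<open>v > 0\<close> by (simp only: norm_of_real power_mult_distrib power2_abs) (simp add: \<sigma>_def power_divide power_mult_distrib)
        finally show "char ?D u = char std_normal_distribution u"
          by (simp add: char_std_normal_distribution)
      qed
    qed
    then have "distributed M lborel (\<lambda>\<omega>. (Re (Z \<omega>) - 0) / \<sigma>) (\<lambda>x. ennreal (std_normal_density x))"
      by (auto simp: distributed_def cong: distr_cong)
    then have "distributed M lborel (\<lambda>\<omega>. Re (Z \<omega>)) (\<lambda>x. ennreal (normal_density 0 \<sigma> x))"
      using normal_standard_normal_convert[OF \<sigma>] by blast
    then show ?thesis unfolding real_gaussian_def using \<sigma> by auto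
  qed
qed

lemma has_wiener_integral_gaussian_family:
  assumes "\<And>i. i \<in> I \<Longrightarrow> has_wiener_integral M W (h i) (X i)"
  shows "gaussian_family M I X"
  unfolding gaussian_family_def
proof (intro conjI ballI allI impI)
  fix J c assume J: "finite J \<and> J \<subseteq> I"
  have "has_wiener_integral M W (\<lambda>\<xi>. \<Sum>j\<in>J. c j * h j \<xi>) (\<lambda>\<omega>. \<Sum>j\<in>J. c j * X j \<omega>)"
    using J assms by (intro has_wiener_integral_sum has_wiener_integral_cmult) auto
  then show "real_gaussian M (\<lambda>\<omega>. Re (\<Sum>j\<in>J. c j * X j \<omega>))"
    by (rule has_wiener_integral_real_gaussian)
qed (use assms has_wiener_integral_square_integrable square_integrableD in blast)

end


section \<open>Characteristic functions determine the law of a random field\<close>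

context prob_space
begin

text \<open>
  After division by the common mass \<open>c\<close>, the weights are densities of probability measures, to which
  the uniqueness theorem of Levy applies. The bounds keep \<open>c\<close> positive and everything integrable.
\<close>

lemma Levy_uniqueness_weighted_pos:
  fixes X Y p q :: "'a \<Rightarrow> real"
  assumes [measurable]: "X \<in> borel_measurable M" "Y \<in> borel_measurable M"
      "p \<in> borel_measurable M" "q \<in> borel_measurable M"
    and p: "\<And>\<omega>. 1 \<le> p \<omega>" "\<And>\<omega>. p \<omega> \<le> 3" and q: "\<And>\<omega>. 1 \<le> q \<omega>" "\<And>\<omega>. q \<omega> \<le> 3"
    and eq: "\<And>v. (\<integral>\<omega>. iexp (v * X \<omega>) * of_real (p \<omega>) \<partial>M) = (\<integral>\<omega>. iexp (v * Y \<omega>) * of_real (q \<omega>) \<partial>M)"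
    and A: "A \<in> sets borel"
  shows "(\<integral>\<omega>. indicator A (X \<omega>) * p \<omega> \<partial>M) = (\<integral>\<omega>. indicator A (Y \<omega>) * q \<omega> \<partial>M)"
proof -
  note [measurable] = A
  have int: "integrable M p" "integrable M q"
    using p q order_trans[OF zero_le_one p(1)] order_trans[OF zero_le_one q(1)]
    by (auto intro!: integrable_const_bound[where B = 3])
  define c where "c = expectation p"
  have cq: "c = expectation q"
  proof -
    have "(\<integral>\<omega>. complex_of_real (p \<omega>) \<partial>M) = (\<integral>\<omega>. complex_of_real (q \<omega>) \<partial>M)" using eq[of 0] by simp
    then show ?thesis by (simp add: c_def)
  qed
  have "1 \<le> c" unfolding c_def using p int by (intro integral_ge_const) auto
  define M1 where "M1 p = density M (\<lambda>\<omega>. ennreal (p \<omega> / c))" for p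
  have *: "prob_space (M1 r) \<and> (\<forall>v. char (distr (M1 r) borel V) v = (\<integral>\<omega>. iexp (v * V \<omega>) * of_real (r \<omega>) \<partial>M) / of_real c)
      \<and> (\<integral>\<omega>. indicator A (V \<omega>) * r \<omega> \<partial>M) = c * measure (distr (M1 r) borel V) A"
    if [measurable]: "r \<in> borel_measurable M" "V \<in> borel_measurable M"
      and r: "\<And>\<omega>. 1 \<le> r \<omega>" and intr: "integrable M r" and cr: "c = expectation r" for r V :: "'a \<Rightarrow> real"
  proof (intro conjI allI)
    have nn: "0 \<le> r \<omega> / c" for \<omega> using r[of \<omega>] \<open>1 \<le> c\<close> by simp
    show ps: "prob_space (M1 r)"
    proof
      have "emeasure (M1 r) (space (M1 r)) = (\<integral>\<^sup>+\<omega>. ennreal (r \<omega> / c) \<partial>M)"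
        by (simp add: M1_def emeasure_density nn_integral_set_ennreal cong: nn_integral_cong)
      also have "\<dots> = ennreal (\<integral>\<omega>. r \<omega> / c \<partial>M)"
        using intr nn by (intro nn_integral_eq_integral) auto
      also have "\<dots> = 1" using cr \<open>1 \<le> c\<close> by simp
      finally show "emeasure (M1 r) (space (M1 r)) = 1" .
    qed
    interpret P1: prob_space "M1 r" by (rule ps)
    have V1: "V \<in> borel_measurable (M1 r)" by (simp add: M1_def)
    show "char (distr (M1 r) borel V) v = (\<integral>\<omega>. iexp (v * V \<omega>) * of_real (r \<omega>) \<partial>M) / of_real c" for v
    proof -
      have "char (distr (M1 r) borel V) v = (\<integral>\<omega>. iexp (v * V \<omega>) \<partial>M1 r)"
        unfolding char_def by (subst integral_distr) (auto simp: V1)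
      also have "\<dots> = (\<integral>\<omega>. (r \<omega> / c) *\<^sub>R iexp (v * V \<omega>) \<partial>M)"
        unfolding M1_def using nn by (subst integral_density) auto
      also have "\<dots> = (\<integral>\<omega>. iexp (v * V \<omega>) * of_real (r \<omega>) / of_real c \<partial>M)"
        by (intro Bochner_Integration.integral_cong refl) (simp add: scaleR_conv_of_real)
      finally show ?thesis by simp
    qed
    have "measure (distr (M1 r) borel V) A = (\<integral>\<omega>. indicator A (V \<omega>) \<partial>M1 r)"
    proof -
      have "measure (distr (M1 r) borel V) A = (\<integral>x. indicator A x \<partial>distr (M1 r) borel V)"
        by simp
      also have "\<dots> = (\<integral>\<omega>. indicator A (V \<omega>) \<partial>M1 r)"
        by (rule integral_distr[OF V1]) simp
      finally show ?thesis .
    qed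
    also have "\<dots> = (\<integral>\<omega>. (r \<omega> / c) *\<^sub>R indicator A (V \<omega>) \<partial>M)"
      unfolding M1_def using nn by (subst integral_density) auto
    also have "\<dots> = (\<integral>\<omega>. indicator A (V \<omega>) * r \<omega> / c \<partial>M)"
      by (intro Bochner_Integration.integral_cong refl) simp
    finally show "(\<integral>\<omega>. indicator A (V \<omega>) * r \<omega> \<partial>M) = c * measure (distr (M1 r) borel V) A"
      using \<open>1 \<le> c\<close> by simp
  qed
  note X = *[OF assms(3,1) p(1) int(1) c_def] and Y = *[OF assms(4,2) q(1) int(2) cq]
  have "distr (M1 p) borel X = distr (M1 q) borel Y"
  proof (rule Levy_uniqueness)
    show "real_distribution (distr (M1 p) borel X)" "real_distribution (distr (M1 q) borel Y)"
      using X Y by (auto intro!: prob_space.real_distribution_distr simp: M1_def)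
    show "char (distr (M1 p) borel X) = char (distr (M1 q) borel Y)"
      using X Y eq by auto
  qed
  with X Y show ?thesis by simp
qed

text \<open>
  A complex weight \<open>G\<close> of modulus at most \<open>1\<close> is reduced to the positive weights \<open>2 + Re G\<close> and
  \<open>2 + Im G\<close>. Their Fourier transforms are known because conjugating the Fourier transform of
  \<open>G\<close> at \<open>-v\<close> gives that of the conjugate of \<open>G\<close> at \<open>v\<close>.
\<close>

lemma Levy_uniqueness_weighted:
  fixes X Y :: "'a \<Rightarrow> real" and G H :: "'a \<Rightarrow> complex"
  assumes [measurable]: "X \<in> borel_measurable M" "Y \<in> borel_measurable M"
      "G \<in> borel_measurable M" "H \<in> borel_measurable M"
    and GH: "\<And>\<omega>. cmod (G \<omega>) \<le> 1" "\<And>\<omega>. cmod (H \<omega>) \<le> 1"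
    and eq1: "\<And>v. (\<integral>\<omega>. iexp (v * X \<omega>) \<partial>M) = (\<integral>\<omega>. iexp (v * Y \<omega>) \<partial>M)"
    and eq: "\<And>v. (\<integral>\<omega>. iexp (v * X \<omega>) * G \<omega> \<partial>M) = (\<integral>\<omega>. iexp (v * Y \<omega>) * H \<omega> \<partial>M)"
    and A: "A \<in> sets borel"
  shows "(\<integral>\<omega>. of_real (indicator A (X \<omega>)) * G \<omega> \<partial>M) = (\<integral>\<omega>. of_real (indicator A (Y \<omega>)) * H \<omega> \<partial>M)"
proof -
  note [measurable] = A
  have bdd: "integrable M (\<lambda>\<omega>. U \<omega> * K \<omega>)"
    if [measurable]: "U \<in> borel_measurable M" "K \<in> borel_measurable M"
      and "\<And>\<omega>. cmod (U \<omega>) \<le> 1" "\<And>\<omega>. cmod (K \<omega>) \<le> 1" for U K :: "'a \<Rightarrow> complex"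
    using that by (intro integrable_const_bound[where B = 1])
      (auto simp: norm_mult intro!: AE_I2 mult_le_one)
  have cnj_m: "(\<lambda>\<omega>. cnj (K \<omega>)) \<in> borel_measurable M" if "K \<in> borel_measurable M" for K :: "'a \<Rightarrow> complex"
  proof -
    have "cnj \<in> borel_measurable borel" by (intro borel_measurable_continuous_onI continuous_intros)
    from measurable_compose[OF that this] show ?thesis .
  qed
  have cnj_eq: "(\<integral>\<omega>. iexp (v * V \<omega>) * cnj (K \<omega>) \<partial>M) = cnj (\<integral>\<omega>. iexp (- v * V \<omega>) * K \<omega> \<partial>M)" for V K v
    by (subst Bochner_Integration.integral_cnj[symmetric]) (simp add: exp_cnj)
  have Re_case: "(\<integral>\<omega>. indicator A (X \<omega>) * Re (a * G \<omega>) \<partial>M) = (\<integral>\<omega>. indicator A (Y \<omega>) * Re (a * H \<omega>) \<partial>M)"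
    if a: "cmod a = 1" for a
  proof -
    have aGH: "\<bar>Re (a * G \<omega>)\<bar> \<le> 1" "\<bar>Re (a * H \<omega>)\<bar> \<le> 1" for \<omega>
      using abs_Re_le_cmod[of "a * G \<omega>"] abs_Re_le_cmod[of "a * H \<omega>"] GH[of \<omega>] a
      by (auto simp: norm_mult simp del: times_complex.sel)
    have expand: "(\<integral>\<omega>. iexp (v * V \<omega>) * of_real (2 + Re (a * K \<omega>)) \<partial>M)
        = 2 * (\<integral>\<omega>. iexp (v * V \<omega>) \<partial>M) + (a * (\<integral>\<omega>. iexp (v * V \<omega>) * K \<omega> \<partial>M)
          + cnj a * cnj (\<integral>\<omega>. iexp (- v * V \<omega>) * K \<omega> \<partial>M)) / 2"
      if [measurable]: "V \<in> borel_measurable M" "K \<in> borel_measurable M" and K: "\<And>\<omega>. cmod (K \<omega>) \<le> 1" for V v K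
    proof -
      note [measurable] = cnj_m[OF that(2)]
      have Re_eq: "complex_of_real (2 + Re z) = 2 + (z + cnj z) / 2" for z
        by (simp add: complex_eq_iff)
      have "(\<integral>\<omega>. iexp (v * V \<omega>) * of_real (2 + Re (a * K \<omega>)) \<partial>M)
          = (\<integral>\<omega>. 2 * iexp (v * V \<omega>) + (a * (iexp (v * V \<omega>) * K \<omega>) + cnj a * (iexp (v * V \<omega>) * cnj (K \<omega>))) / 2 \<partial>M)"
        unfolding Re_eq by (intro Bochner_Integration.integral_cong refl) (simp add: algebra_simps add_divide_distrib)
      also have "\<dots> = 2 * (\<integral>\<omega>. iexp (v * V \<omega>) \<partial>M) + (a * (\<integral>\<omega>. iexp (v * V \<omega>) * K \<omega> \<partial>M)
          + cnj a * (\<integral>\<omega>. iexp (v * V \<omega>) * cnj (K \<omega>) \<partial>M)) / 2"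
      proof -
        have i: "integrable M (\<lambda>\<omega>. iexp (v * V \<omega>))" "integrable M (\<lambda>\<omega>. iexp (v * V \<omega>) * K \<omega>)"
            "integrable M (\<lambda>\<omega>. iexp (v * V \<omega>) * cnj (K \<omega>))"
          using bdd[of "\<lambda>\<omega>. iexp (v * V \<omega>)" "\<lambda>_. 1"] bdd[of "\<lambda>\<omega>. iexp (v * V \<omega>)" K]
            bdd[of "\<lambda>\<omega>. iexp (v * V \<omega>)" "\<lambda>\<omega>. cnj (K \<omega>)"] K by auto
        show ?thesis using i by (simp del: of_real_mult)
      qed
      finally show ?thesis unfolding cnj_eq .
    qed
    have p: "(\<integral>\<omega>. indicator A (X \<omega>) * (2 + Re (a * G \<omega>)) \<partial>M) = (\<integral>\<omega>. indicator A (Y \<omega>) * (2 + Re (a * H \<omega>)) \<partial>M)"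
    proof (rule Levy_uniqueness_weighted_pos)
      show "(\<integral>\<omega>. iexp (v * X \<omega>) * of_real (2 + Re (a * G \<omega>)) \<partial>M)
          = (\<integral>\<omega>. iexp (v * Y \<omega>) * of_real (2 + Re (a * H \<omega>)) \<partial>M)" for v
        by (simp only: expand[OF assms(1,3) GH(1)] expand[OF assms(2,4) GH(2)] eq eq1)
      show "1 \<le> 2 + Re (a * G \<omega>)" "2 + Re (a * G \<omega>) \<le> 3" "1 \<le> 2 + Re (a * H \<omega>)" "2 + Re (a * H \<omega>) \<le> 3" for \<omega>
        using aGH[of \<omega>] by linarith+
    qed (use A in measurable)
    have one: "(\<integral>\<omega>. indicator A (X \<omega>) * 1 \<partial>M) = (\<integral>\<omega>. indicator A (Y \<omega>) * (1::real) \<partial>M)"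
      by (rule Levy_uniqueness_weighted_pos[OF assms(1,2)]) (use eq1 A in auto)
    have i: "integrable M (\<lambda>\<omega>. indicat_real A (V \<omega>))" "integrable M (\<lambda>\<omega>. indicat_real A (V \<omega>) * Re (a * K \<omega>))"
      if [measurable]: "V \<in> borel_measurable M" "K \<in> borel_measurable M" and K: "\<And>\<omega>. \<bar>Re (a * K \<omega>)\<bar> \<le> 1" for V K
      using K by (auto intro!: integrable_const_bound[where B = 1] split: split_indicator simp del: times_complex.sel)
    show ?thesis
      using p one i[OF assms(1,3) aGH(1)] i[OF assms(2,4) aGH(2)]
      by (simp add: distrib_left del: times_complex.sel)
  qed
  have split: "(\<integral>\<omega>. of_real (indicator A (V \<omega>)) * K \<omega> \<partial>M)
      = Complex (\<integral>\<omega>. indicator A (V \<omega>) * Re (1 * K \<omega>) \<partial>M) (\<integral>\<omega>. indicator A (V \<omega>) * Re (-\<i> * K \<omega>) \<partial>M)"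
    if [measurable]: "V \<in> borel_measurable M" "K \<in> borel_measurable M" and K: "\<And>\<omega>. cmod (K \<omega>) \<le> 1" for V K
  proof -
    have "integrable M (\<lambda>\<omega>. of_real (indicator A (V \<omega>)) * K \<omega>)"
      using K by (intro bdd) (auto split: split_indicator)
    from integral_Re[OF this] integral_Im[OF this] show ?thesis
      by (simp add: complex_eq_iff)
  qed
  show ?thesis
    unfolding split[OF assms(1,3) GH(1)] split[OF assms(2,4) GH(2)]
    using Re_case[of 1] Re_case[of "-\<i>"] by (simp only: norm_one norm_minus_cancel norm_ii)
qed

text \<open>
  The one-dimensional statement is applied to one coordinate after another, which adds its indicator
  to the weight. The characters of all coordinates stay in the weight as well, so that the hypothesis
  on the next coordinate \<open>m\<close> is the induction hypothesis with \<open>u m\<close> shifted by \<open>v\<close>.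
\<close>

lemma finite_dim_law_eq:
  fixes X Y :: "'i \<Rightarrow> 'a \<Rightarrow> real"
  assumes X: "\<And>i. X i \<in> borel_measurable M" and Y: "\<And>i. Y i \<in> borel_measurable M"
    and I: "finite I"
    and eq: "\<And>u. (\<integral>\<omega>. iexp (\<Sum>i\<in>I. u i * X i \<omega>) \<partial>M) = (\<integral>\<omega>. iexp (\<Sum>i\<in>I. u i * Y i \<omega>) \<partial>M)"
    and A: "\<And>i. A i \<in> sets borel" and "S \<subseteq> I"
  shows "(\<integral>\<omega>. of_real (\<Prod>i\<in>S. indicator (A i) (X i \<omega>)) * iexp (\<Sum>i\<in>I. u i * X i \<omega>) \<partial>M)
    = (\<integral>\<omega>. of_real (\<Prod>i\<in>S. indicator (A i) (Y i \<omega>)) * iexp (\<Sum>i\<in>I. u i * Y i \<omega>) \<partial>M)"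
  using finite_subset[OF \<open>S \<subseteq> I\<close> I] \<open>S \<subseteq> I\<close>
proof (induction S arbitrary: u rule: finite_induct)
  case empty
  then show ?case using eq by simp
next
  case (insert m S)
  note [measurable] = X Y A
  have m: "m \<in> I" using insert by auto
  have upd: "(\<Sum>i\<in>I. (u(m := u m + v)) i * Z i) = v * Z m + (\<Sum>i\<in>I. u i * Z i)" for u v and Z :: "'i \<Rightarrow> real"
  proof -
    have "(\<Sum>i\<in>I. (u(m := u m + v)) i * Z i) = (\<Sum>i\<in>I. u i * Z i + (if i = m then v * Z m else 0))"
      by (intro sum.cong) (auto simp: algebra_simps)
    also have "\<dots> = (\<Sum>i\<in>I. u i * Z i) + v * Z m"
      using m I by (simp add: sum.distrib)
    finally show ?thesis by simp
  qed
  have prod_le: "cmod (of_real (\<Prod>i\<in>S. indicator (A i) (Z i)) * iexp r) \<le> 1" for Z :: "'i \<Rightarrow> real" and r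
  proof -
    have "\<bar>\<Prod>i\<in>S. indicat_real (A i) (Z i)\<bar> \<le> 1"
      unfolding abs_prod by (intro prod_le_1) (auto split: split_indicator)
    then show ?thesis by (simp add: norm_mult del: of_real_prod)
  qed
  have "(\<integral>\<omega>. of_real (indicator (A m) (X m \<omega>)) * (of_real (\<Prod>i\<in>S. indicator (A i) (X i \<omega>)) * iexp (\<Sum>i\<in>I. u i * X i \<omega>)) \<partial>M)
    = (\<integral>\<omega>. of_real (indicator (A m) (Y m \<omega>)) * (of_real (\<Prod>i\<in>S. indicator (A i) (Y i \<omega>)) * iexp (\<Sum>i\<in>I. u i * Y i \<omega>)) \<partial>M)"
  proof (rule Levy_uniqueness_weighted[OF X Y _ _ prod_le prod_le])
    show "(\<integral>\<omega>. iexp (v * X m \<omega>) \<partial>M) = (\<integral>\<omega>. iexp (v * Y m \<omega>) \<partial>M)" for v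
      using eq[of "(\<lambda>_. 0)(m := 0 + v)"] unfolding upd[of "\<lambda>_. 0" v] by simp
    show "(\<integral>\<omega>. iexp (v * X m \<omega>) * (of_real (\<Prod>i\<in>S. indicator (A i) (X i \<omega>)) * iexp (\<Sum>i\<in>I. u i * X i \<omega>)) \<partial>M)
        = (\<integral>\<omega>. iexp (v * Y m \<omega>) * (of_real (\<Prod>i\<in>S. indicator (A i) (Y i \<omega>)) * iexp (\<Sum>i\<in>I. u i * Y i \<omega>)) \<partial>M)" for v
    proof -
      have "(\<integral>\<omega>. of_real (\<Prod>i\<in>S. indicator (A i) (X i \<omega>)) * iexp (\<Sum>i\<in>I. (u(m := u m + v)) i * X i \<omega>) \<partial>M)
          = (\<integral>\<omega>. of_real (\<Prod>i\<in>S. indicator (A i) (Y i \<omega>)) * iexp (\<Sum>i\<in>I. (u(m := u m + v)) i * Y i \<omega>) \<partial>M)"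
        using insert by (intro insert.IH) auto
      then show ?thesis
        unfolding upd[of u v] of_real_add distrib_left exp_add by (simp only: mult_ac)
    qed
  qed (auto intro: A)
  then show ?case using insert by (simp add: mult.assoc)
qed

lemma law_eq_real:
  fixes X Y :: "'i \<Rightarrow> 'a \<Rightarrow> real"
  assumes X: "\<And>i. X i \<in> borel_measurable M" and Y: "\<And>i. Y i \<in> borel_measurable M"
    and eq: "\<And>I u. finite I \<Longrightarrow>
      (\<integral>\<omega>. iexp (\<Sum>i\<in>I. u i * X i \<omega>) \<partial>M) = (\<integral>\<omega>. iexp (\<Sum>i\<in>I. u i * Y i \<omega>) \<partial>M)"
  shows "distr M (\<Pi>\<^sub>M i\<in>UNIV. borel) (\<lambda>\<omega> i. X i \<omega>) = distr M (\<Pi>\<^sub>M i\<in>UNIV. borel) (\<lambda>\<omega> i. Y i \<omega>)"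
proof (rule measure_eqI_PiM_infinite)
  have m: "(\<lambda>\<omega> i. Z i \<omega>) \<in> measurable M (\<Pi>\<^sub>M i\<in>UNIV. borel)"
    if "\<And>i. Z i \<in> borel_measurable M" for Z :: "'i \<Rightarrow> 'a \<Rightarrow> real"
    using that by (intro measurable_PiM_single') auto
  show "finite_measure (distr M (\<Pi>\<^sub>M i\<in>UNIV. borel) (\<lambda>\<omega> i. X i \<omega>))"
    by (intro prob_space.finite_measure prob_space_distr m X)
  fix A and J :: "'i set" assume J: "finite J" and A: "\<And>i. i \<in> J \<Longrightarrow> A i \<in> sets (borel :: real measure)"
  define B where "B i = (if i \<in> J then A i else {})" for i
  have B [measurable]: "B i \<in> sets borel" for i using A by (simp add: B_def)
  let ?E = "prod_emb UNIV (\<lambda>_. borel) J (Pi\<^sub>E J A)"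
  have E: "?E \<in> sets (\<Pi>\<^sub>M i\<in>UNIV. borel)"
    using J A by (intro sets_PiM_I) auto
  have meas: "emeasure (distr M (\<Pi>\<^sub>M i\<in>UNIV. borel) (\<lambda>\<omega> i. Z i \<omega>)) ?E
      = ennreal (\<integral>\<omega>. (\<Prod>i\<in>J. indicator (B i) (Z i \<omega>)) \<partial>M)"
    if Z: "\<And>i. Z i \<in> borel_measurable M" for Z :: "'i \<Rightarrow> 'a \<Rightarrow> real"
  proof -
    note [measurable] = Z
    have "emeasure (distr M (\<Pi>\<^sub>M i\<in>UNIV. borel) (\<lambda>\<omega> i. Z i \<omega>)) ?E
        = emeasure M ((\<lambda>\<omega> i. Z i \<omega>) -` ?E \<inter> space M)"
      by (rule emeasure_distr[OF m[OF Z] E])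
    also have "(\<lambda>\<omega> i. Z i \<omega>) -` ?E \<inter> space M = {\<omega>\<in>space M. \<forall>i\<in>J. Z i \<omega> \<in> B i}"
      by (auto simp: prod_emb_def B_def PiE_def Pi_def)
    also have "emeasure M {\<omega>\<in>space M. \<forall>i\<in>J. Z i \<omega> \<in> B i} = (\<integral>\<^sup>+\<omega>. indicator {\<omega>\<in>space M. \<forall>i\<in>J. Z i \<omega> \<in> B i} \<omega> \<partial>M)"
      using J by (subst nn_integral_indicator) measurable
    also have "\<dots> = (\<integral>\<^sup>+\<omega>. ennreal (\<Prod>i\<in>J. indicator (B i) (Z i \<omega>)) \<partial>M)"
    proof (rule nn_integral_cong)
      fix \<omega> assume \<omega>: "\<omega> \<in> space M"
      show "indicator {\<omega>\<in>space M. \<forall>i\<in>J. Z i \<omega> \<in> B i} \<omega> = ennreal (\<Prod>i\<in>J. indicator (B i) (Z i \<omega>))"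
      proof (cases "\<forall>i\<in>J. Z i \<omega> \<in> B i")
        case True
        then have "(\<Prod>i\<in>J. indicat_real (B i) (Z i \<omega>)) = 1" by (intro prod.neutral) auto
        then show ?thesis using True \<omega> by simp
      next
        case False
        then have "(\<Prod>i\<in>J. indicat_real (B i) (Z i \<omega>)) = 0" using J by (subst prod_zero_iff) (auto simp: indicator_def)
        then show ?thesis using False by simp
      qed
    qed
    also have "\<dots> = ennreal (\<integral>\<omega>. (\<Prod>i\<in>J. indicator (B i) (Z i \<omega>)) \<partial>M)"
    proof (rule nn_integral_eq_integral)
      show "integrable M (\<lambda>\<omega>. \<Prod>i\<in>J. indicat_real (B i) (Z i \<omega>))"
      proof (rule integrable_const_bound[where B = 1])
        show "AE \<omega> in M. norm (\<Prod>i\<in>J. indicat_real (B i) (Z i \<omega>)) \<le> 1"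
          unfolding real_norm_def abs_prod by (intro AE_I2 prod_le_1) (auto split: split_indicator)
      qed measurable
    qed (auto intro!: AE_I2 prod_nonneg)
    finally show ?thesis .
  qed
  have "complex_of_real (\<integral>\<omega>. (\<Prod>i\<in>J. indicator (B i) (X i \<omega>)) \<partial>M) = of_real (\<integral>\<omega>. (\<Prod>i\<in>J. indicator (B i) (Y i \<omega>)) \<partial>M)"
    using finite_dim_law_eq[OF X Y J eq[OF J] B order_refl, where u = "\<lambda>_. 0"]
    by (simp del: of_real_prod)
  then show "emeasure (distr M (\<Pi>\<^sub>M i\<in>UNIV. borel) (\<lambda>\<omega> i. X i \<omega>)) ?E
      = emeasure (distr M (\<Pi>\<^sub>M i\<in>UNIV. borel) (\<lambda>\<omega> i. Y i \<omega>)) ?E"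
    unfolding meas[OF X] meas[OF Y] by simp
qed simp_all

text \<open>
  The real and imaginary parts form a real field over the doubled index set, whose real linear
  combinations are the real parts of the complex ones.
\<close>

lemma law_eq_complex:
  fixes X Y :: "'i \<Rightarrow> 'a \<Rightarrow> complex"
  assumes X: "\<And>i. X i \<in> borel_measurable M" and Y: "\<And>i. Y i \<in> borel_measurable M"
    and eq: "\<And>J c. finite J \<Longrightarrow>
      (\<integral>\<omega>. iexp (Re (\<Sum>j\<in>J. c j * X j \<omega>)) \<partial>M) = (\<integral>\<omega>. iexp (Re (\<Sum>j\<in>J. c j * Y j \<omega>)) \<partial>M)"
  shows "distr M (\<Pi>\<^sub>M i\<in>UNIV. borel) (\<lambda>\<omega> i. X i \<omega>) = distr M (\<Pi>\<^sub>M i\<in>UNIV. borel) (\<lambda>\<omega> i. Y i \<omega>)"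
proof -
  note [measurable] = X Y
  define R :: "('i \<Rightarrow> 'a \<Rightarrow> complex) \<Rightarrow> 'i \<times> bool \<Rightarrow> 'a \<Rightarrow> real"
    where "R Z ib \<omega> = (if snd ib then Re (Z (fst ib) \<omega>) else Im (Z (fst ib) \<omega>))" for Z ib \<omega>
  define \<Phi> :: "('i \<times> bool \<Rightarrow> real) \<Rightarrow> 'i \<Rightarrow> complex"
    where "\<Phi> r i = of_real (r (i, True)) + \<i> * of_real (r (i, False))" for r i
  have Rm: "R Z ib \<in> borel_measurable M" if "\<And>i. Z i \<in> borel_measurable M" for Z ib
    using that unfolding R_def by (cases ib) auto
  have \<Phi>m: "\<Phi> \<in> measurable (\<Pi>\<^sub>M i\<in>UNIV. borel) (\<Pi>\<^sub>M i\<in>UNIV. borel)"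
    unfolding \<Phi>_def by (intro measurable_PiM_single') (auto simp: space_PiM)
  have R_sum: "(\<Sum>ib\<in>I. u ib * R Z ib \<omega>)
      = Re (\<Sum>i\<in>fst ` I. Complex (if (i, True) \<in> I then u (i, True) else 0)
            (if (i, False) \<in> I then - u (i, False) else 0) * Z i \<omega>)"
    if "finite I" for I u Z \<omega>
  proof -
    have sub: "I \<subseteq> fst ` I \<times> UNIV" by force
    have "(\<Sum>ib\<in>I. u ib * R Z ib \<omega>) = (\<Sum>ib\<in>fst ` I \<times> UNIV. (if ib \<in> I then u ib * R Z ib \<omega> else 0))"
      using that sub by (intro sum.mono_neutral_cong_left) auto
    also have "\<dots> = (\<Sum>i\<in>fst ` I. \<Sum>b\<in>UNIV. (if (i, b) \<in> I then u (i, b) * R Z (i, b) \<omega> else 0))"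
      by (simp add: sum.cartesian_product)
    also have "\<dots> = (\<Sum>i\<in>fst ` I. Re (Complex (if (i, True) \<in> I then u (i, True) else 0)
            (if (i, False) \<in> I then - u (i, False) else 0) * Z i \<omega>))"
      by (intro sum.cong refl) (auto simp: UNIV_bool R_def)
    finally show ?thesis unfolding Re_sum .
  qed
  have "distr M (\<Pi>\<^sub>M i\<in>UNIV. borel) (\<lambda>\<omega> ib. R X ib \<omega>) = distr M (\<Pi>\<^sub>M i\<in>UNIV. borel) (\<lambda>\<omega> ib. R Y ib \<omega>)"
    by (rule law_eq_real) (use X Y Rm eq in \<open>auto simp: R_sum simp del: Re_sum\<close>)
  moreover have "distr M (\<Pi>\<^sub>M i\<in>UNIV. borel) (\<lambda>\<omega> i. Z i \<omega>)
      = distr (distr M (\<Pi>\<^sub>M i\<in>UNIV. borel) (\<lambda>\<omega> ib. R Z ib \<omega>)) (\<Pi>\<^sub>M i\<in>UNIV. borel) \<Phi>"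
    if "\<And>i. Z i \<in> borel_measurable M" for Z
  proof -
    have "(\<lambda>\<omega> ib. R Z ib \<omega>) \<in> measurable M (\<Pi>\<^sub>M i\<in>UNIV. borel)"
      using Rm[OF that] by (intro measurable_PiM_single') auto
    moreover have "\<Phi> \<circ> (\<lambda>\<omega> ib. R Z ib \<omega>) = (\<lambda>\<omega> i. Z i \<omega>)"
      by (auto simp: \<Phi>_def R_def fun_eq_iff complex_eq_iff)
    ultimately show ?thesis using \<Phi>m by (simp add: distr_distr)
  qed
  ultimately show ?thesis using X Y by simp
qed

end

lemma (in white_noise) wiener_law_eq:
  assumes X: "\<And>i. has_wiener_integral M W (h i) (X i)" and Y: "\<And>i. has_wiener_integral M W (g i) (Y i)"
    and eq: "\<And>J c. finite J \<Longrightarrow>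
      L2_norm lborel (\<lambda>\<xi>. \<Sum>j\<in>J. c j * h j \<xi>) = L2_norm lborel (\<lambda>\<xi>. \<Sum>j\<in>J. c j * g j \<xi>)"
  shows "distr M (\<Pi>\<^sub>M i\<in>UNIV. borel) (\<lambda>\<omega> i. X i \<omega>) = distr M (\<Pi>\<^sub>M i\<in>UNIV. borel) (\<lambda>\<omega> i. Y i \<omega>)"
proof (rule law_eq_complex)
  show "X i \<in> borel_measurable M" "Y i \<in> borel_measurable M" for i
    using has_wiener_integral_square_integrable(2)[OF X] has_wiener_integral_square_integrable(2)[OF Y]
    by (auto simp: square_integrable_def)
  fix J :: "'b set" and c assume "finite J"
  have "has_wiener_integral M W (\<lambda>\<xi>. \<Sum>j\<in>J. c j * h j \<xi>) (\<lambda>\<omega>. \<Sum>j\<in>J. c j * X j \<omega>)"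
    "has_wiener_integral M W (\<lambda>\<xi>. \<Sum>j\<in>J. c j * g j \<xi>) (\<lambda>\<omega>. \<Sum>j\<in>J. c j * Y j \<omega>)"
    by (intro has_wiener_integral_sum has_wiener_integral_cmult X Y)+
  from this[THEN has_wiener_integral_char] eq[OF \<open>finite J\<close>, of c]
  show "(\<integral>\<omega>. iexp (Re (\<Sum>j\<in>J. c j * X j \<omega>)) \<partial>M) = (\<integral>\<omega>. iexp (Re (\<Sum>j\<in>J. c j * Y j \<omega>)) \<partial>M)"
    by (simp del: Re_sum)
qed


section \<open>Variations of a finite signed measure\<close>

lemma finite_signed_measure_Un:
  assumes w: "finite_signed_measure w" and "A \<in> sets borel" "B \<in> sets borel" "A \<inter> B = {}"
  shows "w (A \<union> B) = w A + w B"
proof -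
  have "disjoint_family (binaryset A B)"
    using assms(4) by (auto simp: disjoint_family_on_def binaryset_def)
  moreover have "range (binaryset A B) \<subseteq> sets borel"
    using assms(2,3) by (simp add: range_binaryset_eq)
  ultimately have "(\<lambda>n. w (binaryset A B n)) sums w (\<Union>n. binaryset A B n)"
    using w unfolding finite_signed_measure_def by blast
  moreover have "(\<lambda>n. w (binaryset A B n)) sums (w A + w B)"
    using w by (intro binaryset_sums) (auto simp: finite_signed_measure_def)
  ultimately show ?thesis by (simp add: UN_binaryset_eq sums_unique2)
qed

lemma finite_signed_measure_Diff:
  assumes "finite_signed_measure w" "A \<in> sets borel" "B \<in> sets borel" "B \<subseteq> A"
  shows "w (A - B) = w A - w B"
  using finite_signed_measure_Un[OF assms(1), of B "A - B"] assms by (simp add: Un_absorb1)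

text \<open>
  If \<open>w\<close> were unbounded on the subsets of \<open>A\<close>, then \<open>A\<close> would split into two parts with
  \<open>\<bar>w\<bar> > 1\<close> on both of them and \<open>w\<close> unbounded on the subsets of one of them. Iterating yields
  disjoint sets with \<open>\<bar>w\<bar> > 1\<close>, against the convergence of the series of their values.
\<close>

lemma finite_signed_measure_bounded:
  fixes w :: "'a::topological_space set \<Rightarrow> real"
  assumes w: "finite_signed_measure w"
  shows "\<exists>C. \<forall>B\<in>sets borel. w B \<le> C"
proof (rule ccontr)
  define bad where "bad A \<longleftrightarrow> A \<in> sets borel \<and> (\<forall>C. \<exists>B\<in>sets borel. B \<subseteq> A \<and> C < w B)" for A
  assume "\<not> ?thesis"
  then have bad_UNIV: "bad UNIV" by (auto simp: bad_def not_le)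
  have step: "\<exists>A'. bad A' \<and> A' \<subseteq> A \<and> 1 < \<bar>w (A - A')\<bar>" if A: "bad A" for A
  proof -
    obtain B where B: "B \<in> sets borel" "B \<subseteq> A" "\<bar>w A\<bar> + 1 < w B"
      using A unfolding bad_def by blast
    have Am: "A \<in> sets borel" using A by (simp add: bad_def)
    have diff: "w (A - B) = w A - w B" using finite_signed_measure_Diff[OF w Am B(1,2)] .
    have "bad B \<or> bad (A - B)"
    proof (rule ccontr)
      assume "\<not> ?thesis"
      then have nb: "\<not> bad B" "\<not> bad (A - B)" by simp_all
      obtain C1 where C1: "\<And>D. D \<in> sets borel \<Longrightarrow> D \<subseteq> B \<Longrightarrow> w D \<le> C1"
        using nb(1) B(1) unfolding bad_def by (meson not_less)
      obtain C2 where C2: "\<And>D. D \<in> sets borel \<Longrightarrow> D \<subseteq> A - B \<Longrightarrow> w D \<le> C2"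
        using nb(2) sets.Diff[OF Am B(1)] unfolding bad_def by (meson not_less)
      obtain D where D: "D \<in> sets borel" "D \<subseteq> A" "C1 + C2 < w D"
        using A unfolding bad_def by blast
      have "w ((D \<inter> B) \<union> (D - B)) = w (D \<inter> B) + w (D - B)"
        using D(1) B(1) by (intro finite_signed_measure_Un[OF w]) auto
      moreover have "(D \<inter> B) \<union> (D - B) = D" by auto
      ultimately have "w D \<le> C1 + C2"
        using C1[of "D \<inter> B"] C2[OF _ Diff_mono[OF D(2) order_refl]] D(1) B(1) by auto
      with D(3) show False by simp
    qed
    then show ?thesis
    proof
      assume "bad B"
      then show ?thesis using B diff by (intro exI[of _ B]) auto
    next
      assume "bad (A - B)"
      moreover have "A - (A - B) = B" using B(2) by auto
      ultimately show ?thesis using B by (intro exI[of _ "A - B"]) auto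
    qed
  qed
  obtain A where A: "\<And>n::nat. bad (A n)" "\<And>n. A (Suc n) \<subseteq> A n" "\<And>n. 1 < \<bar>w (A n - A (Suc n))\<bar>"
    using dependent_nat_choice[of "\<lambda>_. bad" "\<lambda>_ A A'. A' \<subseteq> A \<and> 1 < \<bar>w (A - A')\<bar>"] bad_UNIV step
    by metis
  let ?E = "\<lambda>n. A n - A (Suc n)"
  have anti: "A n \<subseteq> A m" if "m \<le> n" for m n
    using lift_Suc_antimono_le[of A, OF A(2) that] .
  have "disjoint_family ?E"
  proof -
    have "?E m \<inter> ?E n = {}" if "m < n" for m n
      using anti[of "Suc m" n] that by auto
    then show ?thesis unfolding disjoint_family_on_def
      by (metis Int_commute linorder_neqE_nat)
  qed
  moreover have "range ?E \<subseteq> sets borel" using A(1) by (auto simp: bad_def)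
  ultimately have "(\<lambda>n. w (?E n)) sums w (\<Union>n. ?E n)"
    using w by (auto simp: finite_signed_measure_def)
  then have "(\<lambda>n. w (?E n)) \<longlonglongrightarrow> 0" by (intro summable_LIMSEQ_zero sums_summable)
  from LIMSEQ_D[OF this, of 1] obtain n where "\<bar>w (?E n)\<bar> < 1" by auto
  then show False using A(3)[of n] by simp
qed

lemma sets_pos_variation [simp, measurable_cong]: "sets (pos_variation w) = sets borel"
  using sets.sigma_sets_eq[of borel] by (simp add: pos_variation_def)

lemma space_pos_variation [simp]: "space (pos_variation w) = UNIV"
  by (simp add: pos_variation_def space_measure_of_conv)

lemma sets_neg_variation [simp, measurable_cong]: "sets (neg_variation w) = sets borel"
  by (simp add: neg_variation_def)

text \<open>
  The extension of a set function to a measure is null unless the function is countably additive.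
  Both cases are kept, since finiteness and evenness can be read off in either.
\<close>

lemma emeasure_pos_variation:
  fixes w :: "'a::topological_space set \<Rightarrow> real"
  defines "\<mu> \<equiv> (\<lambda>A. SUP B\<in>{B \<in> sets borel. B \<subseteq> A}. ennreal (w B))"
  shows "emeasure (pos_variation w) A =
    (if A \<in> sets borel \<and> measure_space UNIV (sets borel) \<mu> then \<mu> A else 0)"
  using sets.sigma_sets_eq[of "borel :: 'a measure"]
  by (simp add: pos_variation_def emeasure_measure_of_conv \<mu>_def)

lemma finite_measure_pos_variation:
  assumes "finite_signed_measure w" shows "finite_measure (pos_variation w)"
proof
  obtain C where C: "\<And>B. B \<in> sets borel \<Longrightarrow> w B \<le> C"
    using finite_signed_measure_bounded[OF assms] by blast
  have "(SUP B\<in>{B \<in> sets borel. B \<subseteq> UNIV}. ennreal (w B)) \<le> ennreal C"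
    by (intro SUP_least ennreal_leI C) simp
  then have "emeasure (pos_variation w) UNIV \<le> ennreal C"
    by (auto simp: emeasure_pos_variation)
  then show "emeasure (pos_variation w) (space (pos_variation w)) \<noteq> \<infinity>"
    by (auto simp: top_unique)
qed

lemma uminus_image_borel:
  fixes A :: "'a::real_normed_vector set"
  assumes "A \<in> sets borel" shows "uminus ` A \<in> sets borel"
proof -
  have "(uminus :: 'a \<Rightarrow> 'a) \<in> borel_measurable borel"
    by (intro borel_measurable_continuous_onI continuous_intros)
  from measurable_sets[OF this assms] show ?thesis
    by (simp add: surj_image_vimage_eq bij_vimage_eq_inv_image[OF bij_uminus] inv_unique_comp[of uminus uminus])
qed

lemma pos_variation_distr_uminus:
  fixes w :: "'a::real_normed_vector set \<Rightarrow> real"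
  assumes even: "even_signed_measure w"
  shows "distr (pos_variation w) borel uminus = pos_variation w"
proof (rule measure_eqI)
  fix A assume "A \<in> sets (distr (pos_variation w) borel uminus)"
  then have A: "A \<in> sets borel" by simp
  have meas: "(uminus :: 'a \<Rightarrow> 'a) \<in> measurable (pos_variation w) borel"
    by (subst measurable_cong_sets[OF sets_pos_variation refl])
       (intro borel_measurable_continuous_onI continuous_intros)
  have inv: "uminus -` A = uminus ` A" by (force simp: image_iff)
  have "(\<lambda>B. ennreal (w B)) ` {B \<in> sets borel. B \<subseteq> uminus ` A} = (\<lambda>B. ennreal (w B)) ` {B \<in> sets borel. B \<subseteq> A}"
  proof (intro set_eqI iffI)
    fix x assume "x \<in> (\<lambda>B. ennreal (w B)) ` {B \<in> sets borel. B \<subseteq> uminus ` A}"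
    then obtain B where "B \<in> sets borel" "B \<subseteq> uminus ` A" "x = ennreal (w B)" by auto
    then show "x \<in> (\<lambda>B. ennreal (w B)) ` {B \<in> sets borel. B \<subseteq> A}"
      using even uminus_image_borel[of B]
      by (intro image_eqI[of _ _ "uminus ` B"]) (auto simp: even_signed_measure_def)
  next
    fix x assume "x \<in> (\<lambda>B. ennreal (w B)) ` {B \<in> sets borel. B \<subseteq> A}"
    then obtain B where "B \<in> sets borel" "B \<subseteq> A" "x = ennreal (w B)" by auto
    then show "x \<in> (\<lambda>B. ennreal (w B)) ` {B \<in> sets borel. B \<subseteq> uminus ` A}"
      using even uminus_image_borel[of B]
      by (intro image_eqI[of _ _ "uminus ` B"]) (auto simp: even_signed_measure_def)
  qed
  then have "emeasure (pos_variation w) (uminus ` A) = emeasure (pos_variation w) A"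
    using A uminus_image_borel[OF A] by (simp add: emeasure_pos_variation)
  then show "emeasure (distr (pos_variation w) borel uminus) A = emeasure (pos_variation w) A"
    using A by (simp add: emeasure_distr[OF meas] inv)
qed simp

lemma finite_signed_measure_uminus:
  "finite_signed_measure w \<Longrightarrow> finite_signed_measure (\<lambda>A. - w A)"
  by (auto simp: finite_signed_measure_def intro!: sums_minus)

lemma even_signed_measure_uminus: "even_signed_measure w \<Longrightarrow> even_signed_measure (\<lambda>A. - w A)"
  by (simp add: even_signed_measure_def)


section \<open>Integrals with values in square-integrable functions\<close>

text \<open>
  The integrand is approximated by \<open>z \<mapsto> U (s\<^sub>j z)\<close> on \<open>D\<close>, where the \<open>s\<^sub>j\<close> are simple and tend to
  the identity. With \<open>a j z\<close> the \<open>L\<^sup>2\<close>-distance at \<open>z\<close>, dominated convergence gives that \<open>a j\<close> and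
  its square have integrals tending to \<open>0\<close>. The square controls the distance of the integrals, by
  the Cauchy-Schwarz inequality in \<open>z\<close> over the set \<open>D\<close> of finite measure and Tonelli's theorem.
\<close>

lemma has_L2_integral_lborel:
  fixes N :: "'z::euclidean_space measure" and g :: "'z \<Rightarrow> 'a::euclidean_space \<Rightarrow> complex"
  assumes sets_N [measurable_cong]: "sets N = sets borel" and "sigma_finite_measure N"
    and D [measurable]: "D \<in> sets borel" and fin_D: "emeasure N D < \<infinity>"
    and g_meas [measurable]: "case_prod g \<in> borel_measurable (borel \<Otimes>\<^sub>M borel)"
    and g_bound: "\<And>z \<xi>. cmod (g z \<xi>) \<le> B"
    and g_cont: "\<And>\<xi>. continuous_on UNIV (\<lambda>z. g z \<xi>)"
    and g_supp: "\<And>z \<xi>. z \<notin> D \<Longrightarrow> g z \<xi> = 0"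
    and f: "square_integrable lborel f"
  shows "has_L2_integral N lborel (\<lambda>z \<xi>. g z \<xi> * f \<xi>) (\<lambda>\<xi>. (\<integral>z. g z \<xi> \<partial>N) * f \<xi>)"
proof -
  interpret N: sigma_finite_measure N by fact
  interpret P: pair_sigma_finite N "lborel :: 'a measure" ..
  have [simp]: "space N = UNIV" using sets_eq_imp_space_eq[OF sets_N] by simp
  note [measurable] = square_integrableD(1)[OF f]
  have B: "0 \<le> B" using order_trans[OF norm_ge_zero g_bound] .
  define U where "U z \<xi> = g z \<xi> * f \<xi>" for z \<xi>
  have U_meas [measurable]: "case_prod U \<in> borel_measurable (borel \<Otimes>\<^sub>M borel)"
    unfolding U_def by measurable
  have g_z [measurable]: "g z \<in> borel_measurable borel" for z
    using measurable_compose[OF measurable_Pair1' g_meas, of z] by simp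
  have g_\<xi> [measurable]: "(\<lambda>z. g z \<xi>) \<in> borel_measurable borel" for \<xi>
    by (rule borel_measurable_continuous_onI[OF g_cont])
  have sqU: "square_integrable lborel (U z)" for z
    using g_bound by (intro square_integrable_dominated[OF f, where B = B])
      (auto simp: U_def norm_mult intro!: mult_right_mono)
  have int_D: "integrable N (indicat_real D)"
    using fin_D by (intro integrable_real_indicator) (auto simp: sets_N)
  have "(\<lambda>z. z) \<in> borel_measurable N" by measurable
  from borel_measurable_implies_sequence_metric[OF this, of 0]
  obtain s where s: "\<And>j::nat. simple_function N (s j)" "\<And>z. (\<lambda>j. s j z) \<longlonglongrightarrow> z" by auto
  have s_meas [measurable]: "s j \<in> borel_measurable borel" for j
    using borel_measurable_simple_function[OF s(1)] by (simp add: measurable_cong_sets[OF sets_N refl])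
  have fin_s: "finite (range (s j))" for j using s(1)[of j] by (simp add: simple_function_def)
  have "\<exists>e. bij_betw e {..<card (range (s j))} (range (s j))" for j
    using ex_bij_betw_nat_finite[OF fin_s[of j]] by (simp add: atLeast0LessThan)
  then obtain e where e: "\<And>j. bij_betw (e j) {..<card (range (s j))} (range (s j))" by metis
  define n where "n j = card (range (s j))" for j
  define A where "A j k = D \<inter> s j -` {e j k}" for j k
  have A_meas: "A j k \<in> sets borel" for j k
  proof -
    have "s j -` {e j k} \<inter> space borel \<in> sets borel" by (rule measurable_sets[OF s_meas]) simp
    then show ?thesis unfolding A_def using D by auto
  qed
  have A_fin: "emeasure N (A j k) < \<infinity>" for j k
    using emeasure_mono[of "A j k" D N] fin_D D by (auto simp: A_def sets_N intro: le_less_trans)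
  have sum_A: "(\<Sum>k<n j. of_real (indicator (A j k) z) * c (e j k)) = of_real (indicator D z) * c (s j z)"
    for j z and c :: "'z \<Rightarrow> complex"
  proof -
    have "(\<Sum>k<n j. of_real (indicator (A j k) z) * c (e j k))
        = (\<Sum>v\<in>range (s j). of_real (indicator (D \<inter> s j -` {v}) z) * c v)"
      unfolding A_def n_def by (rule sum.reindex_bij_betw[OF e])
    also have "\<dots> = (\<Sum>v\<in>range (s j). if s j z = v then of_real (indicator D z) * c v else 0)"
      by (intro sum.cong) (auto simp: indicator_def)
    also have "\<dots> = of_real (indicator D z) * c (s j z)"
      using fin_s by (subst sum.delta') auto
    finally show ?thesis .
  qed
  define d where "d j z \<xi> = of_real (indicator D z) * (g z \<xi> - g (s j z) \<xi>) * f \<xi>" for j z \<xi>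
  have d_eq: "U z \<xi> - (\<Sum>k<n j. of_real (indicator (A j k) z) * U (e j k) \<xi>) = d j z \<xi>" for j z \<xi>
    using sum_A[where c = "\<lambda>v. U v \<xi>"] g_supp[of z \<xi>]
    by (cases "z \<in> D") (simp_all add: d_def U_def algebra_simps)
  have gs_meas [measurable]: "(\<lambda>(z, \<xi>). g (s j z) \<xi>) \<in> borel_measurable (borel \<Otimes>\<^sub>M borel)" for j
  proof -
    have "(\<lambda>p. (s j (fst p), snd p)) \<in> measurable (borel \<Otimes>\<^sub>M borel) (borel \<Otimes>\<^sub>M borel)" by measurable
    from measurable_compose[OF this g_meas] show ?thesis by (simp add: case_prod_beta')
  qed
  have d_meas [measurable]: "case_prod (d j) \<in> borel_measurable (borel \<Otimes>\<^sub>M borel)" for j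
    unfolding d_def by measurable
  have d_bound: "cmod (d j z \<xi>) \<le> 2 * B * indicator D z * cmod (f \<xi>)" for j z \<xi>
    using norm_triangle_ineq4[of "g z \<xi>" "g (s j z) \<xi>"] g_bound[of z \<xi>] g_bound[of "s j z" \<xi>]
    by (auto simp: d_def norm_mult indicator_def intro!: mult_right_mono)
  have d_z [measurable]: "d j z \<in> borel_measurable borel" for j z
    using measurable_compose[OF measurable_Pair1' d_meas, of z] by simp
  have sq_d: "square_integrable lborel (d j z)" for j z
    using d_bound by (intro square_integrable_dominated[OF f, where B = "2 * B * indicator D z"]) auto
  define a where "a j z = L2_norm lborel (d j z)" for j z
  have a_meas [measurable]: "a j \<in> borel_measurable borel" for j
    unfolding a_def L2_norm_def by measurable
  have a_nonneg: "0 \<le> a j z" for j z by (simp add: a_def)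
  have a_bound: "a j z \<le> 2 * B * L2_norm lborel f * indicator D z" for j z
  proof -
    have "(a j z)\<^sup>2 \<le> (\<integral>\<xi>. (2 * B * indicator D z)\<^sup>2 * (cmod (f \<xi>))\<^sup>2 \<partial>lborel)"
      unfolding a_def L2_norm_power2
    proof (rule integral_mono)
      show "(cmod (d j z \<xi>))\<^sup>2 \<le> (2 * B * indicator D z)\<^sup>2 * (cmod (f \<xi>))\<^sup>2" for \<xi>
        using power_mono[OF d_bound, of j z \<xi> 2] by (simp add: power_mult_distrib)
    qed (use sq_d f in \<open>auto simp: square_integrable_def\<close>)
    also have "\<dots> = (2 * B * L2_norm lborel f * indicator D z)\<^sup>2"
      by (simp add: power_mult_distrib L2_norm_power2)
    finally show ?thesis by (rule power2_le_imp_le) (use B in simp)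
  qed
  have a_lim: "(\<lambda>j. a j z) \<longlonglongrightarrow> 0" for z
  proof -
    have "(\<lambda>j. \<integral>\<xi>. (cmod (d j z \<xi>))\<^sup>2 \<partial>lborel) \<longlonglongrightarrow> (\<integral>\<xi>. 0 \<partial>(lborel :: 'a measure))"
    proof (rule integral_dominated_convergence)
      show "integrable lborel (\<lambda>\<xi>. (2 * B)\<^sup>2 * (cmod (f \<xi>))\<^sup>2)" using f by (simp add: square_integrable_def)
      show "AE \<xi> in lborel. (\<lambda>j. (cmod (d j z \<xi>))\<^sup>2) \<longlonglongrightarrow> 0"
      proof (rule AE_I2)
        fix \<xi>
        have "(\<lambda>j. g (s j z) \<xi>) \<longlonglongrightarrow> g z \<xi>"
          using g_cont[of \<xi>] s(2)[of z] by (auto simp: continuous_on_sequentially comp_def)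
        then have "(\<lambda>j. (cmod (d j z \<xi>))\<^sup>2) \<longlonglongrightarrow> (cmod (of_real (indicator D z) * (g z \<xi> - g z \<xi>) * f \<xi>))\<^sup>2"
          unfolding d_def by (intro tendsto_intros)
        then show "(\<lambda>j. (cmod (d j z \<xi>))\<^sup>2) \<longlonglongrightarrow> 0" by simp
      qed
      show "AE \<xi> in lborel. norm ((cmod (d j z \<xi>))\<^sup>2) \<le> (2 * B)\<^sup>2 * (cmod (f \<xi>))\<^sup>2" for j
      proof (rule AE_I2)
        fix \<xi>
        have "cmod (d j z \<xi>) \<le> 2 * B * cmod (f \<xi>)"
          using d_bound[of j z \<xi>] B by (auto simp: indicator_def split: if_splits intro: order_trans)
        from power_mono[OF this, of 2]
        show "norm ((cmod (d j z \<xi>))\<^sup>2) \<le> (2 * B)\<^sup>2 * (cmod (f \<xi>))\<^sup>2" by (simp add: power_mult_distrib)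
      qed
    qed measurable
    then have "(\<lambda>j. sqrt (\<integral>\<xi>. (cmod (d j z \<xi>))\<^sup>2 \<partial>lborel)) \<longlonglongrightarrow> sqrt 0"
      by (intro tendsto_real_sqrt) simp
    then show ?thesis by (simp add: a_def L2_norm_def)
  qed
  have nn_lim: "(\<lambda>j. \<integral>\<^sup>+z. ennreal (b j z) \<partial>N) \<longlonglongrightarrow> 0"
    if [measurable]: "\<And>j. b j \<in> borel_measurable borel" and b: "\<And>j z. 0 \<le> b j z" "\<And>j z. b j z \<le> K * indicator D z"
      and lim: "\<And>z. (\<lambda>j. b j z) \<longlonglongrightarrow> 0" for b :: "nat \<Rightarrow> 'z \<Rightarrow> real" and K
  proof -
    have bK: "integrable N (\<lambda>z. K * indicator D z)" using int_D by simp
    have "integrable N (b j)" for j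
      using b by (intro Bochner_Integration.integrable_bound[OF bK] AE_I2) (auto simp: abs_of_nonneg intro: order_trans[OF b(2) abs_ge_self])
    then have "(\<integral>\<^sup>+z. ennreal (b j z) \<partial>N) = ennreal (\<integral>z. b j z \<partial>N)" for j
      using b by (intro nn_integral_eq_integral) auto
    moreover have "(\<lambda>j. \<integral>z. b j z \<partial>N) \<longlonglongrightarrow> (\<integral>z. 0 \<partial>N)"
      by (rule integral_dominated_convergence[OF _ _ bK]) (use b lim in \<open>auto simp: abs_of_nonneg\<close>)
    ultimately show ?thesis
      using tendsto_ennrealI[of "\<lambda>j. \<integral>z. b j z \<partial>N" 0 sequentially] by simp
  qed
  define V where "V \<xi> = (\<integral>z. g z \<xi> \<partial>N) * f \<xi>" for \<xi>
  have g_int: "integrable N (\<lambda>z. g z \<xi>)" for \<xi>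
  proof (rule Bochner_Integration.integrable_bound)
    show "integrable N (\<lambda>z. B * indicator D z)" using int_D by simp
    show "AE z in N. cmod (g z \<xi>) \<le> norm (B * indicator D z)"
      using g_bound g_supp B by (intro AE_I2) (auto simp: indicator_def)
  qed measurable
  have sqV: "square_integrable lborel V"
  proof (rule square_integrable_dominated[OF f])
    have "(\<lambda>\<xi>. \<integral>z. g z \<xi> \<partial>N) \<in> borel_measurable borel" by measurable
    then show "V \<in> borel_measurable lborel" unfolding V_def by measurable
    fix \<xi>
    have "cmod (\<integral>z. g z \<xi> \<partial>N) \<le> (\<integral>z. B * indicator D z \<partial>N)"
    proof (rule order_trans[OF integral_norm_bound integral_mono])
      show "cmod (g z \<xi>) \<le> B * indicator D z" for z
        using g_bound g_supp by (cases "z \<in> D") auto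
    qed (use int_D g_int in auto)
    then show "cmod (V \<xi>) \<le> (\<integral>z. B * indicator D z \<partial>N) * cmod (f \<xi>)"
      unfolding V_def norm_mult by (intro mult_right_mono) auto
  qed
  define v where "v j \<xi> = V \<xi> - (\<Sum>k<n j. of_real (measure N (A j k)) * U (e j k) \<xi>)" for j \<xi>
  have sqv: "square_integrable lborel (v j)" for j
    unfolding v_def by (intro square_integrable_diff sqV square_integrable_sum square_integrable_cmult sqU)
  have v_eq: "v j \<xi> = (\<integral>z. d j z \<xi> \<partial>N)" for j \<xi>
  proof -
    have "integrable N (\<lambda>z. complex_of_real (indicator (A j k) z))" for k
      using A_fin A_meas by (intro integrable_of_real integrable_real_indicator) (auto simp: sets_N)
    moreover have "(\<integral>z. complex_of_real (indicator (A j k) z) \<partial>N) = of_real (measure N (A j k))" for k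
      using A_fin A_meas by (subst integral_complex_of_real) (simp add: sets_N)
    ultimately have "(\<Sum>k<n j. of_real (measure N (A j k)) * U (e j k) \<xi>)
        = (\<integral>z. (\<Sum>k<n j. of_real (indicator (A j k) z) * U (e j k) \<xi>) \<partial>N)"
      and i: "integrable N (\<lambda>z. \<Sum>k<n j. of_real (indicator (A j k) z) * U (e j k) \<xi>)"
      by (simp_all add: Bochner_Integration.integral_sum)
    moreover have "V \<xi> = (\<integral>z. U z \<xi> \<partial>N)" by (simp add: V_def U_def)
    moreover have "integrable N (\<lambda>z. U z \<xi>)" unfolding U_def using g_int by simp
    ultimately have "v j \<xi> = (\<integral>z. U z \<xi> - (\<Sum>k<n j. of_real (indicator (A j k) z) * U (e j k) \<xi>) \<partial>N)"
      unfolding v_def by (subst Bochner_Integration.integral_diff) auto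
    then show ?thesis unfolding d_eq .
  qed
  have d_\<xi> [measurable]: "(\<lambda>z. d j z \<xi>) \<in> borel_measurable borel" for j \<xi>
    using measurable_compose[OF measurable_Pair2' d_meas, of \<xi>] by simp
  have sq_d_N: "square_integrable N (\<lambda>z. d j z \<xi>)" for j \<xi>
    unfolding square_integrable_def
  proof
    show "integrable N (\<lambda>z. (cmod (d j z \<xi>))\<^sup>2)"
    proof (rule Bochner_Integration.integrable_bound)
      show "integrable N (\<lambda>z. (2 * B * cmod (f \<xi>))\<^sup>2 * indicator D z)" using int_D by simp
      show "AE z in N. norm ((cmod (d j z \<xi>))\<^sup>2) \<le> norm ((2 * B * cmod (f \<xi>))\<^sup>2 * indicator D z)"
      proof (rule AE_I2)
        fix z
        show "norm ((cmod (d j z \<xi>))\<^sup>2) \<le> norm ((2 * B * cmod (f \<xi>))\<^sup>2 * indicator D z)"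
          using power_mono[OF d_bound, of j z \<xi> 2] by (cases "z \<in> D") auto
      qed
    qed measurable
  qed measurable
  have sq_ind: "square_integrable N (\<lambda>z. of_real (indicator D z))"
  proof -
    have "(cmod (of_real (indicator D z)))\<^sup>2 = indicator D z" for z by (simp split: split_indicator)
    then show ?thesis using int_D by (simp add: square_integrable_def)
  qed
  have v_le: "(cmod (v j \<xi>))\<^sup>2 \<le> measure N D * (\<integral>z. (cmod (d j z \<xi>))\<^sup>2 \<partial>N)" for j \<xi>
  proof -
    have ind_d: "of_real (indicator D z) * d j z \<xi> = d j z \<xi>" for z
      by (simp add: d_def split: split_indicator)
    have "cmod (v j \<xi>) \<le> L2_norm N (\<lambda>z. of_real (indicator D z)) * L2_norm N (\<lambda>z. d j z \<xi>)"
      unfolding v_eq using norm_integral_mult_le_L2_norm[OF sq_ind sq_d_N, of j \<xi>] unfolding ind_d .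
    from power_mono[OF this, of 2]
    have "(cmod (v j \<xi>))\<^sup>2 \<le> (L2_norm N (\<lambda>z. of_real (indicator D z)))\<^sup>2 * (L2_norm N (\<lambda>z. d j z \<xi>))\<^sup>2"
      by (simp add: power_mult_distrib)
    moreover have "(cmod (of_real (indicator D z)))\<^sup>2 = indicator D z" for z by (simp split: split_indicator)
    then have "(L2_norm N (\<lambda>z. of_real (indicator D z)))\<^sup>2 = measure N D"
      unfolding L2_norm_power2 by simp
    ultimately show ?thesis by (simp add: L2_norm_power2)
  qed
  have v_lim: "(\<lambda>j. L2_norm lborel (v j)) \<longlonglongrightarrow> 0"
  proof -
    have le: "ennreal ((L2_norm lborel (v j))\<^sup>2) \<le> ennreal (measure N D) * (\<integral>\<^sup>+z. ennreal ((a j z)\<^sup>2) \<partial>N)" for j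
    proof -
      have "ennreal ((L2_norm lborel (v j))\<^sup>2) = (\<integral>\<^sup>+\<xi>. ennreal ((cmod (v j \<xi>))\<^sup>2) \<partial>lborel)"
        using square_integrableD(2)[OF sqv] by (simp add: L2_norm_power2 nn_integral_eq_integral)
      also have "\<dots> \<le> (\<integral>\<^sup>+\<xi>. ennreal (measure N D) * (\<integral>\<^sup>+z. ennreal ((cmod (d j z \<xi>))\<^sup>2) \<partial>N) \<partial>lborel)"
        using square_integrableD(2)[OF sq_d_N] v_le
        by (intro nn_integral_mono) (simp add: nn_integral_eq_integral ennreal_mult[symmetric] ennreal_leI)
      also have "\<dots> = ennreal (measure N D) * (\<integral>\<^sup>+\<xi>. (\<integral>\<^sup>+z. ennreal ((cmod (d j z \<xi>))\<^sup>2) \<partial>N) \<partial>lborel)"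
        by (rule nn_integral_cmult) measurable
      also have "(\<integral>\<^sup>+\<xi>. (\<integral>\<^sup>+z. ennreal ((cmod (d j z \<xi>))\<^sup>2) \<partial>N) \<partial>lborel)
          = (\<integral>\<^sup>+z. (\<integral>\<^sup>+\<xi>. ennreal ((cmod (d j z \<xi>))\<^sup>2) \<partial>lborel) \<partial>N)"
        by (rule P.Fubini') measurable
      also have "\<dots> = (\<integral>\<^sup>+z. ennreal ((a j z)\<^sup>2) \<partial>N)"
        using square_integrableD(2)[OF sq_d]
        by (intro nn_integral_cong) (simp add: a_def L2_norm_power2 nn_integral_eq_integral)
      finally show ?thesis .
    qed
    have "(\<lambda>j. ennreal (measure N D) * (\<integral>\<^sup>+z. ennreal ((a j z)\<^sup>2) \<partial>N)) \<longlonglongrightarrow> ennreal (measure N D) * 0"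
    proof (intro ennreal_tendsto_cmult nn_lim)
      show "(a j z)\<^sup>2 \<le> (2 * B * L2_norm lborel f)\<^sup>2 * indicator D z" for j z
        using power_mono[OF a_bound, of j z 2] by (cases "z \<in> D") (auto simp: a_def)
      show "(\<lambda>j. (a j z)\<^sup>2) \<longlonglongrightarrow> 0" for z
        using tendsto_power[OF a_lim, of z 2] by simp
    qed auto
    then have "(\<lambda>j. ennreal (measure N D) * (\<integral>\<^sup>+z. ennreal ((a j z)\<^sup>2) \<partial>N)) \<longlonglongrightarrow> 0" by simp
    from tendsto_sandwich[OF _ _ tendsto_const this]
    have "(\<lambda>j. ennreal ((L2_norm lborel (v j))\<^sup>2)) \<longlonglongrightarrow> ennreal 0"
      using le by simp
    then have "(\<lambda>j. (L2_norm lborel (v j))\<^sup>2) \<longlonglongrightarrow> 0"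
      by (subst (asm) tendsto_ennreal_iff) auto
    from tendsto_real_sqrt[OF this] show ?thesis by simp
  qed
  have "(\<lambda>j. \<integral>\<^sup>+z. ennreal (a j z) \<partial>N) \<longlonglongrightarrow> 0"
    by (rule nn_lim[where K = "2 * B * L2_norm lborel f"]) (use a_nonneg a_bound a_lim in auto)
  then have "has_L2_integral N lborel U V"
    unfolding has_L2_integral_def
  proof (intro conjI exI[of _ n] exI[of _ A] exI[of _ "\<lambda>j k. U (e j k)"])
    show "\<forall>j. (\<lambda>z. L2_norm lborel (\<lambda>\<xi>. U z \<xi> - (\<Sum>k<n j. of_real (indicator (A j k) z) * U (e j k) \<xi>))) \<in> borel_measurable N"
      unfolding d_eq a_def[symmetric] using a_meas by (auto simp: measurable_cong_sets[OF sets_N refl])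
  qed (use A_meas A_fin sqU sqV v_lim in \<open>auto simp: d_eq a_def sets_N v_def[abs_def]\<close>)
  then show ?thesis by (simp add: U_def[abs_def] V_def[abs_def])
qed

text \<open>The Wiener integral is linear and isometric, so it maps approximations to approximations.\<close>

lemma (in white_noise) has_L2_integral_wiener:
  assumes hH: "has_L2_integral N lborel h H"
    and Z: "\<And>z. z \<in> space N \<Longrightarrow> has_wiener_integral M W (h z) (Z z)" and V: "has_wiener_integral M W H V"
  shows "has_L2_integral N M Z V"
proof -
  obtain n A K where A: "\<forall>(j::nat) (k::nat). A j k \<in> sets N \<and> emeasure N (A j k) < \<infinity> \<and> square_integrable lborel (K j k)"
    and meas: "\<forall>j. (\<lambda>z. L2_norm lborel (\<lambda>\<xi>. h z \<xi> - (\<Sum>k<n j. of_real (indicator (A j k) z) * K j k \<xi>))) \<in> borel_measurable N"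
    and lim: "(\<lambda>j. \<integral>\<^sup>+ z. ennreal (L2_norm lborel (\<lambda>\<xi>. h z \<xi> - (\<Sum>k<n j. of_real (indicator (A j k) z) * K j k \<xi>))) \<partial>N) \<longlonglongrightarrow> 0"
    and limV: "(\<lambda>j. L2_norm lborel (\<lambda>\<xi>. H \<xi> - (\<Sum>k<n j. of_real (measure N (A j k)) * K j k \<xi>))) \<longlonglongrightarrow> 0"
    using hH unfolding has_L2_integral_def by blast
  define I where "I j k = wiener_integral M W (K j k)" for j k
  have I: "has_wiener_integral M W (K j k) (I j k)" for j k
    unfolding I_def using A by (intro has_wiener_integral_wiener_integral) auto
  have comb: "L2_norm M (\<lambda>\<omega>. Z' \<omega> - (\<Sum>k<n j. c k * I j k \<omega>)) = L2_norm lborel (\<lambda>\<xi>. h' \<xi> - (\<Sum>k<n j. c k * K j k \<xi>))"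
    if "has_wiener_integral M W h' Z'" for h' Z' j c
    by (intro has_wiener_integral_isometry has_wiener_integral_diff has_wiener_integral_sum
        has_wiener_integral_cmult that I)
  have meas': "(\<lambda>z. L2_norm M (\<lambda>\<omega>. Z z \<omega> - (\<Sum>k<n j. of_real (indicator (A j k) z) * I j k \<omega>))) \<in> borel_measurable N" for j
    using meas[rule_format, of j] by (subst measurable_cong[OF comb[OF Z]]) auto
  have lim': "(\<integral>\<^sup>+ z. ennreal (L2_norm M (\<lambda>\<omega>. Z z \<omega> - (\<Sum>k<n j. of_real (indicator (A j k) z) * I j k \<omega>))) \<partial>N)
      = (\<integral>\<^sup>+ z. ennreal (L2_norm lborel (\<lambda>\<xi>. h z \<xi> - (\<Sum>k<n j. of_real (indicator (A j k) z) * K j k \<xi>))) \<partial>N)" for j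
    by (rule nn_integral_cong) (simp add: comb[OF Z])
  show ?thesis
    unfolding has_L2_integral_def
  proof (intro conjI exI[of _ n] exI[of _ A] exI[of _ I])
    show "\<forall>j k. A j k \<in> sets N \<and> emeasure N (A j k) < \<infinity> \<and> square_integrable M (I j k)"
      using A has_wiener_integral_square_integrable(2)[OF I] by blast
    show "\<forall>z\<in>space N. square_integrable M (Z z)" "square_integrable M V"
      using has_wiener_integral_square_integrable(2) Z V by auto
  qed (use meas' lim limV lim' comb[OF V] in auto)
qed


section \<open>Integration by parts against plane waves\<close>

lemma dir_deriv_eq_0_outside:
  assumes "closed K" "\<And>z. z \<notin> K \<Longrightarrow> \<phi> z = 0" "z \<notin> K"
  shows "dir_deriv v \<phi> z = 0"
proof -
  have "((\<lambda>_. 0) has_derivative (\<lambda>_. 0)) (at z)" by simp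
  then have "(\<phi> has_derivative (\<lambda>_. 0)) (at z)"
    by (rule has_derivative_transform_within_open[where s = "- K"]) (use assms in auto)
  then show ?thesis by (metis dir_deriv_def frechet_derivative_at)
qed

lemma test_function_support: "z \<notin> closure {z. \<phi> z \<noteq> 0} \<Longrightarrow> \<phi> z = 0"
  using subsetD[OF closure_subset, of z "{z. \<phi> z \<noteq> 0}"] by auto

lemma test_functionD:
  assumes "test_function \<phi>"
  shows "continuous_on UNIV \<phi>" "\<phi> differentiable (at z)" "compact (closure {z. \<phi> z \<noteq> 0})"
  using assms unfolding test_function_def
  by (auto elim: allE[of _ 0] allE[of _ "Suc 0"])

lemma test_function_dir_deriv:
  assumes \<phi>: "test_function \<phi>" shows "test_function (dir_deriv v \<phi>)"
  unfolding test_function_def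
proof
  show "\<forall>k. times_differentiable k (dir_deriv v \<phi>)"
  proof
    fix k
    have "times_differentiable (Suc k) \<phi>" using \<phi> unfolding test_function_def by blast
    then show "times_differentiable k (dir_deriv v \<phi>)" by simp
  qed
  have "{z. dir_deriv v \<phi> z \<noteq> 0} \<subseteq> closure {z. \<phi> z \<noteq> 0}"
  proof (rule subsetI, rule ccontr)
    fix z assume "z \<in> {z. dir_deriv v \<phi> z \<noteq> 0}" and z: "z \<notin> closure {z. \<phi> z \<noteq> 0}"
    moreover have "dir_deriv v \<phi> z = 0"
      by (rule dir_deriv_eq_0_outside[OF closed_closure _ z]) (rule test_function_support)
    ultimately show False by blast
  qed
  then have "closure {z. dir_deriv v \<phi> z \<noteq> 0} \<subseteq> closure {z. \<phi> z \<noteq> 0}"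
    by (simp add: closure_minimal)
  then show "compact (closure {z. dir_deriv v \<phi> z \<noteq> 0})"
    using compact_Int_closed[OF test_functionD(3)[OF \<phi>] closed_closure[of "{z. dir_deriv v \<phi> z \<noteq> 0}"]]
    by (simp add: inf_absorb2)
qed

lemma compact_support_bounded:
  fixes \<psi> :: "'a::topological_space \<Rightarrow> complex"
  assumes "continuous_on UNIV \<psi>" "compact K" "\<And>z. z \<notin> K \<Longrightarrow> \<psi> z = 0"
  obtains C where "0 \<le> C" "\<And>z. cmod (\<psi> z) \<le> C"
proof -
  have "bounded (\<psi> ` K)"
    using assms by (intro compact_imp_bounded compact_continuous_image) (auto intro: continuous_on_subset)
  then obtain C where C: "\<And>z. z \<in> K \<Longrightarrow> cmod (\<psi> z) \<le> C" by (auto simp: bounded_iff)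
  have "cmod (\<psi> z) \<le> max C 0" for z
    using C[of z] assms(3)[of z] by (cases "z \<in> K") auto
  then show ?thesis using that[of "max C 0"] by auto
qed

lemma compact_support_integrable:
  fixes \<psi> :: "'a::euclidean_space \<Rightarrow> complex"
  assumes "continuous_on UNIV \<psi>" "compact K" "\<And>z. z \<notin> K \<Longrightarrow> \<psi> z = 0"
  shows "integrable lborel \<psi>"
proof -
  have "integrable lborel (\<lambda>x. indicator K x *\<^sub>R \<psi> x)"
    using assms by (intro borel_integrable_compact) (auto intro: continuous_on_subset)
  moreover have "(\<lambda>x. indicator K x *\<^sub>R \<psi> x) = \<psi>"
    using assms(3) by (auto simp: indicator_def)
  ultimately show ?thesis by simp
qed

lemma line_has_derivative:
  fixes \<psi> :: "'a::real_normed_vector \<Rightarrow> complex"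
  assumes "\<And>z. \<psi> differentiable (at z)"
  shows "((\<lambda>s::real. \<psi> (z + s *\<^sub>R v)) has_derivative (\<lambda>r. of_real r * dir_deriv v \<psi> (z + s *\<^sub>R v))) (at s)"
proof -
  have \<psi>: "(\<psi> has_derivative frechet_derivative \<psi> (at y)) (at y)" for y
    using assms frechet_derivative_works by blast
  have "((\<lambda>s::real. z + s *\<^sub>R v) has_derivative (\<lambda>r. r *\<^sub>R v)) (at s)"
    by (auto intro!: derivative_eq_intros)
  from diff_chain_at[OF this \<psi>]
  have "((\<lambda>s. \<psi> (z + s *\<^sub>R v)) has_derivative (\<lambda>r. frechet_derivative \<psi> (at (z + s *\<^sub>R v)) (r *\<^sub>R v))) (at s)"
    by (simp add: o_def)
  moreover have "frechet_derivative \<psi> (at y) (r *\<^sub>R v) = of_real r * dir_deriv v \<psi> y" for y r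
    using linear_scale[OF has_derivative_linear[OF \<psi>]] by (simp add: dir_deriv_def scaleR_conv_of_real)
  ultimately show ?thesis by simp
qed

text \<open>
  The difference quotients of \<open>\<psi>\<close> in the direction \<open>v\<close> have integral \<open>0\<close> by translation invariance
  of Lebesgue measure, and they converge boundedly, with supports in a common ball.
\<close>

lemma integral_dir_deriv_eq_0:
  fixes \<psi> :: "'a::euclidean_space \<Rightarrow> complex"
  assumes diff: "\<And>z. \<psi> differentiable (at z)" and cont: "continuous_on UNIV (dir_deriv v \<psi>)"
    and K: "compact K" "\<And>z. z \<notin> K \<Longrightarrow> \<psi> z = 0"
  shows "(\<integral>z. dir_deriv v \<psi> z \<partial>lborel) = 0"
proof -
  have cont\<psi>: "continuous_on UNIV \<psi>"
    using diff by (simp add: continuous_on_eq_continuous_at differentiable_imp_continuous_within)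
  have [measurable]: "\<psi> \<in> borel_measurable borel" "dir_deriv v \<psi> \<in> borel_measurable borel"
    by (intro borel_measurable_continuous_onI cont\<psi> cont)+
  have int\<psi>: "integrable lborel \<psi>" by (rule compact_support_integrable[OF cont\<psi> K])
  obtain C where C: "0 \<le> C" "\<And>z. cmod (dir_deriv v \<psi> z) \<le> C"
    using compact_support_bounded[OF cont K(1) dir_deriv_eq_0_outside[OF compact_imp_closed[OF K(1)] K(2)]]
    by blast
  define h where "h n = 1 / real (Suc n)" for n
  have h: "0 < h n" "h n \<le> 1" for n by (auto simp: h_def divide_le_eq)
  have h_lim: "h \<longlonglongrightarrow> 0" unfolding h_def using LIMSEQ_inverse_real_of_nat by (simp add: inverse_eq_divide)
  define F where "F n z = (\<psi> (z + h n *\<^sub>R v) - \<psi> z) / of_real (h n)" for n z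
  obtain R where R: "\<And>z. z \<in> K \<Longrightarrow> norm z \<le> R"
    using compact_imp_bounded[OF K(1)] by (auto simp: bounded_iff)
  have F_bound: "cmod (F n z) \<le> C * indicator (cball 0 (R + norm v)) z" for n z
  proof (cases "z \<in> cball 0 (R + norm v)")
    case True
    obtain s where "cmod (\<psi> (z + h n *\<^sub>R v) - \<psi> (z + 0 *\<^sub>R v)) \<le> cmod (of_real (h n - 0) * dir_deriv v \<psi> (z + s *\<^sub>R v))"
      using mvt_general[OF h(1)[of n], of "\<lambda>s. \<psi> (z + s *\<^sub>R v)"] line_has_derivative[OF diff, of z v]
      by (metis (no_types, lifting) has_derivative_continuous continuous_at_imp_continuous_on)
    also have "\<dots> \<le> h n * C"
      using C(2) h(1)[of n] by (simp add: norm_mult)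
    finally show ?thesis using True h(1)[of n] by (simp add: F_def norm_divide field_simps)
  next
    case False
    then have n: "norm z > R + norm v" by simp
    have "norm (h n *\<^sub>R v) \<le> norm v" using h[of n] by (simp add: mult_left_le_one_le)
    then have "norm (z + h n *\<^sub>R v) > R" using n norm_diff_ineq[of z "h n *\<^sub>R v"] by linarith
    moreover have "norm z > R" using n norm_ge_zero[of v] by linarith
    ultimately have "\<psi> (z + h n *\<^sub>R v) = 0" "\<psi> z = 0" using R K(2) by (meson not_le)+
    then show ?thesis using False by (simp add: F_def)
  qed
  have F_lim: "(\<lambda>n. F n z) \<longlonglongrightarrow> dir_deriv v \<psi> z" for z
  proof -
    have "(\<lambda>s. cmod (\<psi> (z + (0 + s) *\<^sub>R v) - \<psi> (z + 0 *\<^sub>R v) - of_real s * dir_deriv v \<psi> (z + 0 *\<^sub>R v)) / norm s) \<midarrow>0\<rightarrow> 0"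
      using line_has_derivative[OF diff, of z v 0] unfolding has_derivative_at by blast
    then have "(\<lambda>n. cmod (\<psi> (z + h n *\<^sub>R v) - \<psi> z - of_real (h n) * dir_deriv v \<psi> z) / norm (h n)) \<longlonglongrightarrow> 0"
      using h_lim h(1) unfolding LIMSEQ_SEQ_conv[symmetric]
      by (auto elim!: allE[of _ h] simp: less_imp_neq[symmetric])
    moreover have "cmod (\<psi> (z + h n *\<^sub>R v) - \<psi> z - of_real (h n) * dir_deriv v \<psi> z) / norm (h n)
        = cmod (F n z - dir_deriv v \<psi> z)" for n
    proof -
      have "F n z - dir_deriv v \<psi> z = (\<psi> (z + h n *\<^sub>R v) - \<psi> z - of_real (h n) * dir_deriv v \<psi> z) / of_real (h n)"
        using h(1)[of n] by (simp add: F_def field_simps)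
      then show ?thesis by (simp add: norm_divide)
    qed
    ultimately have "(\<lambda>n. F n z - dir_deriv v \<psi> z) \<longlonglongrightarrow> 0"
      by (simp add: tendsto_norm_zero_iff)
    then show ?thesis by (simp add: LIM_zero_iff)
  qed
  have shift: "integrable lborel (\<lambda>z. \<psi> (z + c)) \<and> (\<integral>z. \<psi> (z + c) \<partial>lborel) = (\<integral>z. \<psi> z \<partial>lborel)" for c
  proof -
    have "integrable (distr lborel borel ((+) c)) \<psi>" "(\<integral>z. \<psi> z \<partial>distr lborel borel ((+) c)) = (\<integral>z. \<psi> z \<partial>lborel)"
      using int\<psi> by (simp_all add: lborel_distr_plus)
    then show ?thesis
      by (subst (asm) integrable_distr_eq; simp) (subst (asm) integral_distr; simp add: add.commute)
  qed
  have "(\<integral>z. F n z \<partial>lborel) = 0" for n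
    unfolding F_def using shift[of "h n *\<^sub>R v"] int\<psi> by simp
  moreover have "(\<lambda>n. \<integral>z. F n z \<partial>lborel) \<longlonglongrightarrow> (\<integral>z. dir_deriv v \<psi> z \<partial>lborel)"
  proof (rule integral_dominated_convergence)
    show "integrable lborel (\<lambda>z. C * indicator (cball 0 (R + norm v)) z :: real)"
      by (intro integrable_mult_right integrable_real_indicator emeasure_lborel_cball_finite) simp
    show "F n \<in> borel_measurable lborel" for n unfolding F_def by measurable
  qed (use F_bound F_lim in auto)
  ultimately show ?thesis by (simp add: LIMSEQ_const_iff)
qed

text \<open>The product rule, with vanishing integral of the derivative of \<open>\<phi> * exp L\<close>.\<close>

lemma integral_dir_deriv_plane_wave:
  fixes L :: "'a::euclidean_space \<Rightarrow> complex"
  assumes \<phi>: "test_function \<phi>" and L: "bounded_linear L"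
  shows "(\<integral>z. dir_deriv v \<phi> z * exp (L z) \<partial>lborel) = - L v * (\<integral>z. \<phi> z * exp (L z) \<partial>lborel)"
proof -
  let ?K = "closure {z. \<phi> z \<noteq> 0}"
  have supp: "\<phi> z = 0" if "z \<notin> ?K" for z by (rule test_function_support[OF that])
  note K = test_functionD(3)[OF \<phi>]
  have dsupp: "dir_deriv v \<phi> z = 0" if "z \<notin> ?K" for z
    by (rule dir_deriv_eq_0_outside[OF closed_closure _ that]) (rule supp)
  have d: "(\<phi> has_derivative frechet_derivative \<phi> (at z)) (at z)" for z
    using test_functionD(2)[OF \<phi>] frechet_derivative_works by blast
  have e: "((\<lambda>z. exp (L z)) has_derivative (\<lambda>u. L u * exp (L z))) (at z)" for z
    using diff_chain_at[OF bounded_linear_imp_has_derivative[OF L] has_field_derivative_imp_has_derivative[OF DERIV_exp]]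
    by (simp add: o_def mult.commute)
  have der: "((\<lambda>z. \<phi> z * exp (L z)) has_derivative
      (\<lambda>u. \<phi> z * (L u * exp (L z)) + frechet_derivative \<phi> (at z) u * exp (L z))) (at z)" for z
    by (rule has_derivative_mult[OF d e])
  have dd: "dir_deriv v (\<lambda>z. \<phi> z * exp (L z)) z = dir_deriv v \<phi> z * exp (L z) + L v * (\<phi> z * exp (L z))" for z
    unfolding dir_deriv_def frechet_derivative_at[OF der, symmetric] by (simp add: algebra_simps)
  have contL: "continuous_on UNIV L" by (rule linear_continuous_on[OF L])
  have cont: "continuous_on UNIV (\<lambda>z. \<phi> z * exp (L z))" "continuous_on UNIV (\<lambda>z. dir_deriv v \<phi> z * exp (L z))"
    using test_functionD(1)[OF \<phi>] test_functionD(1)[OF test_function_dir_deriv[OF \<phi>]] contL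
    by (auto intro!: continuous_intros)
  have int1: "integrable lborel (\<lambda>z. \<phi> z * exp (L z))"
    by (rule compact_support_integrable[OF cont(1) K]) (drule supp, simp)
  have int2: "integrable lborel (\<lambda>z. dir_deriv v \<phi> z * exp (L z))"
    by (rule compact_support_integrable[OF cont(2) K]) (drule dsupp, simp)
  have "(\<integral>z. dir_deriv v (\<lambda>z. \<phi> z * exp (L z)) z \<partial>lborel) = 0"
  proof (rule integral_dir_deriv_eq_0[OF _ _ K])
    show "(\<lambda>z. \<phi> z * exp (L z)) differentiable (at z)" for z using der by (auto simp: differentiable_def)
    show "continuous_on UNIV (dir_deriv v (\<lambda>z. \<phi> z * exp (L z)))"
      unfolding dd[abs_def] by (intro continuous_intros cont)
    show "\<phi> z * exp (L z) = 0" if "z \<notin> ?K" for z using supp[OF that] by simp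
  qed
  then show ?thesis
    unfolding dd using int1 int2 by (simp add: add_eq_0_iff)
qed


section \<open>The exchange multiplier and the dispersion relation\<close>

text \<open>The correlation function of the field: its value at \<open>x - y\<close> is the correlation of the points \<open>y\<close> and \<open>x\<close>.\<close>

definition density_transform :: "('a::euclidean_space \<Rightarrow> real) \<Rightarrow> 'a \<Rightarrow> complex" where
  "density_transform f y = (\<integral>\<eta>. iexp (\<eta> \<bullet> y) * of_real ((f \<eta>)\<^sup>2) \<partial>lborel)"

text \<open>
  The exchange term with interaction \<open>P\<close> acts on the plane wave of frequency \<open>\<xi>\<close> by this factor.
\<close>

definition exchange_multiplier :: "'a::euclidean_space measure \<Rightarrow> ('a \<Rightarrow> real) \<Rightarrow> 'a \<Rightarrow> complex" where
  "exchange_multiplier P f \<xi> = (\<integral>y. density_transform f y * iexp (- (y \<bullet> \<xi>)) \<partial>P)"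

locale square_density =
  fixes f :: "'a::euclidean_space \<Rightarrow> real"
  assumes f_meas [measurable]: "f \<in> borel_measurable borel"
    and f_int: "integrable lborel (\<lambda>\<xi>. (f \<xi>)\<^sup>2)"
begin

definition mass :: real where "mass = (\<integral>\<xi>. (f \<xi>)\<^sup>2 \<partial>lborel)"

lemma square_integrable_f: "square_integrable lborel (\<lambda>\<xi>. of_real (f \<xi>))"
  using f_int by (auto simp: square_integrable_def)

lemma density_transform_bound: "cmod (density_transform f y) \<le> mass"
proof -
  have "cmod (density_transform f y) \<le> (\<integral>\<eta>. cmod (iexp (\<eta> \<bullet> y) * of_real ((f \<eta>)\<^sup>2)) \<partial>lborel)"
    unfolding density_transform_def by (rule integral_norm_bound)
  also have "\<dots> = mass" unfolding mass_def by (simp add: norm_mult norm_power)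
  finally show ?thesis .
qed

lemma density_transform_continuous: "continuous_on UNIV (density_transform f)"
  unfolding continuous_on_sequentially
proof (intro allI ballI impI)
  fix y and s :: "nat \<Rightarrow> 'a" assume "(\<forall>n. s n \<in> UNIV) \<and> s \<longlonglongrightarrow> y"
  then have s: "s \<longlonglongrightarrow> y" by simp
  show "(density_transform f \<circ> s) \<longlonglongrightarrow> density_transform f y"
    unfolding comp_def density_transform_def
  proof (rule integral_dominated_convergence[OF _ _ f_int])
    show "AE \<eta> in lborel. (\<lambda>n. iexp (\<eta> \<bullet> s n) * of_real ((f \<eta>)\<^sup>2)) \<longlonglongrightarrow> iexp (\<eta> \<bullet> y) * of_real ((f \<eta>)\<^sup>2)"
      by (intro AE_I2 tendsto_intros s)
    show "AE \<eta> in lborel. norm (iexp (\<eta> \<bullet> s n) * of_real ((f \<eta>)\<^sup>2)) \<le> (f \<eta>)\<^sup>2" for n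
      by (simp add: norm_mult norm_power)
  qed measurable
qed

lemma density_transform_uminus: "density_transform f (- y) = cnj (density_transform f y)"
  unfolding density_transform_def by (subst Bochner_Integration.integral_cnj[symmetric]) (simp add: exp_cnj)

lemma density_transform_measurable [measurable]: "density_transform f \<in> borel_measurable borel"
  by (rule borel_measurable_continuous_onI[OF density_transform_continuous])

context
  fixes P :: "'a measure"
  assumes fin: "finite_measure P" and sets_P [measurable_cong]: "sets P = sets borel"
begin

interpretation finite_measure P by (rule fin)

lemma space_P: "space P = UNIV"
  using sets_eq_imp_space_eq[OF sets_P] by simp

lemma exchange_multiplier_measurable: "exchange_multiplier P f \<in> borel_measurable borel"
  unfolding exchange_multiplier_def by measurable

lemma exchange_multiplier_bound: "cmod (exchange_multiplier P f \<xi>) \<le> mass * measure P UNIV"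
proof -
  have "cmod (exchange_multiplier P f \<xi>) \<le> (\<integral>y. cmod (density_transform f y * iexp (- (y \<bullet> \<xi>))) \<partial>P)"
    unfolding exchange_multiplier_def by (rule integral_norm_bound)
  also have "\<dots> \<le> (\<integral>y. mass \<partial>P)"
  proof (rule integral_mono)
    show "integrable P (\<lambda>y. cmod (density_transform f y * iexp (- (y \<bullet> \<xi>))))"
      using density_transform_bound
      by (intro integrable_norm integrable_const_bound[where B = mass]) (auto simp: norm_mult)
  qed (use density_transform_bound in \<open>auto simp: norm_mult\<close>)
  also have "\<dots> = mass * measure P UNIV" by (simp add: space_P)
  finally show ?thesis .
qed

text \<open>Conjugation amounts to the substitution \<open>y \<mapsto> - y\<close>, under which \<open>P\<close> is invariant.\<close>

lemma exchange_multiplier_real: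
  assumes even: "distr P borel uminus = P"
  shows "cnj (exchange_multiplier P f \<xi>) = exchange_multiplier P f \<xi>"
proof -
  have "exchange_multiplier P f \<xi> = (\<integral>y. density_transform f y * iexp (- (y \<bullet> \<xi>)) \<partial>distr P borel uminus)"
    by (simp add: exchange_multiplier_def even)
  also have "\<dots> = (\<integral>y. density_transform f (- y) * iexp (- (- y \<bullet> \<xi>)) \<partial>P)"
    by (rule integral_distr) measurable
  also have "\<dots> = (\<integral>y. cnj (density_transform f y * iexp (- (y \<bullet> \<xi>))) \<partial>P)"
    by (simp add: density_transform_uminus exp_cnj)
  also have "\<dots> = cnj (exchange_multiplier P f \<xi>)"
    unfolding exchange_multiplier_def by (rule Bochner_Integration.integral_cnj)
  finally show ?thesis by simp
qed

lemma char_conv_integrable: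
  "integrable lborel (\<lambda>\<eta>. (\<integral>x. iexp (- (x \<bullet> (\<xi> - \<eta>))) \<partial>P) * of_real ((f \<eta>)\<^sup>2))" (is ?int)
  and exchange_multiplier_eq:
  "(\<integral>\<eta>. (\<integral>x. iexp (- (x \<bullet> (\<xi> - \<eta>))) \<partial>P) * of_real ((f \<eta>)\<^sup>2) \<partial>lborel) = exchange_multiplier P f \<xi>" (is ?eq)
proof -
  interpret Q: pair_sigma_finite P "lborel :: 'a measure" ..
  let ?F = "\<lambda>x \<eta>. iexp (- (x \<bullet> (\<xi> - \<eta>))) * of_real ((f \<eta>)\<^sup>2)"
  have int: "integrable (P \<Otimes>\<^sub>M lborel) (case_prod ?F)"
  proof (rule Q.Fubini_integrable)
    show "integrable P (\<lambda>x. \<integral>\<eta>. norm (case (x, \<eta>) of (x, \<eta>) \<Rightarrow> ?F x \<eta>) \<partial>lborel)"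
      by (simp add: norm_mult norm_power)
    show "AE x in P. integrable lborel (\<lambda>\<eta>. case (x, \<eta>) of (x, \<eta>) \<Rightarrow> ?F x \<eta>)"
    proof (rule AE_I2)
      fix x
      show "integrable lborel (\<lambda>\<eta>. case (x, \<eta>) of (x, \<eta>) \<Rightarrow> ?F x \<eta>)"
        by (rule Bochner_Integration.integrable_bound[OF f_int]) (auto simp: norm_mult norm_power)
    qed
  qed measurable
  have F_P: "(\<integral>x. ?F x \<eta> \<partial>P) = (\<integral>x. iexp (- (x \<bullet> (\<xi> - \<eta>))) \<partial>P) * of_real ((f \<eta>)\<^sup>2)" for \<eta> by simp
  have F_l: "(\<integral>\<eta>. ?F x \<eta> \<partial>lborel) = density_transform f x * iexp (- (x \<bullet> \<xi>))" for x
  proof -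
    have split: "?F x \<eta> = iexp (\<eta> \<bullet> x) * of_real ((f \<eta>)\<^sup>2) * iexp (- (x \<bullet> \<xi>))" for \<eta>
    proof -
      have "\<i> * complex_of_real (- (x \<bullet> (\<xi> - \<eta>))) = \<i> * complex_of_real (\<eta> \<bullet> x) + \<i> * complex_of_real (- (x \<bullet> \<xi>))"
        by (simp add: inner_diff_right inner_commute algebra_simps)
      then show ?thesis by (simp only: exp_add mult_ac)
    qed
    show ?thesis unfolding split density_transform_def by (rule integral_mult_left_zero)
  qed
  show ?int using Q.integrable_snd[OF int] unfolding F_P .
  show ?eq using Q.Fubini_integral[OF int] unfolding F_P F_l exchange_multiplier_def .
qed

end

end


section \<open>The equilibrium field\<close>

locale equilibrium = white_noise M W + square_density f
  for M :: "'w measure" and W :: "(real ^ 'd) set \<Rightarrow> 'w \<Rightarrow> complex" and f :: "real ^ 'd \<Rightarrow> real" +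
  fixes w :: "(real ^ 'd) set \<Rightarrow> real"
  assumes w_fin: "finite_signed_measure w" and w_even: "even_signed_measure w"
begin

abbreviation "Pos \<equiv> pos_variation w"
abbreviation "Neg \<equiv> neg_variation w"
abbreviation "Y \<equiv> Y_field M W w f"

lemma finite_Pos: "finite_measure Pos" and finite_Neg: "finite_measure Neg"
  unfolding neg_variation_def
  by (intro finite_measure_pos_variation finite_signed_measure_uminus w_fin)+

lemma even_Pos: "distr Pos borel uminus = Pos" and even_Neg: "distr Neg borel uminus = Neg"
  unfolding neg_variation_def
  by (intro pos_variation_distr_uminus even_signed_measure_uminus w_even)+

definition K :: "real ^ 'd \<Rightarrow> complex" where
  "K \<xi> = exchange_multiplier Pos f \<xi> - exchange_multiplier Neg f \<xi>"

definition direct :: real where "direct = signed_integral w (\<lambda>_. 1) * mass"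

lemma K_measurable [measurable]: "K \<in> borel_measurable borel"
  unfolding K_def
  using exchange_multiplier_measurable[OF finite_Pos] exchange_multiplier_measurable[OF finite_Neg]
  by (intro borel_measurable_diff) auto

lemma K_bound: "cmod (K \<xi>) \<le> mass * measure Pos UNIV + mass * measure Neg UNIV"
  unfolding K_def
  using exchange_multiplier_bound[OF finite_Pos] exchange_multiplier_bound[OF finite_Neg]
  by (intro order_trans[OF norm_triangle_ineq4] add_mono) auto

lemma K_eq:
  "of_real ((2 * pi) powr (real CARD('d) / 2)) *
     (\<integral>\<eta>. fourier_measure w (\<xi> - \<eta>) * of_real ((f \<eta>)\<^sup>2) \<partial>lborel) = K \<xi>"
proof -
  let ?a = "complex_of_real ((2 * pi) powr (real CARD('d) / 2))"
  let ?b = "complex_of_real ((2 * pi) powr (- (real CARD('d) / 2)))"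
  have ab: "?a * ?b = 1" by (simp add: powr_minus flip: of_real_mult)
  let ?p = "\<lambda>\<eta>. \<integral>x. iexp (- (x \<bullet> (\<xi> - \<eta>))) \<partial>Pos"
  let ?q = "\<lambda>\<eta>. \<integral>x. iexp (- (x \<bullet> (\<xi> - \<eta>))) \<partial>Neg"
  have "fourier_measure w (\<xi> - \<eta>) * of_real ((f \<eta>)\<^sup>2)
      = ?b * (?p \<eta> * of_real ((f \<eta>)\<^sup>2) - ?q \<eta> * of_real ((f \<eta>)\<^sup>2))" for \<eta>
    by (simp add: fourier_measure_def signed_integral_def algebra_simps)
  then have "(\<integral>\<eta>. fourier_measure w (\<xi> - \<eta>) * of_real ((f \<eta>)\<^sup>2) \<partial>lborel)
      = ?b * (\<integral>\<eta>. ?p \<eta> * of_real ((f \<eta>)\<^sup>2) - ?q \<eta> * of_real ((f \<eta>)\<^sup>2) \<partial>lborel)"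
    by (simp only: integral_mult_right_zero)
  also have "(\<integral>\<eta>. ?p \<eta> * of_real ((f \<eta>)\<^sup>2) - ?q \<eta> * of_real ((f \<eta>)\<^sup>2) \<partial>lborel) = K \<xi>"
    unfolding K_def
    using char_conv_integrable[OF finite_Pos] char_conv_integrable[OF finite_Neg]
      exchange_multiplier_eq[OF finite_Pos] exchange_multiplier_eq[OF finite_Neg]
    by (subst Bochner_Integration.integral_diff) auto
  finally show ?thesis using ab by (simp only: mult.assoc[symmetric] mult_1_left)
qed

lemma theta_eq: "theta w f \<xi> = of_real ((norm \<xi>)\<^sup>2) + of_real direct - K \<xi>"
  unfolding theta_def K_eq by (simp add: direct_def mass_def)

text \<open>Evenness of \<open>w\<close> makes the dispersion relation real, so the waves have modulus one.\<close>

lemma theta_real: "theta w f \<xi> = of_real (Re (theta w f \<xi>))"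
proof -
  have "cnj (K \<xi>) = K \<xi>"
    using exchange_multiplier_real[OF finite_Pos _ even_Pos] exchange_multiplier_real[OF finite_Neg _ even_Neg]
    by (simp add: K_def)
  then have "cnj (theta w f \<xi>) = theta w f \<xi>" by (simp add: theta_eq)
  then show ?thesis by (simp add: complex_eq_iff)
qed

definition \<theta> :: "real ^ 'd \<Rightarrow> real" where "\<theta> \<xi> = Re (theta w f \<xi>)"

lemma theta_measurable [measurable]: "\<theta> \<in> borel_measurable borel"
  unfolding \<theta>_def theta_eq by measurable

definition phase :: "real \<Rightarrow> real ^ 'd \<Rightarrow> real ^ 'd \<Rightarrow> complex" where
  "phase t x \<xi> = iexp (\<xi> \<bullet> x - \<theta> \<xi> * t)"

lemma phase_eq: "phase t x \<xi> = exp (\<i> * (of_real (\<xi> \<bullet> x) - theta w f \<xi> * of_real t))"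
  unfolding phase_def \<theta>_def by (subst (2) theta_real) simp

lemma norm_phase [simp]: "cmod (phase t x \<xi>) = 1"
  by (simp add: phase_def)

lemma phase_add: "phase (t + s) (x + a) \<xi> = phase s a \<xi> * phase t x \<xi>"
proof -
  have "\<xi> \<bullet> (x + a) - \<theta> \<xi> * (t + s) = (\<xi> \<bullet> a - \<theta> \<xi> * s) + (\<xi> \<bullet> x - \<theta> \<xi> * t)"
    by (simp add: inner_add_right algebra_simps)
  then show ?thesis by (simp only: phase_def of_real_add distrib_left exp_add)
qed

lemma phase_measurable [measurable]: "phase t x \<in> borel_measurable borel"
  unfolding phase_def by measurable

lemma square_integrable_multiplier:
  assumes [measurable]: "m \<in> borel_measurable borel" and "\<And>\<xi>. cmod (m \<xi>) \<le> B"
  shows "square_integrable lborel (\<lambda>\<xi>. m \<xi> * of_real (f \<xi>))"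
  using assms(2) by (intro square_integrable_dominated[OF square_integrable_f, where B = B])
    (auto simp: norm_mult intro!: mult_right_mono)

lemma square_integrable_phase:
  assumes "square_integrable lborel g"
  shows "square_integrable lborel (\<lambda>\<xi>. phase t x \<xi> * g \<xi>)"
proof (rule square_integrable_dominated[OF assms, where B = 1])
  note [measurable] = square_integrableD(1)[OF assms]
  show "(\<lambda>\<xi>. phase t x \<xi> * g \<xi>) \<in> borel_measurable lborel" by measurable
qed (simp add: norm_mult)

lemma has_wiener_integral_Y: "has_wiener_integral M W (\<lambda>\<xi>. phase t x \<xi> * of_real (f \<xi>)) (Y t x)"
  using has_wiener_integral_wiener_integral[OF square_integrable_phase[OF square_integrable_f, of t x]]
  unfolding Y_field_def phase_eq by (simp add: mult.commute)

lemma correlation_Y: "correlation M Y t y x = density_transform f (x - y)"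
proof -
  have "cnj (phase t y \<xi> * of_real (f \<xi>)) * (phase t x \<xi> * of_real (f \<xi>)) = iexp (\<xi> \<bullet> (x - y)) * of_real ((f \<xi>)\<^sup>2)" for \<xi>
  proof -
    have "cnj (phase t y \<xi>) = iexp (- (\<xi> \<bullet> y - \<theta> \<xi> * t))" by (simp add: phase_def exp_cnj algebra_simps)
    then have "cnj (phase t y \<xi>) * phase t x \<xi> = exp (\<i> * of_real (- (\<xi> \<bullet> y - \<theta> \<xi> * t)) + \<i> * of_real (\<xi> \<bullet> x - \<theta> \<xi> * t))"
      by (simp only: phase_def exp_add)
    also have "\<i> * complex_of_real (- (\<xi> \<bullet> y - \<theta> \<xi> * t)) + \<i> * of_real (\<xi> \<bullet> x - \<theta> \<xi> * t) = \<i> * of_real (\<xi> \<bullet> (x - y))"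
      by (simp add: inner_diff_right algebra_simps)
    finally have "cnj (phase t y \<xi>) * phase t x \<xi> = iexp (\<xi> \<bullet> (x - y))" .
    then show ?thesis by (simp add: power2_eq_square mult_ac)
  qed
  then show ?thesis
    unfolding correlation_def density_transform_def
    by (subst has_wiener_integral_covariance[OF has_wiener_integral_Y has_wiener_integral_Y]) simp
qed

lemma second_moment_Y: "(\<integral>\<omega>. (cmod (Y t x \<omega>))\<^sup>2 \<partial>M) = mass"
proof -
  have "(\<integral>\<omega>. (cmod (Y t x \<omega>))\<^sup>2 \<partial>M) = (L2_norm lborel (\<lambda>\<xi>. phase t x \<xi> * of_real (f \<xi>)))\<^sup>2"
    using has_wiener_integral_isometry[OF has_wiener_integral_Y, of t x] by (simp flip: L2_norm_power2)
  also have "\<dots> = mass" unfolding L2_norm_power2 mass_def by (simp add: norm_mult)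
  finally show ?thesis .
qed

lemma signed_integrable_second_moment: "signed_integrable w (\<lambda>z. \<integral>\<omega>. (cmod (Y t (x - z) \<omega>))\<^sup>2 \<partial>M)"
  unfolding second_moment_Y signed_integrable_def
  using finite_measure.integrable_const[OF finite_Pos] finite_measure.integrable_const[OF finite_Neg] by blast

lemma direct_potential_Y: "direct_potential M w Y t x = direct"
  unfolding direct_potential_def second_moment_Y direct_def signed_integral_def
  by (simp add: neg_variation_def algebra_simps)

definition exchange_field :: "real \<Rightarrow> real ^ 'd \<Rightarrow> 'w \<Rightarrow> complex" where
  "exchange_field t x = wiener_integral M W (\<lambda>\<xi>. phase t x \<xi> * (K \<xi> * of_real (f \<xi>)))"

lemma has_wiener_integral_exchange_field:
  "has_wiener_integral M W (\<lambda>\<xi>. phase t x \<xi> * (K \<xi> * of_real (f \<xi>))) (exchange_field t x)"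
  unfolding exchange_field_def
  by (intro has_wiener_integral_wiener_integral square_integrable_phase square_integrable_multiplier[OF _ K_bound])
     measurable

text \<open>
  Shifting \<open>Y\<close> by \<open>- z\<close> multiplies its integrand by \<open>exp (- \<i> z \<bullet> \<xi>)\<close>, so the integral over \<open>z\<close> acts on
  the integrand as the Fourier transform of the correlation function times \<open>P\<close>.
\<close>

lemma exchange_integral:
  assumes fin: "finite_measure P" and sets_P [measurable_cong]: "sets P = sets borel"
    and V: "has_wiener_integral M W (\<lambda>\<xi>. exchange_multiplier P f \<xi> * (phase t x \<xi> * of_real (f \<xi>))) V"
  shows "has_L2_integral P M (\<lambda>z \<omega>. correlation M Y t (x - z) x * Y t (x - z) \<omega>) V"
proof (rule has_L2_integral_wiener[OF _ _ V])
  interpret finite_measure P by (rule fin)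
  show "has_wiener_integral M W
      (\<lambda>\<xi>. (density_transform f z * iexp (- (z \<bullet> \<xi>))) * (phase t x \<xi> * of_real (f \<xi>)))
      (\<lambda>\<omega>. correlation M Y t (x - z) x * Y t (x - z) \<omega>)" for z
  proof -
    have "phase t (x - z) \<xi> = iexp (- (z \<bullet> \<xi>)) * phase t x \<xi>" for \<xi>
      using phase_add[of t 0 x "- z" \<xi>] by (simp add: phase_def inner_commute)
    then show ?thesis
      using has_wiener_integral_cmult[OF has_wiener_integral_Y[of t "x - z"], of "density_transform f z"]
      by (simp add: correlation_Y mult.assoc)
  qed
  show "has_L2_integral P lborel
      (\<lambda>z \<xi>. (density_transform f z * iexp (- (z \<bullet> \<xi>))) * (phase t x \<xi> * of_real (f \<xi>)))
      (\<lambda>\<xi>. exchange_multiplier P f \<xi> * (phase t x \<xi> * of_real (f \<xi>)))"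
    unfolding exchange_multiplier_def
  proof (rule has_L2_integral_lborel[where D = UNIV and B = mass])
    show "sigma_finite_measure P" by unfold_locales
    show "emeasure P UNIV < \<infinity>" by (simp add: less_top[symmetric])
    show "continuous_on UNIV (\<lambda>z. density_transform f z * iexp (- (z \<bullet> \<xi>)))" for \<xi>
      by (intro continuous_intros density_transform_continuous)
    show "cmod (density_transform f z * iexp (- (z \<bullet> \<xi>))) \<le> mass" for z \<xi>
      using density_transform_bound[of z] by (simp add: norm_mult)
    show "square_integrable lborel (\<lambda>\<xi>. phase t x \<xi> * of_real (f \<xi>))"
      by (rule square_integrable_phase[OF square_integrable_f])
  qed (use sets_P in auto)
qed

lemma is_exchange_term_Y: "is_exchange_term M w Y exchange_field"
  unfolding is_exchange_term_def
proof (intro allI)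
  fix t x
  define h where "h P \<xi> = exchange_multiplier P f \<xi> * (phase t x \<xi> * of_real (f \<xi>))" for P \<xi>
  have sq: "square_integrable lborel (h P)" if "finite_measure P" and sets_P: "sets P = sets borel" for P
  proof -
    note [measurable] = exchange_multiplier_measurable[OF that]
    have "square_integrable lborel (\<lambda>\<xi>. phase t x \<xi> * (exchange_multiplier P f \<xi> * of_real (f \<xi>)))"
      by (intro square_integrable_phase square_integrable_multiplier[OF _ exchange_multiplier_bound[OF that]])
         measurable
    then show ?thesis by (simp add: h_def[abs_def] mult_ac)
  qed
  note V = has_wiener_integral_wiener_integral[OF sq[OF finite_Pos]] has_wiener_integral_wiener_integral[OF sq[OF finite_Neg]]
  have "has_wiener_integral M W (\<lambda>\<xi>. h Pos \<xi> - h Neg \<xi>)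
      (\<lambda>\<omega>. wiener_integral M W (h Pos) \<omega> - wiener_integral M W (h Neg) \<omega>)"
    using V by (intro has_wiener_integral_diff) auto
  moreover have "(\<lambda>\<xi>. h Pos \<xi> - h Neg \<xi>) = (\<lambda>\<xi>. phase t x \<xi> * (K \<xi> * of_real (f \<xi>)))"
    by (simp add: h_def K_def algebra_simps)
  ultimately have "AE \<omega> in M. exchange_field t x \<omega> = wiener_integral M W (h Pos) \<omega> - wiener_integral M W (h Neg) \<omega>"
    using has_wiener_integral_unique[OF has_wiener_integral_exchange_field] by simp
  moreover have "has_L2_integral Pos M (\<lambda>z \<omega>. correlation M Y t (x - z) x * Y t (x - z) \<omega>) (wiener_integral M W (h Pos))"
    using exchange_integral[OF finite_Pos] V(1) by (simp add: h_def[abs_def])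
  moreover have "has_L2_integral Neg M (\<lambda>z \<omega>. correlation M Y t (x - z) x * Y t (x - z) \<omega>) (wiener_integral M W (h Neg))"
    using exchange_integral[OF finite_Neg] V(2) by (simp add: h_def[abs_def])
  ultimately show "has_signed_L2_integral w M (\<lambda>z \<omega>. correlation M Y t (x - z) x * Y t (x - z) \<omega>) (exchange_field t x)"
    unfolding has_signed_L2_integral_def
    using has_wiener_integral_square_integrable(2)[OF has_wiener_integral_exchange_field] by blast
qed

definition wave_integral :: "(real \<times> (real ^ 'd) \<Rightarrow> complex) \<Rightarrow> real ^ 'd \<Rightarrow> complex" where
  "wave_integral \<phi> \<xi> = (\<integral>z. \<phi> z * phase (fst z) (snd z) \<xi> \<partial>lborel)"

lemma has_pairing_wiener:
  assumes cont: "continuous_on UNIV \<phi>" and D: "compact D" and supp: "\<And>z. z \<notin> D \<Longrightarrow> \<phi> z = 0"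
    and g: "square_integrable lborel g"
    and X: "\<And>t x. has_wiener_integral M W (\<lambda>\<xi>. phase t x \<xi> * g \<xi>) (X t x)"
  obtains V where "has_pairing M X \<phi> V" "has_wiener_integral M W (\<lambda>\<xi>. wave_integral \<phi> \<xi> * g \<xi>) V"
proof -
  obtain B where B: "\<And>z. cmod (\<phi> z) \<le> B"
    using compact_support_bounded[OF cont D supp] by blast
  have [measurable]: "\<phi> \<in> borel_measurable borel" by (rule borel_measurable_continuous_onI[OF cont])
  have [measurable]: "(fst :: real \<times> (real ^ 'd) \<Rightarrow> real) \<in> borel_measurable borel"
      "(snd :: real \<times> (real ^ 'd) \<Rightarrow> real ^ 'd) \<in> borel_measurable borel"
    by (intro borel_measurable_continuous_onI continuous_intros)+
  have L2: "has_L2_integral lborel lborel (\<lambda>z \<xi>. (\<phi> z * phase (fst z) (snd z) \<xi>) * g \<xi>)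
      (\<lambda>\<xi>. wave_integral \<phi> \<xi> * g \<xi>)"
    unfolding wave_integral_def
  proof (rule has_L2_integral_lborel[where D = D and B = B])
    show "D \<in> sets borel" using D by (simp add: borel_closed compact_imp_closed)
    show "emeasure lborel D < \<infinity>" by (rule emeasure_compact_finite[OF D])
    show "case_prod (\<lambda>z \<xi>. \<phi> z * phase (fst z) (snd z) \<xi>) \<in> borel_measurable (borel \<Otimes>\<^sub>M borel)"
      unfolding phase_def by measurable
    show "continuous_on UNIV (\<lambda>z. \<phi> z * phase (fst z) (snd z) \<xi>)" for \<xi>
      unfolding phase_def by (intro continuous_intros cont)
  qed (use B supp g in \<open>auto simp: norm_mult lborel.sigma_finite_measure_axioms\<close>)
  then have "square_integrable lborel (\<lambda>\<xi>. wave_integral \<phi> \<xi> * g \<xi>)"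
    unfolding has_L2_integral_def by blast
  then obtain V where V: "has_wiener_integral M W (\<lambda>\<xi>. wave_integral \<phi> \<xi> * g \<xi>) V"
    using has_wiener_integral_exists by blast
  have "has_L2_integral lborel M (\<lambda>z \<omega>. \<phi> z * X (fst z) (snd z) \<omega>) V"
    by (rule has_L2_integral_wiener[OF L2 _ V]) (use has_wiener_integral_cmult[OF X] in \<open>simp add: mult.assoc\<close>)
  then have "has_pairing M X \<phi> V" by (simp add: has_pairing_def case_prod_beta')
  then show ?thesis using V that by blast
qed

lemma bounded_linear_phase: "bounded_linear (\<lambda>z. \<i> * complex_of_real (\<xi> \<bullet> snd z - \<theta> \<xi> * fst z))"
proof -
  have "bounded_linear (\<lambda>z :: real \<times> (real ^ 'd). \<xi> \<bullet> snd z - \<theta> \<xi> * fst z)"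
    by (intro bounded_linear_sub bounded_linear_inner_right_comp bounded_linear_const_mult
        bounded_linear_fst bounded_linear_snd)
  then show ?thesis
    by (intro bounded_linear_const_mult bounded_linear_compose[OF bounded_linear_of_real])
qed

lemma wave_integral_dir_deriv:
  assumes "test_function \<phi>"
  shows "wave_integral (dir_deriv v \<phi>) \<xi> = - \<i> * of_real (\<xi> \<bullet> snd v - \<theta> \<xi> * fst v) * wave_integral \<phi> \<xi>"
  using integral_dir_deriv_plane_wave[OF assms bounded_linear_phase, of v \<xi>]
  by (simp add: wave_integral_def phase_def)

lemma wave_integral_time_deriv:
  assumes "test_function \<phi>"
  shows "wave_integral (time_deriv \<phi>) \<xi> = \<i> * of_real (\<theta> \<xi>) * wave_integral \<phi> \<xi>"
  using wave_integral_dir_deriv[OF assms, of "(1, 0)" \<xi>] by (simp add: time_deriv_def)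

lemma wave_integral_integrable:
  assumes "test_function \<phi>"
  shows "integrable lborel (\<lambda>z. \<phi> z * phase (fst z) (snd z) \<xi>)"
proof (rule compact_support_integrable)
  show "continuous_on UNIV (\<lambda>z. \<phi> z * phase (fst z) (snd z) \<xi>)"
    unfolding phase_def by (intro continuous_intros test_functionD(1)[OF assms])
  show "compact (closure {z. \<phi> z \<noteq> 0})" by (rule test_functionD(3)[OF assms])
  show "\<phi> z * phase (fst z) (snd z) \<xi> = 0" if "z \<notin> closure {z. \<phi> z \<noteq> 0}" for z
    using test_function_support[OF that] by simp
qed

lemma wave_integral_laplacian:
  assumes \<phi>: "test_function \<phi>"
  shows "wave_integral (space_laplacian \<phi>) \<xi> = - of_real ((norm \<xi>)\<^sup>2) * wave_integral \<phi> \<xi>"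
proof -
  have "wave_integral (space_laplacian \<phi>) \<xi>
      = (\<Sum>b\<in>Basis. wave_integral (dir_deriv (0, b) (dir_deriv (0, b) \<phi>)) \<xi>)"
    unfolding wave_integral_def space_laplacian_def sum_distrib_right
    by (rule Bochner_Integration.integral_sum) (intro wave_integral_integrable test_function_dir_deriv \<phi>)
  also have "\<dots> = (\<Sum>b\<in>Basis. - of_real ((\<xi> \<bullet> b)\<^sup>2) * wave_integral \<phi> \<xi>)"
  proof (rule sum.cong[OF refl])
    fix b
    have "- \<i> * complex_of_real r * (- \<i> * of_real r * c) = - of_real (r\<^sup>2) * c" for r c
      by (simp add: power2_eq_square algebra_simps)
    then show "wave_integral (dir_deriv (0, b) (dir_deriv (0, b) \<phi>)) \<xi> = - of_real ((\<xi> \<bullet> b)\<^sup>2) * wave_integral \<phi> \<xi>"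
      using wave_integral_dir_deriv[OF test_function_dir_deriv[OF \<phi>], of "(0, b)" "(0, b)" \<xi>]
        wave_integral_dir_deriv[OF \<phi>, of "(0, b)" \<xi>] by simp
  qed
  also have "\<dots> = - of_real (\<Sum>b\<in>Basis. (\<xi> \<bullet> b)\<^sup>2) * wave_integral \<phi> \<xi>"
    by (simp only: sum_distrib_right[symmetric] sum_negf of_real_sum)
  also have "(\<Sum>b\<in>Basis. (\<xi> \<bullet> b)\<^sup>2) = (norm \<xi>)\<^sup>2"
    unfolding power2_norm_eq_inner euclidean_inner[of \<xi> \<xi>] by (simp add: power2_eq_square)
  finally show ?thesis .
qed

lemma space_laplacian_regular:
  assumes \<phi>: "test_function \<phi>"
  shows "continuous_on UNIV (space_laplacian \<phi>)"
    and "z \<notin> closure {z. \<phi> z \<noteq> 0} \<Longrightarrow> space_laplacian \<phi> z = 0"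
proof -
  show "continuous_on UNIV (space_laplacian \<phi>)"
    unfolding space_laplacian_def
    by (intro continuous_on_sum test_functionD(1) test_function_dir_deriv \<phi>)
  assume z: "z \<notin> closure {z. \<phi> z \<noteq> 0}"
  have d: "dir_deriv v \<phi> u = 0" if "u \<notin> closure {z. \<phi> z \<noteq> 0}" for u v
    by (rule dir_deriv_eq_0_outside[OF closed_closure _ that]) (rule test_function_support)
  have "dir_deriv v (dir_deriv v \<phi>) z = 0" for v
    by (rule dir_deriv_eq_0_outside[OF closed_closure _ z]) (rule d)
  then show "space_laplacian \<phi> z = 0" by (simp add: space_laplacian_def)
qed

text \<open>
  All four pairings are Wiener integrals of multiples of \<open>wave_integral \<phi> * f\<close>; their multipliers
  satisfy \<open>\<theta> = \<bar>\<xi>\<bar>\<^sup>2 + direct - K\<close>, which is the definition of the dispersion relation.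
\<close>

lemma is_solution_Y: "is_solution M w Y"
  unfolding is_solution_def
proof (intro conjI allI impI exI[of _ exchange_field])
  show "square_integrable M (Y t x)" for t x
    by (rule has_wiener_integral_square_integrable(2)[OF has_wiener_integral_Y])
  show "signed_integrable w (\<lambda>z. \<integral>\<omega>. (cmod (Y t (x - z) \<omega>))\<^sup>2 \<partial>M)" for t x
    by (rule signed_integrable_second_moment)
  show "is_exchange_term M w Y exchange_field" by (rule is_exchange_term_Y)
  fix \<phi> :: "real \<times> (real ^ 'd) \<Rightarrow> complex" assume \<phi>: "test_function \<phi>"
  note \<phi>' = test_function_dir_deriv[OF \<phi>, of "(1, 0)", folded time_deriv_def]
  note f_sq = square_integrable_f
  obtain A where A: "has_pairing M Y (time_deriv \<phi>) A"
      "has_wiener_integral M W (\<lambda>\<xi>. wave_integral (time_deriv \<phi>) \<xi> * of_real (f \<xi>)) A"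
    by (rule has_pairing_wiener[OF test_functionD(1)[OF \<phi>'] test_functionD(3)[OF \<phi>'] test_function_support[of _ "time_deriv \<phi>"] f_sq has_wiener_integral_Y])
  obtain B where B: "has_pairing M Y (space_laplacian \<phi>) B"
      "has_wiener_integral M W (\<lambda>\<xi>. wave_integral (space_laplacian \<phi>) \<xi> * of_real (f \<xi>)) B"
    by (rule has_pairing_wiener[OF space_laplacian_regular(1)[OF \<phi>] test_functionD(3)[OF \<phi>]
          space_laplacian_regular(2)[OF \<phi>] f_sq has_wiener_integral_Y])
  have "has_wiener_integral M W (\<lambda>\<xi>. phase t x \<xi> * (of_real direct * of_real (f \<xi>)))
      (\<lambda>\<omega>. of_real (direct_potential M w Y t x) * Y t x \<omega>)" for t x
    using has_wiener_integral_cmult[OF has_wiener_integral_Y, of "of_real direct"]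
    by (simp add: direct_potential_Y mult_ac)
  from has_pairing_wiener[OF test_functionD(1)[OF \<phi>] test_functionD(3)[OF \<phi>] test_function_support[of _ \<phi>]
      square_integrable_cmult[OF f_sq] this]
  obtain C where C: "has_pairing M (\<lambda>t x \<omega>. of_real (direct_potential M w Y t x) * Y t x \<omega>) \<phi> C"
      "has_wiener_integral M W (\<lambda>\<xi>. wave_integral \<phi> \<xi> * (of_real direct * of_real (f \<xi>))) C"
    by blast
  obtain D where D: "has_pairing M exchange_field \<phi> D"
      "has_wiener_integral M W (\<lambda>\<xi>. wave_integral \<phi> \<xi> * (K \<xi> * of_real (f \<xi>))) D"
    by (rule has_pairing_wiener[OF test_functionD(1)[OF \<phi>] test_functionD(3)[OF \<phi>] test_function_support[of _ \<phi>]
          square_integrable_multiplier[OF K_measurable K_bound] has_wiener_integral_exchange_field])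
  have "has_wiener_integral M W (\<lambda>\<xi>. - \<i> * (wave_integral (time_deriv \<phi>) \<xi> * of_real (f \<xi>))) (\<lambda>\<omega>. - \<i> * A \<omega>)"
    by (rule has_wiener_integral_cmult[OF A(2)])
  moreover have "has_wiener_integral M W
      (\<lambda>\<xi>. ((-1) * (wave_integral (space_laplacian \<phi>) \<xi> * of_real (f \<xi>))
            + 1 * (wave_integral \<phi> \<xi> * (of_real direct * of_real (f \<xi>)))) - wave_integral \<phi> \<xi> * (K \<xi> * of_real (f \<xi>)))
      (\<lambda>\<omega>. ((-1) * B \<omega> + 1 * C \<omega>) - D \<omega>)"
    by (rule has_wiener_integral_diff[OF has_wiener_integral_linear[OF B(2) C(2)] D(2)])
  moreover have "- \<i> * (wave_integral (time_deriv \<phi>) \<xi> * of_real (f \<xi>))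
      = ((-1) * (wave_integral (space_laplacian \<phi>) \<xi> * of_real (f \<xi>))
            + 1 * (wave_integral \<phi> \<xi> * (of_real direct * of_real (f \<xi>)))) - wave_integral \<phi> \<xi> * (K \<xi> * of_real (f \<xi>))" for \<xi>
  proof -
    have "complex_of_real (\<theta> \<xi>) = of_real ((norm \<xi>)\<^sup>2) + of_real direct - K \<xi>"
      using theta_real[of \<xi>] theta_eq[of \<xi>] by (simp add: \<theta>_def)
    then have time: "wave_integral (time_deriv \<phi>) \<xi> = \<i> * (of_real ((norm \<xi>)\<^sup>2) + of_real direct - K \<xi>) * wave_integral \<phi> \<xi>"
      using wave_integral_time_deriv[OF \<phi>] by simp
    show ?thesis
      unfolding time wave_integral_laplacian[OF \<phi>] by (simp add: algebra_simps)
  qed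
  ultimately have "AE \<omega> in M. - \<i> * A \<omega> = ((-1) * B \<omega> + 1 * C \<omega>) - D \<omega>"
    using has_wiener_integral_unique by simp
  then show "\<exists>A B C D. has_pairing M Y (time_deriv \<phi>) A \<and> has_pairing M Y (space_laplacian \<phi>) B \<and>
      has_pairing M (\<lambda>t x \<omega>. of_real (direct_potential M w Y t x) * Y t x \<omega>) \<phi> C \<and>
      has_pairing M exchange_field \<phi> D \<and> (AE \<omega> in M. - \<i> * A \<omega> = - B \<omega> + C \<omega> - D \<omega>)"
    using A(1) B(1) C(1) D(1) by (intro exI[of _ A] exI[of _ B] exI[of _ C] exI[of _ D]) simp
qed

lemma gaussian_field_Y: "gaussian_field M Y"
  unfolding gaussian_field_def
  by (rule has_wiener_integral_gaussian_family[where h = "\<lambda>(t, x) \<xi>. phase t x \<xi> * of_real (f \<xi>)"])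
     (auto intro: has_wiener_integral_Y)

text \<open>
  A translation multiplies all integrands by the same function of modulus one, which leaves the
  norms of their linear combinations unchanged.
\<close>

lemma field_law_translate: "field_law M (\<lambda>t x. Y (t + s) (x + a)) = field_law M Y"
proof -
  define h where "h p \<xi> = phase (fst p) (snd p) \<xi> * of_real (f \<xi>)" for p :: "real \<times> (real ^ 'd)" and \<xi>
  define h' where "h' p \<xi> = phase (fst p + s) (snd p + a) \<xi> * of_real (f \<xi>)" for p :: "real \<times> (real ^ 'd)" and \<xi>
  have "distr M (\<Pi>\<^sub>M p\<in>UNIV. borel) (\<lambda>\<omega> p. Y (fst p + s) (snd p + a) \<omega>)
      = distr M (\<Pi>\<^sub>M p\<in>UNIV. borel) (\<lambda>\<omega> p. Y (fst p) (snd p) \<omega>)"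
  proof (rule wiener_law_eq)
    show "has_wiener_integral M W (h' p) (Y (fst p + s) (snd p + a))" for p
      unfolding h'_def by (rule has_wiener_integral_Y)
    show "has_wiener_integral M W (h p) (Y (fst p) (snd p))" for p
      unfolding h_def by (rule has_wiener_integral_Y)
    show "L2_norm lborel (\<lambda>\<xi>. \<Sum>p\<in>J. c p * h' p \<xi>) = L2_norm lborel (\<lambda>\<xi>. \<Sum>p\<in>J. c p * h p \<xi>)" for J c
    proof -
      have "(\<Sum>p\<in>J. c p * h' p \<xi>) = phase s a \<xi> * (\<Sum>p\<in>J. c p * h p \<xi>)" for \<xi>
        unfolding h'_def h_def phase_add sum_distrib_left by (intro sum.cong) (auto simp: mult_ac)
      then show ?thesis unfolding L2_norm_def by (simp add: norm_mult)
    qed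
  qed
  then show ?thesis by (simp add: field_law_def case_prod_beta')
qed

end

theorem mainTheorem2:
  fixes M :: "'w measure"
    and W :: "(real ^ 'd) set \<Rightarrow> 'w \<Rightarrow> complex"
    and w :: "(real ^ 'd) set \<Rightarrow> real"
    and f :: "real ^ 'd \<Rightarrow> real"
  assumes "prob_space M"
    and "complex_white_noise M W"
    and "finite_signed_measure w"
    and "even_signed_measure w"
    and "f \<in> borel_measurable borel"
    and "integrable lborel (\<lambda>\<xi>. (f \<xi>)\<^sup>2)"
    and "AE \<xi> in lborel. 0 \<le> f \<xi>"
  shows "is_solution M w (Y_field M W w f)
    \<and> gaussian_field M (Y_field M W w f)
    \<and> time_translation_invariant M (Y_field M W w f)
    \<and> space_translation_invariant M (Y_field M W w f)"
proof -
  interpret equilibrium M W f w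
    using assms by (intro equilibrium.intro white_noise.intro white_noise_axioms.intro
        square_density.intro equilibrium_axioms.intro)
  show ?thesis
    using is_solution_Y gaussian_field_Y field_law_translate[where a = 0] field_law_translate[where s = 0]
    by (simp add: time_translation_invariant_def space_translation_invariant_def)
qed

end
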